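(* Let $m,n\in\mathbb R$, $\mathcal B>0$, $q=m-n+1$. Let $h_{\rm ss}\in C^4(\mathbb R)$ be a non-constant positive periodic steady state of $h_t=-(h^nh_{xxx})_x-\mathcal B(h^mh_x)_x$ with least period $X$, and let $\overline{h_{\rm ss}}=\frac1X\int_0^Xh_{\rm ss}\,dx$ be its mean value (regarded as a constant function). Translate $h_{\rm ss}$ to put its minimum at $x=0$, so that $h_{\rm ss}$ rescales to $k_\alpha$ for some $\alpha\in(0,1)$ (rescaling as in the context). (1) If $q\ge2$ or $q<1$ then $\mathcal E(h_{\rm ss})>\mathcal E(\overline{h_{\rm ss}})$. (2) If $q=1$ then $\mathcal E(h_{\rm ss})=\mathcal E(\overline{h_{\rm ss}})$. (3) If $1<q<2$ and $E'>0$ on $(\alpha,1)$ then $\mathcal E(h_{\rm ss})>\mathcal E(\overline{h_{\rm ss}})$. (4) If $1<q<2$ and $E'<0$ on $(\alpha,1)$ then $\mathcal E(h_{\rm ss})<\mathcal E(\overline{h_{\rm ss}})$.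
   Context: A positive periodic steady state is a positive periodic $C^4$ function with $(h^nh'''+\mathcal B h^mh')'=0$ classically. Rescaling: a non-constant positive periodic steady state $h_{\rm ss}$ satisfies, for some constant $D$, $h_{\rm ss}''+\frac{\mathcal B h_{\rm ss}^q-D}{q}=0$ if $q\ne0$ (and then $D>0$), or $h_{\rm ss}''+\mathcal B\log h_{\rm ss}-D=0$ if $q=0$. With the minimum of $h_{\rm ss}$ at $x=0$, put $k(x)=(\mathcal B/D)^{1/q}\,h_{\rm ss}\big((D/\mathcal B)^{1/(2q)}D^{-1/2}x\big)$ if $q\neq0$, and $k(x)=e^{-D/\mathcal B}h_{\rm ss}\big(e^{D/(2\mathcal B)}\mathcal B^{-1/2}x\big)$ if $q=0$. Then $k=k_\alpha$ with $\alpha=\min k\in(0,1)$; this is what "$h_{\rm ss}$ rescales to $k_\alpha$" means. For $\alpha\in(0,1)$, $k_\alpha$ is the unique smooth positive periodic solution of $k''+\frac{k^q-1}{q}=0$ (if $q\ne0$) or $k''+\log k=0$ (if $q=0$) with $k(0)=\alpha$, $k'(0)=0$. $P(\alpha)$ is its least period, $A(\alpha)=\int_0^{P(\alpha)}k_\alpha\,dx$, and $E(\alpha)=P(\alpha)^{3-q}A(\alpha)^{q-1}$; these are smooth functions of $\alpha\in(0,1)$. Energy: for positive $X$-periodic $\ell\in H^1$, $\mathcal E(\ell)=\int_0^X[\frac12(\ell')^2-H(\ell)]dx$, where $H$ is a fixed function on $(0,\infty)$ with $H''(y)=\mathcal B y^{q-1}$. *)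

theory Defs
  imports "HOL-Analysis.Analysis" "HOL-Library.Periodic_Fun"
begin

definition periodic :: "(real \<Rightarrow> real) \<Rightarrow> bool" where
  "periodic f \<longleftrightarrow> (\<exists>T>0. periodic_fun_simple f T)"

definition is_least_period :: "(real \<Rightarrow> real) \<Rightarrow> real \<Rightarrow> bool" where
  "is_least_period f T \<longleftrightarrow>
     T > 0 \<and> periodic_fun_simple f T \<and> (\<forall>S. 0 < S \<and> S < T \<longrightarrow> \<not> periodic_fun_simple f S)"

definition C4 :: "(real \<Rightarrow> real) \<Rightarrow> bool" where
  "C4 f \<longleftrightarrow> (\<forall>j<4. \<forall>x. (deriv ^^ j) f differentiable (at x)) \<and> continuous_on UNIV ((deriv ^^ 4) f)"

definition smooth :: "(real \<Rightarrow> real) \<Rightarrow> bool" where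
  "smooth f \<longleftrightarrow> (\<forall>j x. (deriv ^^ j) f differentiable (at x))"

text \<open>Steady states of \<open>h\<^sub>t = -(h\<^sup>n h\<^sub>x\<^sub>x\<^sub>x)\<^sub>x - B (h\<^sup>m h\<^sub>x)\<^sub>x\<close>; the exponents are real, hence \<^const>\<open>powr\<close>.\<close>

definition positive_periodic_steady_state ::
    "real \<Rightarrow> real \<Rightarrow> real \<Rightarrow> (real \<Rightarrow> real) \<Rightarrow> bool" where
  "positive_periodic_steady_state m n B h \<longleftrightarrow>
     C4 h \<and> (\<forall>x. h x > 0) \<and> periodic h \<and>
     (\<forall>x. ((\<lambda>y. h y powr n * (deriv ^^ 3) h y + B * h y powr m * deriv h y)
             has_real_derivative 0) (at x))"

definition is_k :: "real \<Rightarrow> real \<Rightarrow> (real \<Rightarrow> real) \<Rightarrow> bool" where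
  "is_k q \<alpha> k \<longleftrightarrow>
     smooth k \<and> (\<forall>x. k x > 0) \<and> periodic k \<and>
     (\<forall>x. (deriv ^^ 2) k x + (if q = 0 then ln (k x) else (k x powr q - 1) / q) = 0) \<and>
     k 0 = \<alpha> \<and> deriv k 0 = 0"

text \<open>The definite descriptions below are meaningful for \<open>0 < \<alpha> < 1\<close>, where the solution exists,
  is unique and is not constant.\<close>

definition k_fun :: "real \<Rightarrow> real \<Rightarrow> real \<Rightarrow> real" where
  "k_fun q \<alpha> = (THE k. is_k q \<alpha> k)"

definition P_fun :: "real \<Rightarrow> real \<Rightarrow> real" where
  "P_fun q \<alpha> = (THE T. is_least_period (k_fun q \<alpha>) T)"

definition A_fun :: "real \<Rightarrow> real \<Rightarrow> real" where
  "A_fun q \<alpha> = integral {0..P_fun q \<alpha>} (k_fun q \<alpha>)"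

definition E_fun :: "real \<Rightarrow> real \<Rightarrow> real" where
  "E_fun q \<alpha> = P_fun q \<alpha> powr (3 - q) * A_fun q \<alpha> powr (q - 1)"

definition steady_ode :: "real \<Rightarrow> real \<Rightarrow> real \<Rightarrow> (real \<Rightarrow> real) \<Rightarrow> bool" where
  "steady_ode q B D h \<longleftrightarrow>
     (\<forall>x. (deriv ^^ 2) h x + (if q = 0 then B * ln (h x) - D else (B * h x powr q - D) / q) = 0)"

definition rescaling :: "real \<Rightarrow> real \<Rightarrow> real \<Rightarrow> (real \<Rightarrow> real) \<Rightarrow> real \<Rightarrow> real" where
  "rescaling q B D h x =
     (if q = 0
      then exp (- D / B) * h (exp (D / (2 * B)) * B powr (- 1 / 2) * x)
      else (B / D) powr (1 / q) * h ((D / B) powr (1 / (2 * q)) * D powr (- 1 / 2) * x))"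

text \<open>\<open>h\<close>, with its minimum at \<open>0\<close>, rescales to \<open>k\<^sub>\<alpha>\<close>. For positive periodic \<open>h\<close> and \<open>q \<noteq> 0\<close>
  the equation forces \<open>D > 0\<close>; stating it keeps \<^const>\<open>powr\<close> away from nonpositive bases.\<close>

definition rescales_to :: "real \<Rightarrow> real \<Rightarrow> (real \<Rightarrow> real) \<Rightarrow> real \<Rightarrow> bool" where
  "rescales_to q B h \<alpha> \<longleftrightarrow>
     (\<forall>x. h 0 \<le> h x) \<and>
     (\<exists>D. (q \<noteq> 0 \<longrightarrow> D > 0) \<and> steady_ode q B D h \<and> rescaling q B D h = k_fun q \<alpha>)"

definition mean_value :: "real \<Rightarrow> (real \<Rightarrow> real) \<Rightarrow> real" where
  "mean_value X h = 1 / X * integral {0..X} h"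

text \<open>Energy over one period \<open>X\<close>, with \<open>H\<close> any function satisfying \<open>H'' y = B y\<^bsup>q-1\<^esup>\<close> on \<open>(0,\<infinity>)\<close>.
  For \<open>H\<^sup>1\<close> functions the weak derivative is the almost everywhere defined classical one,
  represented here by \<^const>\<open>deriv\<close>.\<close>

definition energy :: "(real \<Rightarrow> real) \<Rightarrow> real \<Rightarrow> (real \<Rightarrow> real) \<Rightarrow> real" where
  "energy H X l = integral {0..X} (\<lambda>x. 1 / 2 * (deriv l x)\<^sup>2 - H (l x))"

end

theory Submission
  imports Defs
begin

text \<open>
  Let \<open>V'' y = y powr (q - 1)\<close> with \<open>V 1 = V' 1 = 0\<close>, so that \<open>k'' + V' k = 0\<close>. After rescaling, the
  energy difference is a positive multiple of \<open>\<integral> (k'\<^sup>2 / 2 - V k + V c)\<close> over one period \<open>P\<close>, where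
  \<open>c\<close> is the mean of \<open>k\<close>.

  If \<open>V''\<close> is convex (\<open>q \<ge> 2\<close> or \<open>q < 1\<close>), testing the equation against \<open>k - c\<close> and using the error
  of the trapezoidal rule bounds this integral below by \<open>(\<integral> k'\<^sup>2 - V'' c * \<integral> (k - c)\<^sup>2) / 6\<close>. By
  Wirtinger's inequality the bound is positive once \<open>V'' c < (2 * pi / P)\<^sup>2\<close>. For the latter, test
  \<open>k''' + V'' k * k' = 0\<close> against a sine and use the tangent of \<open>V''\<close> at \<open>c\<close>; the remainder has the
  right sign because the wave is steeper on the side where \<open>V'\<close> is steeper.

  For \<open>1 < q < 2\<close>, use the signed square root of \<open>V\<close> as coordinate: the orbits become circles, and
  the period and the action \<open>J = \<integral> k'\<^sup>2\<close> are differentiable in \<open>\<alpha>\<close> with \<open>dJ = P dV\<close>. Then the energy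
  difference \<open>S\<close> at fixed period satisfies \<open>dS = - w dE\<close> with a weight \<open>w > 0\<close> (since \<open>V' c < 0\<close> by
  Jensen), and \<open>S\<close> tends to \<open>0\<close> as \<open>\<alpha>\<close> tends to \<open>1\<close>.
\<close>

section \<open>The potential and its square root\<close>

text \<open>The classical period integral of \<open>1 / sqrt (2 * (V \<alpha> - V y))\<close> has
  singular, moving end points, so it cannot be differentiated under the integral sign; over the
  angle of the circle the range is fixed and the integrand is continuously differentiable in the
  amplitude. The same angle parametrises the solution itself, which gives global existence, evenness
  and periodicity at once. The mean is reached through a virial identity that expresses it by period
  and action. E enters through scaling: if X and M are the period and mass of a steady state, then E
  equals B * X^(3-q) * M^(q-1), so at fixed period a change of E is a change of mass. Steady states
  are critical points of the energy at fixed mass; hence along the family only the change of mass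
  moves the energy gap, with coefficient V' at the mean up to a positive factor. For 1 < q < 2 the
  function V'' is concave: the tangent inequalities of the convex case reverse while Wirtinger's
  inequality does not, so that argument yields no sign.\<close>

lemma integral_continuous_pos:
  fixes f :: "real \<Rightarrow> real"
  assumes "a < b" "continuous_on {a..b} f" "\<And>x. x \<in> {a..b} \<Longrightarrow> 0 \<le> f x" "c \<in> {a..b}" "f c > 0"
  shows "integral {a..b} f > 0"
proof -
  have "integral {a..b} f \<noteq> 0"
    using integral_eq_0_iff[OF assms(2,1,3)] assms(4,5) by force
  moreover have "integral {a..b} f \<ge> 0"
    using assms by (intro integral_nonneg integrable_continuous_interval) auto
  ultimately show ?thesis by linarith
qed

text \<open>The parameter enters the argument linearly, which covers both uses: segments from 1 to
  \<open>y\<close> (\<open>g t = t\<close>) for the quotients of the potential, and arcs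
  (\<open>g = cos\<close>) for period and action.\<close>

lemma DERIV_integral_linear_arg:
  fixes f f' w g :: "real \<Rightarrow> real"
  assumes der: "\<And>y. y \<in> I \<Longrightarrow> (f has_real_derivative f' y) (at y)"
    and contf': "continuous_on I f'"
    and w: "continuous_on {a..b} w" and g: "continuous_on {a..b} g"
    and U: "open U" "convex U" "x0 \<in> U"
    and sub: "\<And>x t. x \<in> U \<Longrightarrow> t \<in> {a..b} \<Longrightarrow> c + x * g t \<in> I"
  shows "((\<lambda>x. integral {a..b} (\<lambda>t. w t * f (c + x * g t))) has_real_derivative
           integral {a..b} (\<lambda>t. w t * g t * f' (c + x0 * g t))) (at x0)"
proof -
  have contf: "continuous_on I f"
    using der by (meson DERIV_continuous continuous_at_imp_continuous_on)
  have "((\<lambda>x. integral (cbox a b) (\<lambda>t. w t * f (c + x * g t))) has_real_derivative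
           integral (cbox a b) (\<lambda>t. w t * g t * f' (c + x0 * g t))) (at x0 within U)"
  proof (rule leibniz_rule_field_derivative[OF _ _ _ U(3,2)])
    fix x t assume x: "x \<in> U" and t: "t \<in> cbox a b"
    then have "c + x * g t \<in> I" using sub by simp
    then show "((\<lambda>x. w t * f (c + x * g t)) has_real_derivative w t * g t * f' (c + x * g t)) (at x within U)"
    proof -
      assume I: "c + x * g t \<in> I"
      have "((\<lambda>x. c + x * g t) has_real_derivative g t) (at x within U)"
        by (auto intro!: derivative_eq_intros)
      from DERIV_cmult[OF DERIV_chain2[OF der[OF I] this], of "w t"]
      show ?thesis by (simp add: mult_ac)
    qed
  next
    fix x assume x: "x \<in> U"
    have "continuous_on {a..b} (\<lambda>t. f (c + x * g t))"
      by (rule continuous_on_compose2[OF contf]) (use g sub[OF x] in \<open>auto intro!: continuous_intros\<close>)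
    then show "(\<lambda>t. w t * f (c + x * g t)) integrable_on cbox a b"
      using w by (intro integrable_continuous) (simp add: continuous_on_mult)
  next
    have g2: "continuous_on (U \<times> {a..b}) (\<lambda>p. g (snd p))"
      by (rule continuous_on_compose2[OF g continuous_on_snd[OF continuous_on_id]]) auto
    have w2: "continuous_on (U \<times> {a..b}) (\<lambda>p. w (snd p))"
      by (rule continuous_on_compose2[OF w continuous_on_snd[OF continuous_on_id]]) auto
    have c2: "continuous_on (U \<times> {a..b}) (\<lambda>p. c + fst p * g (snd p))"
      by (intro continuous_on_add continuous_on_mult continuous_on_const g2 continuous_on_fst[OF continuous_on_id])
    have f2: "continuous_on (U \<times> {a..b}) (\<lambda>p. f' (c + fst p * g (snd p)))"
    proof (rule continuous_on_compose2[OF contf' c2])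
      show "(\<lambda>p. c + fst p * g (snd p)) ` (U \<times> {a..b}) \<subseteq> I"
      proof (rule image_subsetI)
        fix p assume "p \<in> U \<times> {a..b}"
        then have "fst p \<in> U" "snd p \<in> {a..b}" by auto
        then show "c + fst p * g (snd p) \<in> I" by (rule sub)
      qed
    qed
    have "continuous_on (U \<times> {a..b}) (\<lambda>p. w (snd p) * g (snd p) * f' (c + fst p * g (snd p)))"
      by (intro continuous_on_mult g2 w2 f2)
    then show "continuous_on (U \<times> cbox a b) (\<lambda>(x, t). w t * g t * f' (c + x * g t))"
      unfolding case_prod_unfold cbox_interval .
  qed
  then show ?thesis
    unfolding at_within_open[OF U(3,1)] cbox_interval .
qed

section \<open>The normalised potential V = \<open>pot\<close> and its derivative V' =
  \<open>force\<close>\<close>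

definition force :: "real \<Rightarrow> real \<Rightarrow> real" where
  "force q y = (if q = 0 then ln y else (y powr q - 1) / q)"

text \<open>Written through \<open>y * force q y\<close>, the formula treats q = 0 together with the
  generic exponents; only q = -1, where the denominator vanishes, needs a formula of its
  own.\<close>

definition pot :: "real \<Rightarrow> real \<Rightarrow> real" where
  "pot q y = (if q = -1 then y - 1 - ln y else (y * force q y - y + 1) / (q + 1))"

lemma powr_eq_force: "y > 0 \<Longrightarrow> y powr q = 1 + q * force q y"
  by (simp add: force_def)

lemma DERIV_force: "y > 0 \<Longrightarrow> (force q has_real_derivative y powr (q - 1)) (at y)"
proof (cases "q = 0")
  case True
  assume "y > 0"
  then have "(ln has_real_derivative y powr (q - 1)) (at y)"
    using True by (auto intro!: derivative_eq_intros simp: powr_minus_divide)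
  moreover have "force q = ln" using True by (auto simp: force_def)
  ultimately show ?thesis by simp
next
  case False
  assume "y > 0"
  then have "((\<lambda>y. (y powr q - 1) / q) has_real_derivative y powr (q - 1)) (at y)"
    using False by (auto intro!: derivative_eq_intros)
  moreover have "force q = (\<lambda>y. (y powr q - 1) / q)" using False by (auto simp: force_def)
  ultimately show ?thesis by simp
qed

text \<open>An integrated form of \<open>y * V'' = 1 + q * V'\<close>, the homogeneity of V''. Both
  sides vanish at q = -1, so it is uniform in q. It is the source of the virial identity.\<close>

lemma pot_force: "y > 0 \<Longrightarrow> (q + 1) * pot q y = y * force q y - y + 1"
  by (auto simp: pot_def force_def powr_minus_divide right_diff_distrib)

lemma DERIV_pot: "y > 0 \<Longrightarrow> (pot q has_real_derivative force q y) (at y)"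
proof (cases "q = -1")
  case True
  assume y: "y > 0"
  then have "((\<lambda>y. y - 1 - ln y) has_real_derivative force q y) (at y)"
    using True by (auto intro!: derivative_eq_intros simp: force_def powr_minus_divide field_simps)
  moreover have "pot q = (\<lambda>y. y - 1 - ln y)" using True by (auto simp: pot_def)
  ultimately show ?thesis by simp
next
  case False
  assume y: "y > 0"
  have e: "y * y powr (q - 1) = 1 + q * force q y"
    using y powr_eq_force[OF y, of q] by (simp add: powr_diff)
  have "((\<lambda>y. (y * force q y - y + 1) / (q + 1)) has_real_derivative
     (force q y + y * y powr (q-1) - 1) / (q + 1)) (at y)"
    using DERIV_force[OF y] False by (auto intro!: derivative_eq_intros)
  moreover have "(force q y + y * y powr (q-1) - 1) / (q + 1) = force q y"
    unfolding e using False by (simp add: field_simps)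
  moreover have "pot q = (\<lambda>y. (y * force q y - y + 1) / (q + 1))" using False by (auto simp: pot_def)
  ultimately show ?thesis by simp
qed

lemma force_one [simp]: "force q 1 = 0" by (simp add: force_def)
lemma pot_one [simp]: "pot q 1 = 0" by (simp add: pot_def)

lemma continuous_on_pot: "continuous_on {0<..} (pot q)"
  by (meson DERIV_continuous DERIV_pot continuous_at_imp_continuous_on greaterThan_iff)

lemma force_strict_mono: "0 < x \<Longrightarrow> x < y \<Longrightarrow> force q x < force q y"
  by (rule DERIV_pos_imp_increasing) (auto intro!: exI conjI DERIV_force)

lemma force_neg: "0 < y \<Longrightarrow> y < 1 \<Longrightarrow> force q y < 0"
  using force_strict_mono[of y 1 q] by simp

lemma force_pos: "1 < y \<Longrightarrow> force q y > 0"
  using force_strict_mono[of 1 y q] by simp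

lemma force_eq_0_iff: "0 < y \<Longrightarrow> force q y = 0 \<longleftrightarrow> y = 1"
  by (metis force_neg force_one force_pos less_irrefl linorder_neqE_linordered_idom)

lemma pot_decreasing:
  assumes "0 < x" "x < y" "y \<le> 1" shows "pot q y < pot q x"
proof (rule DERIV_neg_imp_decreasing_open[where f = "pot q"])
  show "\<exists>d. (pot q has_real_derivative d) (at z) \<and> d < 0" if "x < z" "z < y" for z
    using that assms by (intro exI[of _ "force q z"] conjI DERIV_pot force_neg) auto
  show "continuous_on {x..y} (pot q)"
    using assms by (intro continuous_on_subset[OF continuous_on_pot]) auto
qed (use assms in auto)

lemma pot_increasing:
  assumes "1 \<le> x" "x < y" shows "pot q x < pot q y"
proof (rule DERIV_pos_imp_increasing_open[where f = "pot q"])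
  show "\<exists>d. (pot q has_real_derivative d) (at z) \<and> d > 0" if "x < z" "z < y" for z
    using that assms by (intro exI[of _ "force q z"] conjI DERIV_pot force_pos) auto
  show "continuous_on {x..y} (pot q)"
    using assms by (intro continuous_on_subset[OF continuous_on_pot]) auto
qed (use assms in auto)

lemma pot_nonneg: "0 < y \<Longrightarrow> 0 \<le> pot q y"
  using pot_decreasing[of y 1 q] pot_increasing[of 1 y q] by (cases y "1::real" rule: linorder_cases) auto

text \<open>V is convex, so beyond 2 it grows at least with slope \<open>force q 2\<close>. This
  makes the range of \<open>amp\<close> unbounded above; near 0 the potential may stay
  bounded.\<close>

lemma pot_unbounded: "\<exists>y>1. pot q y \<ge> M"
proof -
  let ?s = "force q 2"
  have s: "?s > 0" by (rule force_pos) simp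
  define y where "y = 2 + max 1 (M / ?s)"
  have y: "y > 2" "y - 2 \<ge> M / ?s" by (auto simp: y_def)
  have "\<exists>z. 2 < z \<and> z < y \<and> pot q y - pot q 2 = (y - 2) * force q z"
    using y by (intro MVT2) (auto intro!: DERIV_pot)
  then obtain z where z: "2 < z" "pot q y - pot q 2 = (y - 2) * force q z" by auto
  have "force q z \<ge> ?s" using force_strict_mono[of 2 z q] z by simp
  then have "(y - 2) * force q z \<ge> (y - 2) * ?s" using y by (intro mult_left_mono) auto
  moreover have "(y - 2) * ?s \<ge> M" using y s by (simp add: field_simps)
  moreover have "pot q 2 \<ge> 0" by (simp add: pot_nonneg)
  ultimately have "pot q y \<ge> M" using z(2) by linarith
  then show ?thesis using y by (intro exI[of _ y]) auto
qed

text \<open>Taylor's integral remainder at 1: the quotients V / (y - 1)^2 and, below, V' / (y - 1)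
  as integrals of V''. In this form they are positive and differentiable also at y = 1, where the
  fractions are undefined.\<close>

definition pot_quot :: "real \<Rightarrow> real \<Rightarrow> real" where
  "pot_quot q y = integral {0..1} (\<lambda>t. (1 - t) * (1 + (y - 1) * t) powr (q - 1))"

definition force_quot :: "real \<Rightarrow> real \<Rightarrow> real" where
  "force_quot q y = integral {0..1} (\<lambda>t. 1 * (1 + (y - 1) * t) powr (q - 1))"

lemma segment_pos:
  fixes y t :: real
  assumes "0 < y" "t \<in> {0..1}" shows "0 < 1 + (y - 1) * t"
proof (cases "t = 0")
  case False
  then have "0 < t * y" using assms by simp
  moreover have "0 \<le> 1 - t" using assms by simp
  ultimately have "0 < (1 - t) + t * y" by linarith
  then show ?thesis by (simp add: algebra_simps)
qed simp

lemma
  assumes y: "0 < y" and t: "t \<in> {0..1}"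
  shows DERIV_force_segment: "((\<lambda>t. force q (1 + (y - 1) * t)) has_real_derivative
      (y - 1) * (1 + (y - 1) * t) powr (q - 1)) (at t within {0..1})"
    and DERIV_pot_segment: "((\<lambda>t. pot q (1 + (y - 1) * t)) has_real_derivative
      (y - 1) * force q (1 + (y - 1) * t)) (at t within {0..1})"
proof -
  have p: "0 < 1 + (y - 1) * t" using y t by (rule segment_pos)
  have d: "((\<lambda>t. 1 + (y - 1) * t) has_real_derivative y - 1) (at t within {0..1})"
    by (auto intro!: derivative_eq_intros)
  show "((\<lambda>t. force q (1 + (y - 1) * t)) has_real_derivative
      (y - 1) * (1 + (y - 1) * t) powr (q - 1)) (at t within {0..1})"
    using DERIV_chain2[OF DERIV_force[OF p] d] by (simp add: mult.commute)
  show "((\<lambda>t. pot q (1 + (y - 1) * t)) has_real_derivative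
      (y - 1) * force q (1 + (y - 1) * t)) (at t within {0..1})"
    using DERIV_chain2[OF DERIV_pot[OF p] d] by (simp add: mult.commute)
qed

lemma force_eq_quot:
  assumes y: "0 < y" shows "force q y = (y - 1) * force_quot q y"
proof -
  have "((\<lambda>t. (y - 1) * (1 + (y - 1) * t) powr (q - 1)) has_integral
     (force q (1 + (y - 1) * 1) - force q (1 + (y - 1) * 0))) {0..1}"
    by (rule fundamental_theorem_of_calculus)
      (auto intro!: DERIV_force_segment y simp: has_real_derivative_iff_has_vector_derivative[symmetric])
  from integral_unique[OF this] show ?thesis unfolding force_quot_def by simp
qed

lemma pot_eq_quot:
  assumes y: "0 < y" shows "pot q y = (y - 1)\<^sup>2 * pot_quot q y"
proof -
  \<comment> \<open>One integration by parts of V'' along the segment from 1 to \<open>y\<close>: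
    \<open>?G\<close> vanishes at t = 0 and equals \<open>pot q y\<close> at t = 1.\<close>
  let ?G = "\<lambda>t. (1 - t) * (y - 1) * force q (1 + (y - 1) * t) + pot q (1 + (y - 1) * t)"
  have "((\<lambda>t. (y - 1)\<^sup>2 * ((1 - t) * (1 + (y - 1) * t) powr (q - 1))) has_integral (?G 1 - ?G 0)) {0..1}"
  proof (rule fundamental_theorem_of_calculus)
    fix t :: real assume t: "t \<in> {0..1}"
    have d: "((\<lambda>t. (1 - t) * (y - 1)) has_real_derivative - (y - 1)) (at t within {0..1})"
      by (auto intro!: derivative_eq_intros)
    from DERIV_add[OF DERIV_mult[OF d DERIV_force_segment[OF y t, of q]] DERIV_pot_segment[OF y t, of q]]
    show "(?G has_vector_derivative (y - 1)\<^sup>2 * ((1 - t) * (1 + (y - 1) * t) powr (q - 1))) (at t within {0..1})"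
      unfolding has_real_derivative_iff_has_vector_derivative[symmetric]
      by (simp add: power2_eq_square algebra_simps)
  qed auto
  from integral_unique[OF this] show ?thesis unfolding pot_quot_def by simp
qed

lemma quot_deriv:
  fixes w :: "real \<Rightarrow> real"
  assumes y: "0 < y" and w: "continuous_on {0..1} w"
  shows "((\<lambda>y. integral {0..1} (\<lambda>t. w t * (1 + (y - 1) * t) powr p)) has_real_derivative
      integral {0..1} (\<lambda>t. (w t * t) * (p * (1 + (y - 1) * t) powr (p - 1)))) (at y)"
proof -
  have "((\<lambda>x. integral {0..1} (\<lambda>t. w t * (1 + x * t) powr p)) has_real_derivative
      integral {0..1} (\<lambda>t. w t * t * (p * (1 + (y - 1) * t) powr (p - 1)))) (at (y - 1))"
  proof (rule DERIV_integral_linear_arg[where I = "{0<..}" and U = "{-1<..}"])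
    show "1 + x * t \<in> {0<..}" if "x \<in> {-1<..}" "t \<in> {0..1}" for x t :: real
      using segment_pos[of "x + 1" t] that by (simp add: algebra_simps)
  qed (use y w in \<open>auto intro!: derivative_eq_intros continuous_intros\<close>)
  then show ?thesis
    using DERIV_chain2[where g = "\<lambda>y. y - 1" and x = y and s = UNIV and Db = 1] 
    by (force intro!: derivative_eq_intros)
qed

definition pot_quot' :: "real \<Rightarrow> real \<Rightarrow> real" where
  "pot_quot' q y = integral {0..1} (\<lambda>t. ((1 - t) * t) * ((q - 1) * (1 + (y - 1) * t) powr (q - 1 - 1)))"

definition force_quot' :: "real \<Rightarrow> real \<Rightarrow> real" where
  "force_quot' q y = integral {0..1} (\<lambda>t. (1 * t) * ((q - 1) * (1 + (y - 1) * t) powr (q - 1 - 1)))"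

lemma DERIV_pot_quot: "0 < y \<Longrightarrow> (pot_quot q has_real_derivative pot_quot' q y) (at y)"
  unfolding pot_quot_def pot_quot'_def by (rule quot_deriv) (auto intro!: continuous_intros)

lemma DERIV_force_quot: "0 < y \<Longrightarrow> (force_quot q has_real_derivative force_quot' q y) (at y)"
  unfolding force_quot_def force_quot'_def by (rule quot_deriv) (auto intro!: continuous_intros)

text \<open>Each derivative is again an integral of the form treated by \<open>quot_deriv\<close>,
  with a new weight and the exponent lowered by one, so it is even differentiable.\<close>

lemma isCont_quot':
  assumes "0 < y" shows "isCont (pot_quot' q) y" "isCont (force_quot' q) y"
proof -
  have "continuous_on {0..1::real} (\<lambda>t. ((1 - t) * t) * (q - 1))" "continuous_on {0..1::real} (\<lambda>t. (1 * t) * (q - 1))"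
    by (auto intro!: continuous_intros)
  from this[THEN quot_deriv[OF assms, where p = "q - 1 - 1"], THEN DERIV_isCont]
  show "isCont (pot_quot' q) y" "isCont (force_quot' q) y"
    unfolding pot_quot'_def force_quot'_def by (simp_all only: mult.assoc)
qed

lemma quot_pos:
  assumes "0 < y" shows "0 < pot_quot q y" "0 < force_quot q y"
proof -
  have p: "0 < 1 + (y - 1) * t" if "t \<in> {0..1}" for t
    using segment_pos[OF assms that] .
  then have c: "continuous_on {0..1} (\<lambda>t. (1 + (y - 1) * t) powr (q - 1))"
    by (intro continuous_intros) (force simp: less_le)+
  show "0 < pot_quot q y" unfolding pot_quot_def
    by (rule integral_continuous_pos[where c = 0]) (auto intro!: continuous_on_mult continuous_intros c)
  show "0 < force_quot q y" unfolding force_quot_def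
    by (rule integral_continuous_pos[where c = 0]) (auto intro!: c)
qed

text \<open>Differentiate \<open>pot = (y - 1)^2 * pot_quot\<close> and cancel \<open>y - 1\<close>;
  at y = 1 this is impossible, and the two integrals are computed instead as 1 and 1/2. The relation
  eliminates \<open>pot_quot'\<close> from the derivative of \<open>amp\<close>.\<close>

lemma force_quot_eq:
  assumes y: "0 < y" shows "force_quot q y = 2 * pot_quot q y + (y - 1) * pot_quot' q y"
proof (cases "y = 1")
  case True
  have "((\<lambda>t. (1 - t) * (1 + (y - 1) * t) powr (q - 1)) has_integral ((\<lambda>t. t - t^2/2) 1 - (\<lambda>t. t - t^2/2) 0)) {0..1}"
    unfolding True
    by (rule fundamental_theorem_of_calculus)
      (auto simp: has_real_derivative_iff_has_vector_derivative[symmetric] intro!: derivative_eq_intros)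
  then have "pot_quot q y = 1/2" unfolding pot_quot_def by (simp add: integral_unique)
  moreover have "force_quot q y = 1" unfolding True force_quot_def by simp
  ultimately show ?thesis using True by simp
next
  case False
  have "((\<lambda>y. (y - 1)\<^sup>2 * pot_quot q y) has_real_derivative
      2 * (y - 1) * pot_quot q y + (y - 1)\<^sup>2 * pot_quot' q y) (at y)"
    using DERIV_pot_quot[OF y] by (auto intro!: derivative_eq_intros)
  moreover have "((\<lambda>y. (y - 1)\<^sup>2 * pot_quot q y) has_real_derivative force q y) (at y)"
    using DERIV_pot[OF y, of q]
    by (rule has_field_derivative_transform_within_open[where S = "{0<..}"]) (use y pot_eq_quot in auto)
  ultimately have "(y - 1) * force_quot q y = 2 * (y - 1) * pot_quot q y + (y - 1)\<^sup>2 * pot_quot' q y"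
    using DERIV_unique[of _ "force q y"] force_eq_quot[OF y] by fastforce
  then have "(y - 1) * force_quot q y = (y - 1) * (2 * pot_quot q y + (y - 1) * pot_quot' q y)"
    by (simp add: power2_eq_square algebra_simps)
  then show ?thesis using False by simp
qed

text \<open>A signed square root of the potential, smooth across its zero at \<open>1\<close>; in this coordinate
  the orbits of the equation are circles.\<close>

definition amp :: "real \<Rightarrow> real \<Rightarrow> real" where
  "amp q y = (y - 1) * sqrt (pot_quot q y)"

text \<open>The reciprocal of the derivative of \<open>amp\<close>: from \<open>amp^2 = V\<close>
  one gets \<open>amp' = V' / (2 * amp)\<close>. In terms of the two quotients it is positive and
  differentiable at 1 as well.\<close>

definition amp_rate :: "real \<Rightarrow> real \<Rightarrow> real" where
  "amp_rate q y = 2 * sqrt (pot_quot q y) / force_quot q y"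

lemma amp_sq: "0 < y \<Longrightarrow> (amp q y)\<^sup>2 = pot q y"
  using quot_pos[of y q] by (simp add: amp_def power_mult_distrib pot_eq_quot)

lemma amp_one [simp]: "amp q 1 = 0" by (simp add: amp_def)

lemma amp_rate_pos: "0 < y \<Longrightarrow> 0 < amp_rate q y"
  using quot_pos[of y q] by (simp add: amp_rate_def)

lemma force_amp_rate: "0 < y \<Longrightarrow> force q y * amp_rate q y = 2 * amp q y"
  using quot_pos[of y q] by (simp add: amp_rate_def amp_def force_eq_quot)

lemma DERIV_amp:
  assumes y: "0 < y" shows "(amp q has_real_derivative inverse (amp_rate q y)) (at y)"
proof -
  note p = quot_pos[OF y, of q]
  have "(amp q has_real_derivative sqrt (pot_quot q y) + (y - 1) * (pot_quot' q y * (inverse (sqrt (pot_quot q y)) / 2))) (at y)"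
    unfolding amp_def using DERIV_pot_quot[OF y, of q] p
    by (auto intro!: derivative_eq_intros)
  moreover have "sqrt (pot_quot q y) + (y - 1) * (pot_quot' q y * (inverse (sqrt (pot_quot q y)) / 2)) = inverse (amp_rate q y)"
  proof -
    define r where "r = sqrt (pot_quot q y)"
    have r: "r > 0" "pot_quot q y = r\<^sup>2" using p by (simp_all add: r_def)
    show ?thesis
      using r unfolding amp_rate_def force_quot_eq[OF y] r_def[symmetric] r(2)
      by (simp add: field_simps power2_eq_square)
  qed
  ultimately show ?thesis by simp
qed

definition amp_rate' :: "real \<Rightarrow> real \<Rightarrow> real" where
  "amp_rate' q y = (pot_quot' q y * inverse (sqrt (pot_quot q y)) * force_quot q y
      - 2 * sqrt (pot_quot q y) * force_quot' q y) / (force_quot q y * force_quot q y)"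

lemma DERIV_amp_rate:
  assumes y: "0 < y" shows "(amp_rate q has_real_derivative amp_rate' q y) (at y)"
  unfolding amp_rate_def amp_rate'_def
  using DERIV_pot_quot[OF y, of q] DERIV_force_quot[OF y, of q] quot_pos[OF y, of q]
  by (auto intro!: derivative_eq_intros)

lemma isCont_amp_rate: "0 < y \<Longrightarrow> isCont (amp_rate q) y"
  using DERIV_amp_rate DERIV_isCont by blast

lemma isCont_amp_rate': "0 < y \<Longrightarrow> isCont (amp_rate' q) y"
  unfolding amp_rate'_def
  using isCont_quot'[of y q] DERIV_isCont[OF DERIV_pot_quot] DERIV_isCont[OF DERIV_force_quot] quot_pos[of y q]
  by (intro continuous_intros) (auto simp: less_imp_neq)

lemma amp_strict_mono: "0 < x \<Longrightarrow> x < y \<Longrightarrow> amp q x < amp q y"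
  by (rule DERIV_pos_imp_increasing) (auto intro!: exI conjI DERIV_amp amp_rate_pos)

lemma isCont_amp: "0 < y \<Longrightarrow> isCont (amp q) y"
  using DERIV_amp DERIV_isCont by blast

lemma amp_inj: "inj_on (amp q) {0<..}"
  by (rule linorder_inj_onI') (metis amp_strict_mono greaterThan_iff less_irrefl)

text \<open>The intermediate value theorem, with right end point where \<open>pot\<close> has
  reached \<open>s^2\<close>. The lower bound \<open>b\<close> keeps \<open>s\<close> in the range:
  for q > -1 the potential is bounded near 0, so \<open>amp\<close> misses large negative
  values.\<close>

lemma amp_surj:
  assumes "0 < b" "amp q b < s" obtains y where "b < y" "amp q y = s"
proof -
  obtain z where z: "z > 1" "pot q z \<ge> s\<^sup>2" using pot_unbounded by blast
  have "amp q z > 0" using amp_strict_mono[of 1 z q] z by simp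
  moreover have "(amp q z)\<^sup>2 \<ge> s\<^sup>2" using z amp_sq[of z q] by simp
  ultimately have zs: "amp q z \<ge> s"
    using power2_le_imp_le[of s "amp q z"] by auto
  then have "amp q b < amp q z" using assms by simp
  then have bz: "b < z" using amp_strict_mono[of z b q] z by (cases b z rule: linorder_cases) auto
  have "\<exists>y. b \<le> y \<and> y \<le> z \<and> amp q y = s"
    by (rule IVT) (use assms zs bz in \<open>auto intro: isCont_amp\<close>)
  then show ?thesis using assms that by (metis less_irrefl order_less_le)
qed

text \<open>The inverse of the coordinate \<open>amp\<close>. Its value off the range of
  \<open>amp\<close> is arbitrary, hence the hypothesis \<open>amp q b < s\<close> from here
  on.\<close>

definition profile :: "real \<Rightarrow> real \<Rightarrow> real" where
  "profile q = inv_into {0<..} (amp q)"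

lemma profile_amp: "0 < y \<Longrightarrow> profile q (amp q y) = y"
  by (simp add: profile_def amp_inj inv_into_f_f)

lemma profile_gt:
  assumes "0 < b" "amp q b < s" shows "b < profile q s" "amp q (profile q s) = s"
  using amp_surj[OF assms] assms(1) profile_amp by (metis order_less_trans)+

lemma DERIV_profile:
  assumes "0 < b" "amp q b < s"
  shows "(profile q has_real_derivative amp_rate q (profile q s)) (at s)"
proof -
  define y where "y = profile q s"
  have y: "0 < y" "amp q y = s" using profile_gt[OF assms] assms by (auto simp: y_def)
  have "(amp q has_derivative (\<lambda>h. inverse (amp_rate q y) * h)) (at y)"
    using DERIV_amp[OF y(1), of q] by (simp add: has_field_derivative_def)
  then have "(profile q has_derivative (\<lambda>h. amp_rate q y * h)) (at (amp q y))"
    by (intro has_derivative_inverse_strong[where S = "{0<..}" and f = "amp q"])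
      (use y amp_rate_pos[OF y(1), of q] in
        \<open>auto intro!: profile_amp continuous_at_imp_continuous_on isCont_amp simp: fun_eq_iff\<close>)
  then show ?thesis using y by (simp add: y_def has_field_derivative_def)
qed

lemma DERIV_amp_rate_profile:
  assumes "0 < b" "amp q b < s"
  shows "((\<lambda>s. amp_rate q (profile q s)) has_real_derivative
      amp_rate' q (profile q s) * amp_rate q (profile q s)) (at s)"
  using DERIV_chain2[OF DERIV_amp_rate DERIV_profile[OF assms]] profile_gt[OF assms] assms by auto

section \<open>Existence and uniqueness of the waves\<close>

text \<open>Gronwall's argument for the squared distance \<open>N\<close> of the two orbits in the
  phase plane. \<open>force\<close> is Lipschitz only away from 0 and infinity, so its constant is
  taken on a compact interval that contains both solutions over \<open>{0..x}\<close>.\<close>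

lemma force_ode_unique_aux:
  assumes k: "\<And>x. 0 < k x" "\<And>x. (k has_real_derivative kd x) (at x)"
      "\<And>x. (kd has_real_derivative - force q (k x)) (at x)"
    and l: "\<And>x. 0 < l x" "\<And>x. (l has_real_derivative ld x) (at x)"
      "\<And>x. (ld has_real_derivative - force q (l x)) (at x)"
    and init: "k 0 = l 0" "kd 0 = ld 0" and x: "0 \<le> x"
  shows "k x = l x"
proof -
  have contk: "continuous_on {0..x} k" and contl: "continuous_on {0..x} l"
    by (rule DERIV_continuous_on[OF has_field_derivative_at_within[OF k(2)]],
        rule DERIV_continuous_on[OF has_field_derivative_at_within[OF l(2)]])
  define S where "S = k ` {0..x} \<union> l ` {0..x}"
  have S: "compact S" "S \<noteq> {}" "S \<subseteq> {0<..}"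
    using x k(1) l(1) unfolding S_def
    by (auto intro!: compact_Un compact_continuous_image contk contl)
  obtain m where m: "m \<in> S" "\<And>y. y \<in> S \<Longrightarrow> m \<le> y" using compact_attains_inf[OF S(1,2)] by auto
  obtain M where M: "M \<in> S" "\<And>y. y \<in> S \<Longrightarrow> y \<le> M" using compact_attains_sup[OF S(1,2)] by auto
  have mpos: "0 < m" using m S by auto
  have "continuous_on {m..M} (\<lambda>y. y powr (q - 1))"
    using mpos by (intro continuous_intros) auto
  then have "bounded ((\<lambda>y. y powr (q - 1)) ` {m..M})"
    by (intro compact_imp_bounded compact_continuous_image) auto
  then obtain K where K: "\<And>y. y \<in> {m..M} \<Longrightarrow> norm (y powr (q - 1)) \<le> K"
    unfolding bounded_iff by fastforce
  have lip: "\<bar>force q a - force q b\<bar> \<le> K * \<bar>a - b\<bar>" if "a \<in> S" "b \<in> S" for a b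
  proof -
    have "norm (force q a - force q b) \<le> K * norm (a - b)"
    proof (rule field_differentiable_bound[where S = "{m..M}"])
      show "(force q has_field_derivative y powr (q - 1)) (at y within {m..M})" if "y \<in> {m..M}" for y
        using that mpos by (auto intro: has_field_derivative_at_within[OF DERIV_force])
    qed (use K m M that in auto)
    then show ?thesis by simp
  qed
  have Kpos: "0 \<le> K" using K[of m] m M by (meson atLeastAtMost_iff norm_ge_zero order.trans order_refl)
  define N where "N t = (k t - l t)\<^sup>2 + (kd t - ld t)\<^sup>2" for t
  define N' where "N' t = 2 * (k t - l t) * (kd t - ld t) - 2 * (kd t - ld t) * (force q (k t) - force q (l t))" for t
  \<comment> \<open>Collects \<open>2uv \<le> u^2 + v^2\<close> and
    \<open>2K|u||v| \<le> K(u^2 + v^2)\<close>.\<close>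
  define C where "C = 1 + K"
  have N: "(N has_real_derivative N' t) (at t)" for t
    unfolding N_def N'_def
    using DERIV_add[OF DERIV_power[OF DERIV_diff[OF k(2)[of t] l(2)[of t]], of 2]
        DERIV_power[OF DERIV_diff[OF k(3)[of t] l(3)[of t]], of 2]]
    by (simp add: algebra_simps)
  have bound: "N' t \<le> C * N t" if t: "t \<in> {0..x}" for t
  proof -
    define u where "u = k t - l t"
    define v where "v = kd t - ld t"
    define w where "w = force q (k t) - force q (l t)"
    have "\<bar>w\<bar> \<le> K * \<bar>u\<bar>" unfolding u_def w_def by (rule lip) (use t in \<open>auto simp: S_def\<close>)
    then have "\<bar>v\<bar> * \<bar>w\<bar> \<le> \<bar>v\<bar> * (K * \<bar>u\<bar>)" by (intro mult_left_mono) auto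
    then have 1: "- (v * w) \<le> K * (\<bar>u\<bar> * \<bar>v\<bar>)"
      using abs_ge_minus_self[of "v * w"] by (simp add: abs_mult algebra_simps)
    have "0 \<le> (\<bar>u\<bar> - \<bar>v\<bar>)\<^sup>2" by simp
    then have 2: "2 * (\<bar>u\<bar> * \<bar>v\<bar>) \<le> u\<^sup>2 + v\<^sup>2" by (simp add: power2_diff)
    have 3: "u * v \<le> \<bar>u\<bar> * \<bar>v\<bar>" by (metis abs_ge_self abs_mult)
    have "K * (2 * (\<bar>u\<bar> * \<bar>v\<bar>)) \<le> K * (u\<^sup>2 + v\<^sup>2)" using 2 Kpos by (intro mult_left_mono) auto
    then have "2 * u * v - 2 * v * w \<le> (1 + K) * (u\<^sup>2 + v\<^sup>2)"
      using 1 2 3 by (simp add: algebra_simps)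
    then show ?thesis unfolding N'_def N_def C_def u_def v_def w_def .
  qed
  have "N x * exp (- C * x) \<le> N 0 * exp (- C * 0)"
  proof (rule DERIV_nonpos_imp_nonincreasing[OF x])
    fix t assume "0 \<le> t" "t \<le> x"
    then have "N' t - C * N t \<le> 0" using bound[of t] by auto
    then have "(N' t - C * N t) * exp (- C * t) \<le> 0" by (simp add: mult_nonpos_nonneg)
    moreover have "((\<lambda>t. N t * exp (- C * t)) has_real_derivative (N' t - C * N t) * exp (- C * t)) (at t)"
      by (rule derivative_eq_intros N | simp add: algebra_simps)+
    ultimately show "\<exists>d. ((\<lambda>t. N t * exp (- C * t)) has_real_derivative d) (at t) \<and> d \<le> 0" by blast
  qed
  then have "N x \<le> 0" using init by (simp add: N_def mult_le_0_iff)
  then have "(k x - l x)\<^sup>2 \<le> 0" unfolding N_def by (smt (verit) zero_le_power2)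
  then show ?thesis by simp
qed

text \<open>The equation has no first-order term and is therefore invariant under reflection, which
  reduces negative arguments to positive ones.\<close>

lemma force_ode_unique:
  assumes k: "\<And>x. 0 < k x" "\<And>x. (k has_real_derivative kd x) (at x)"
      "\<And>x. (kd has_real_derivative - force q (k x)) (at x)"
    and l: "\<And>x. 0 < l x" "\<And>x. (l has_real_derivative ld x) (at x)"
      "\<And>x. (ld has_real_derivative - force q (l x)) (at x)"
    and init: "k 0 = l 0" "kd 0 = ld 0"
  shows "k = l"
proof
  fix x
  have refl: "((\<lambda>x. f (- x)) has_real_derivative - f' (- x)) (at x)"
    if "\<And>x. (f has_real_derivative f' x) (at x)" for f f' :: "real \<Rightarrow> real" and x
    using that[of "- x"] by (simp add: DERIV_mirror)
  show "k x = l x"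
  proof (cases "0 \<le> x")
    case True
    show ?thesis by (rule force_ode_unique_aux[OF k l init True])
  next
    case False
    have "(\<lambda>x. k (- x)) (- x) = (\<lambda>x. l (- x)) (- x)"
    proof (rule force_ode_unique_aux[where k = "\<lambda>x. k (- x)" and l = "\<lambda>x. l (- x)" and q = q
          and kd = "\<lambda>x. - kd (- x)" and ld = "\<lambda>x. - ld (- x)"])
      show "((\<lambda>x. - kd (- x)) has_real_derivative - force q (k (- x))) (at x)" for x
        using DERIV_minus[OF refl[OF k(3), of x]] by simp
      show "((\<lambda>x. - ld (- x)) has_real_derivative - force q (l (- x))) (at x)" for x
        using DERIV_minus[OF refl[OF l(3), of x]] by simp
    qed (use k(1) l(1) init False in \<open>auto intro!: refl k(2) l(2)\<close>)
    then show ?thesis by simp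
  qed
qed

lemma DERIV_global_inverse:
  fixes f g :: "real \<Rightarrow> real"
  assumes "\<And>x. (f has_real_derivative f' x) (at x)" "f' (g y) \<noteq> 0"
    and "\<And>x. g (f x) = x" "f (g y) = y"
  shows "(g has_real_derivative inverse (f' (g y))) (at y)"
proof -
  have "(f has_derivative (\<lambda>h. f' (g y) * h)) (at (g y))"
    using assms(1)[of "g y"] by (simp add: has_field_derivative_def)
  then have "(g has_derivative (\<lambda>h. inverse (f' (g y)) * h)) (at (f (g y)))"
    by (intro has_derivative_inverse_strong[where S = UNIV and f = f])
      (use assms in \<open>auto intro!: continuous_at_imp_continuous_on DERIV_isCont simp: fun_eq_iff\<close>)
  then show ?thesis using assms by (simp add: has_field_derivative_def)
qed

text \<open>Half the period as an integral over the angle: put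
  \<open>k = profile q (a * cos t)\<close> with \<open>a = amp q \<beta>\<close>. Conservation of
  energy gives \<open>k' = - sqrt 2 * a * sin t\<close>, hence
  \<open>dx = amp_rate / sqrt 2 dt\<close>. The action below is the integral of \<open>k'^2\<close>
  in the same variable.\<close>

definition half_period :: "real \<Rightarrow> real \<Rightarrow> real" where
  "half_period q \<beta> = integral {0..pi} (\<lambda>t. 1 / sqrt 2 * amp_rate q (profile q (amp q \<beta> * cos t)))"

definition half_action :: "real \<Rightarrow> real \<Rightarrow> real" where
  "half_action q \<beta> = 2 * (amp q \<beta>)\<^sup>2 *
     integral {0..pi} (\<lambda>t. ((sin t)\<^sup>2 / sqrt 2) * amp_rate q (profile q (amp q \<beta> * cos t)))"

text \<open>A solution with its minimum \<beta> at 0 and its next critical point at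
  \<open>L\<close>, half the period. Evenness and periodicity reduce every integral to
  \<open>{0..L}\<close>, where \<open>k\<close> is increasing.\<close>

locale wave =
  fixes q \<beta> L :: real and k kd :: "real \<Rightarrow> real"
  assumes L_pos: "0 < L" and \<beta>_pos: "0 < \<beta>" and \<beta>_less: "\<beta> < 1"
    and k_pos: "\<And>x. 0 < k x"
    and DERIV_k: "\<And>x. (k has_real_derivative kd x) (at x)"
    and DERIV_kd: "\<And>x. (kd has_real_derivative - force q (k x)) (at x)"
    and k_0: "k 0 = \<beta>" and kd_0: "kd 0 = 0" and kd_L: "kd L = 0"
    and kd_pos: "\<And>x. 0 < x \<Longrightarrow> x < L \<Longrightarrow> 0 < kd x"
    and k_even: "\<And>x. k (- x) = k x" and k_period: "\<And>x. k (x + 2 * L) = k x"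

lemma amp_neg: "0 < \<beta> \<Longrightarrow> \<beta> < 1 \<Longrightarrow> amp q \<beta> < 0"
  using amp_strict_mono[of \<beta> 1 q] by simp

lemma amp_times_cos:
  assumes "0 < \<beta>" "\<beta> < 1" "b < \<beta>" "0 < b" "u \<le> 1"
  shows "amp q b < amp q \<beta> * u"
proof -
  have "amp q \<beta> * 1 \<le> amp q \<beta> * u" using amp_neg[OF assms(1,2), of q] assms(5) by (intro mult_left_mono_neg) auto
  then show ?thesis using amp_strict_mono[OF assms(4,3), of q] by simp
qed

text \<open>The time \<open>tau\<close> is obtained as a function of the angle and then inverted to
  \<open>T\<close>; \<open>profile q (a * cos (T x))\<close> is the solution. Its symmetries are
  those of the cosine, and it is global because \<open>tau\<close> is onto.\<close>

lemma wave_exists: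
  assumes \<beta>: "0 < \<beta>" "\<beta> < 1"
  obtains k kd where "wave q \<beta> (half_period q \<beta>) k kd"
    "integral {0..half_period q \<beta>} (\<lambda>x. (kd x)\<^sup>2) = half_action q \<beta>"
proof -
  define a where "a = amp q \<beta>"
  have a: "a < 0" unfolding a_def by (rule amp_neg[OF \<beta>])
  have b: "0 < \<beta> / 2" "amp q (\<beta> / 2) < a * u" if "u \<le> 1" for u
    using amp_times_cos[OF \<beta>, of "\<beta> / 2" u q] \<beta> that by (auto simp: a_def)
  define r where "r u = amp_rate q (profile q (a * u))" for u
  have prof_pos: "0 < profile q (a * u)" "amp q (profile q (a * u)) = a * u" if "u \<le> 1" for u
    using profile_gt[OF b[OF that]] \<beta> by auto
  have r_pos: "0 < r u" if "u \<le> 1" for u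
    unfolding r_def by (rule amp_rate_pos) (rule prof_pos[OF that])
  have r_cont: "isCont r u" if "u \<le> 1" for u
  proof -
    have "isCont (\<lambda>s. amp_rate q (profile q s)) (a * u)"
      using DERIV_amp_rate_profile[OF b[OF that]] by (rule DERIV_isCont)
    moreover have "isCont (\<lambda>u. a * u) u" by simp
    ultimately show ?thesis unfolding r_def by (rule isCont_o2[rotated])
  qed
  \<comment> \<open>The derivative of time with respect to the angle; it is even and
    \<open>2 * pi\<close>-periodic because it depends on \<open>cos t\<close> only.\<close>
  define g where "g t = 1 / sqrt 2 * r (cos t)" for t
  have g_pos: "0 < g t" for t using r_pos[of "cos t"] by (simp add: g_def)
  have g_cont: "isCont g t" for t
    unfolding g_def using r_cont[of "cos t"]
    by (intro continuous_intros) (rule isCont_o2[where g = r and f = cos], auto)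
  have g_even: "g (- t) = g t" and g_per: "g (t + 2 * pi) = g t" for t by (simp_all add: g_def)
  obtain F where F: "\<And>t. (F has_vector_derivative g t) (at t)"
    using einterval_antiderivative[of "-\<infinity>" "\<infinity>" g] g_cont by auto
  define tau where "tau t = F t - F 0" for t
  have tau: "(tau has_real_derivative g t) (at t)" for t
    unfolding tau_def has_real_derivative_iff_has_vector_derivative using F
    by (auto intro!: derivative_eq_intros)
  have tau_0: "tau 0 = 0" by (simp add: tau_def)
  have tau_odd: "tau (- t) = - tau t" for t
  proof -
    have "((\<lambda>t. tau t + tau (- t)) has_real_derivative 0) (at t)" for t
      using DERIV_add[OF tau[of t] DERIV_mirror[THEN iffD1, OF tau[of "- t"]]] g_even[of t] by simp
    then have "tau t + tau (- t) = tau 0 + tau (- 0)"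
      using DERIV_isconst_all[of "\<lambda>t. tau t + tau (- t)"] by blast
    then show ?thesis by (simp add: tau_0)
  qed
  have tau_per: "tau (t + 2 * pi) = tau t + 2 * tau pi" for t
  proof -
    have "((\<lambda>t. tau (t + 2 * pi) - tau t) has_real_derivative 0) (at t)" for t
      using DERIV_diff[OF DERIV_shift[THEN iffD1, OF tau[of "t + 2 * pi"]] tau[of t]] g_per[of t] by simp
    then have "tau (t + 2 * pi) - tau t = tau (- pi + 2 * pi) - tau (- pi)"
      using DERIV_isconst_all[of "\<lambda>t. tau (t + 2 * pi) - tau t"] by blast
    then show ?thesis by (simp add: tau_odd)
  qed
  have tau_mono: "tau s < tau t" if "s < t" for s t
    by (rule DERIV_pos_imp_increasing[OF that]) (auto intro!: exI conjI tau g_pos)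
  \<comment> \<open>A positive lower bound of the speed makes \<open>tau\<close> unbounded, so that
    its inverse is defined on the whole line.\<close>
  obtain m where m: "0 < m" "\<And>t. m \<le> g t"
  proof -
    have "continuous_on {-1..1} r" using r_cont by (intro continuous_at_imp_continuous_on) auto
    then obtain u where u: "u \<in> {-1..1}" "\<And>v. v \<in> {-1..1} \<Longrightarrow> r u \<le> r v"
      using continuous_attains_inf[of "{-1..1}" r] by auto
    have "1 / sqrt 2 * r u \<le> g t" for t
      unfolding g_def using u(2)[of "cos t"] by (intro mult_left_mono) auto
    moreover have "0 < 1 / sqrt 2 * r u" using r_pos[of u] u by simp
    ultimately show ?thesis using that by blast
  qed
  have tau_ge: "m * t \<le> tau t" if "0 \<le> t" for t
  proof -
    have "tau 0 - m * 0 \<le> tau t - m * t"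
    proof (rule DERIV_nonneg_imp_nondecreasing[OF that])
      show "\<exists>d. ((\<lambda>t. tau t - m * t) has_real_derivative d) (at s) \<and> 0 \<le> d" for s
        using m(2)[of s] by (intro exI[of _ "g s - m"]) (auto intro!: derivative_eq_intros tau)
    qed
    then show ?thesis by (simp add: tau_0)
  qed
  have surj0: "\<exists>t. tau t = x" if "0 \<le> x" for x
  proof -
    have "x \<le> tau (x / m)" using tau_ge[of "x / m"] that m by simp
    then have "\<exists>t. 0 \<le> t \<and> t \<le> x / m \<and> tau t = x"
      by (intro IVT) (use that m in \<open>auto simp: tau_0 intro: DERIV_isCont[OF tau]\<close>)
    then show ?thesis by blast
  qed
  have surj: "\<exists>t. tau t = x" for x
    using surj0[of x] surj0[of "- x"] tau_odd by (metis linear neg_0_le_iff_le minus_minus)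
  have tau_inj: "tau s = tau t \<Longrightarrow> s = t" for s t using tau_mono by (metis less_irrefl linorder_cases)
  define T where "T = inv tau"
  have T: "tau (T x) = x" "T (tau t) = t" for x t
    using surj tau_inj unfolding T_def by (metis f_inv_into_f rangeI, metis injI inv_f_f)
  have DERIV_T: "(T has_real_derivative inverse (g (T x))) (at x)" for x
    by (rule DERIV_global_inverse[OF tau _ T(2,1)]) (use g_pos in \<open>simp add: less_imp_neq[symmetric]\<close>)
  have T_mono: "T x < T y" if "x < y" for x y
    using that tau_mono[of "T y" "T x"] T(1) by (metis less_asym linorder_neqE_linordered_idom)
  have T_odd: "T (- x) = - T x" for x by (metis T tau_odd)
  have T_per: "T (x + 2 * tau pi) = T x + 2 * pi" for x by (metis T tau_per)
  have T_0: "T 0 = 0" by (metis T(2) tau_0)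
  \<comment> \<open>The circle of the orbit: \<open>pot q (k x) = (a * cos (T x))^2\<close> and
    \<open>(kd x)^2 / 2 = (a * sin (T x))^2\<close>. Since \<open>a\<close> is negative, angle 0 is
    the minimum.\<close>
  define k where "k x = profile q (a * cos (T x))" for x
  define kd where "kd x = - sqrt 2 * a * sin (T x)" for x
  have DERIV_k: "(k has_real_derivative kd x) (at x)" for x
  proof -
    have r: "r (cos (T x)) \<noteq> 0" using r_pos[of "cos (T x)"] by simp
    have d1: "(profile q has_real_derivative r (cos (T x))) (at (a * cos (T x)))"
      unfolding r_def by (rule DERIV_profile[OF b]) auto
    have d2: "((\<lambda>x. a * cos (T x)) has_real_derivative a * (- sin (T x) * inverse (g (T x)))) (at x)"
      by (auto intro!: derivative_eq_intros DERIV_T)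
    have "(k has_real_derivative r (cos (T x)) * (a * (- sin (T x) * inverse (g (T x))))) (at x)"
      using DERIV_chain2[OF d1 d2] by (simp add: k_def[abs_def])
    moreover have "r (cos (T x)) * (a * (- sin (T x) * inverse (g (T x)))) = kd x"
      using r by (simp add: g_def kd_def field_simps)
    ultimately show ?thesis by simp
  qed
  have DERIV_kd: "(kd has_real_derivative - force q (k x)) (at x)" for x
  proof -
    have r: "r (cos (T x)) > 0" using r_pos[of "cos (T x)"] by simp
    have "force q (k x) * r (cos (T x)) = 2 * (a * cos (T x))"
      unfolding k_def r_def using force_amp_rate prof_pos[of "cos (T x)"] by simp
    then have e: "force q (k x) = 2 * (a * cos (T x)) / r (cos (T x))" using r by (simp add: field_simps)
    have "(kd has_real_derivative - sqrt 2 * a * (cos (T x) * inverse (g (T x)))) (at x)"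
      unfolding kd_def by (auto intro!: derivative_eq_intros DERIV_T)
    moreover have "- sqrt 2 * a * (cos (T x) * inverse (g (T x))) = - force q (k x)"
      unfolding e g_def using r by (simp add: field_simps)
    ultimately show ?thesis by simp
  qed
  have int: "((\<lambda>t. g t *\<^sub>R f (tau t)) has_integral integral {0..tau pi} f) {0..pi}"
    if f: "continuous_on {0..tau pi} f" for f :: "real \<Rightarrow> real"
  proof -
    have "strict_mono tau" using tau_mono by (rule strict_monoI)
    then have sub: "tau ` {0..pi} \<subseteq> {0..tau pi}"
      using tau_0 by (metis atLeastAtMost_iff image_subsetI strict_mono_less_eq)
    have le: "tau 0 \<le> tau pi" using tau_mono[of 0 pi] by simp
    from has_integral_substitution[OF pi_ge_zero le sub f has_field_derivative_at_within[OF tau]]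
    show ?thesis by (simp only: tau_0)
  qed
  have L: "tau pi = half_period q \<beta>"
  proof -
    have "integral {0..tau pi} (\<lambda>_. 1) = tau pi" using tau_mono[of 0 pi] tau_0 by simp
    then show ?thesis using integral_unique[OF int[of "\<lambda>_. 1"]]
      by (simp add: half_period_def g_def[abs_def] r_def a_def)
  qed
  have J: "integral {0..tau pi} (\<lambda>x. (kd x)\<^sup>2) = half_action q \<beta>"
  proof -
    have "continuous_on {0..tau pi} (\<lambda>x. (kd x)\<^sup>2)"
      by (intro continuous_on_power continuous_at_imp_continuous_on ballI DERIV_isCont[OF DERIV_kd])
    from integral_unique[OF int[OF this]]
    have "integral {0..tau pi} (\<lambda>x. (kd x)\<^sup>2) = integral {0..pi} (\<lambda>t. g t * (kd (tau t))\<^sup>2)" by simp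
    also have "\<dots> = integral {0..pi} (\<lambda>t. 2 * a\<^sup>2 * (((sin t)\<^sup>2 / sqrt 2) * amp_rate q (profile q (a * cos t))))"
      by (intro integral_cong) (simp add: kd_def T g_def r_def power_mult_distrib)
    also have "\<dots> = half_action q \<beta>" by (simp add: half_action_def a_def)
    finally show ?thesis .
  qed
  have "wave q \<beta> (half_period q \<beta>) k kd"
    unfolding L[symmetric]
  proof
    show "0 < tau pi" using tau_mono[of 0 pi] tau_0 by simp
    show "k 0 = \<beta>" using \<beta> by (simp add: k_def T_0 a_def profile_amp)
    show "kd 0 = 0" "kd (tau pi) = 0" by (simp_all add: kd_def T T_0)
    show "0 < kd x" if "0 < x" "x < tau pi" for x
    proof -
      have "0 < sin (T x)" using T_mono[OF that(1)] T_mono[OF that(2)] by (intro sin_gt_zero) (auto simp: T T_0)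
      then show ?thesis using a by (simp add: kd_def mult_neg_pos mult_pos_neg)
    qed
    show "k (- x) = k x" "k (x + 2 * tau pi) = k x" for x by (simp_all add: k_def T_odd T_per)
    show "0 < k x" for x using prof_pos[of "cos (T x)"] by (simp add: k_def)
  qed (use \<beta> DERIV_k DERIV_kd in auto)
  then show ?thesis using J L that by metis
qed

section \<open>Integral inequalities\<close>

lemma has_integral_DERIV:
  fixes F f :: "real \<Rightarrow> real"
  assumes "a \<le> b" "\<And>x. a \<le> x \<Longrightarrow> x \<le> b \<Longrightarrow> (F has_real_derivative f x) (at x)"
  shows "(f has_integral (F b - F a)) {a..b}"
  using assms by (intro fundamental_theorem_of_calculus)
    (auto simp: has_real_derivative_iff_has_vector_derivative[symmetric] intro: has_field_derivative_at_within)

lemma DERIV_reflect: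
  fixes f :: "real \<Rightarrow> real"
  assumes "(f has_real_derivative D) (at (a - x))"
  shows "((\<lambda>x. f (a - x)) has_real_derivative - D) (at x)"
proof -
  have "((\<lambda>x. a - x) has_real_derivative - 1) (at x)" by (auto intro!: derivative_eq_intros)
  from DERIV_chain2[where f = f and g = "\<lambda>x. a - x", OF assms this] show ?thesis by simp
qed

lemma integral_fold:
  fixes f :: "real \<Rightarrow> real"
  assumes "0 \<le> M" "continuous_on {0..2 * M} f"
  shows "integral {0..2 * M} f = integral {0..M} (\<lambda>x. f x + f (2 * M - x))"
proof -
  have i1: "f integrable_on {0..M}" and i2: "f integrable_on {M..2 * M}"
    using assms by (auto intro!: integrable_continuous_interval intro: continuous_on_subset)
  have "integral {0..2 * M} f = integral {0..M} f + integral {M..2 * M} f"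
    using assms by (intro Henstock_Kurzweil_Integration.integral_combine[symmetric] integrable_continuous_interval) auto
  moreover have "((\<lambda>x. f (2 * M - x)) has_integral integral {M..2 * M} f) {0..M}"
  proof -
    have "((\<lambda>x. f ((-1) *\<^sub>R x + 2 * M)) has_integral (1 / \<bar>-1\<bar>) *\<^sub>R integral {M..2 * M} f) ((\<lambda>x. (1 / (-1)) *\<^sub>R x + - ((1 / (-1)) *\<^sub>R (2 * M))) ` cbox M (2 * M))"
      using has_integral_affinity[OF integrable_integral[OF i2[unfolded cbox_interval[symmetric]]], of "-1" "2 * M"] by simp
    moreover have "(\<lambda>x. (1 / (-1)) *\<^sub>R x + - ((1 / (-1)) *\<^sub>R (2 * M))) ` cbox M (2 * M) = {0..M}"
    proof -
      have "x \<in> (\<lambda>x. 2 * M - x) ` {M..2 * M}" if "x \<in> {0..M}" for x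
        using that by (intro image_eqI[of _ _ "2 * M - x"]) auto
      then show ?thesis by auto
    qed
    ultimately show ?thesis by (simp add: algebra_simps)
  qed
  ultimately show ?thesis
    using integral_unique[OF has_integral_add[OF integrable_integral[OF i1]]] by metis
qed

text \<open>After leaving 0 upwards, \<open>D\<close> would reach its first later zero from above,
  with derivative at most 0 there, although every zero has a positive derivative.\<close>

lemma pos_of_zero_derivs:
  fixes D D' :: "real \<Rightarrow> real"
  assumes D: "\<And>x. (D has_real_derivative D' x) (at x)" and D0: "D 0 = 0"
    and zero: "\<And>x. 0 \<le> x \<Longrightarrow> x < M \<Longrightarrow> D x = 0 \<Longrightarrow> 0 < D' x"
    and x: "0 < x" "x < M"
  shows "0 < D x"
proof (rule ccontr)
  assume "\<not> 0 < D x"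
  then have neg: "D x \<le> 0" by simp
  have cont: "isCont D t" for t using D by (rule DERIV_isCont)
  obtain e where e: "0 < e" "\<And>h. 0 < h \<Longrightarrow> h < e \<Longrightarrow> 0 < D h"
    using DERIV_pos_inc_right[OF D[of 0]] zero[of 0] x D0 by auto
  \<comment> \<open>A point where \<open>D\<close> is already positive; searching from
    \<open>s\<close> on excludes the zero at 0 and keeps the set \<open>Z\<close> compact.\<close>
  define s where "s = min (e / 2) (x / 2)"
  have s: "0 < s" "s < x" "0 < D s" using e x by (auto simp: s_def intro!: e(2))
  define Z where "Z = {t \<in> {s..x}. D t \<le> 0}"
  have "closed ({s..x} \<inter> D -` {..0})"
    using cont by (intro continuous_closed_preimage continuous_at_imp_continuous_on) auto
  moreover have "Z = {s..x} \<inter> ({s..x} \<inter> D -` {..0})" by (auto simp: Z_def)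
  ultimately have "compact Z" by (metis compact_Icc compact_Int_closed)
  moreover have "x \<in> Z" using s neg by (simp add: Z_def)
  ultimately obtain z where z: "z \<in> Z" "\<And>t. t \<in> Z \<Longrightarrow> z \<le> t" using compact_attains_inf[of Z] by auto
  have zs: "s < z" "z \<le> x" "D z \<le> 0"
  proof -
    show "z \<le> x" "D z \<le> 0" using z(1) by (auto simp: Z_def)
    then show "s < z" using z(1) s(3) by (cases "z = s") (auto simp: Z_def)
  qed
  have before: "0 < D t" if "s \<le> t" "t < z" for t
  proof (rule ccontr)
    assume "\<not> 0 < D t"
    then have "t \<in> Z" using that zs by (simp add: Z_def)
    then show False using z(2)[of t] that by simp
  qed
  have "\<exists>t. s \<le> t \<and> t \<le> z \<and> D t = 0"
    using s zs cont by (intro IVT2) auto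
  then have Dz: "D z = 0" using before by (metis less_irrefl order_le_less)
  then have "0 < D' z" using zero zs s x by auto
  then obtain d where d: "0 < d" "\<And>h. 0 < h \<Longrightarrow> h < d \<Longrightarrow> D (z - h) < D z"
    using DERIV_pos_inc_left[OF D[of z]] by auto
  \<comment> \<open>Just left of \<open>z\<close> the positive derivative makes \<open>D\<close>
    negative, but \<open>z\<close> is the first point after \<open>s\<close> where \<open>D\<close>
    fails to be positive.\<close>
  define h where "h = min (d / 2) (z - s)"
  have "0 < h" "h < d" "s \<le> z - h" using d zs by (auto simp: h_def)
  then have "D (z - h) < D z" "0 < D (z - h)" using d before by auto
  then show False using Dz by simp
qed

text \<open>Jacobi's completion of the square: for a positive sine \<open>s\<close> of frequency
  \<open>w\<close>, the function \<open>g'^2 - w^2 * g^2\<close> equals the square of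
  \<open>g' - w * (s' / s) * g\<close> plus the derivative of \<open>w * g^2 * s' / s\<close>, where
  \<open>s'\<close> denotes the cosine. The boundary terms vanish with \<open>g\<close>.\<close>

lemma Wirtinger_Dirichlet:
  fixes g g' :: "real \<Rightarrow> real"
  assumes g: "\<And>x. (g has_real_derivative g' x) (at x)" and g'_cont: "continuous_on UNIV g'"
    and bd: "g 0 = 0" "g L = 0" and L: "0 < L"
  shows "(pi / L)\<^sup>2 * integral {0..L} (\<lambda>x. (g x)\<^sup>2) \<le> integral {0..L} (\<lambda>x. (g' x)\<^sup>2)"
proof -
  have gc: "continuous_on {0..L} g"
    using g by (intro continuous_at_imp_continuous_on ballI) (rule DERIV_isCont)
  have g'c: "continuous_on {0..L} g'" using g'_cont by (rule continuous_on_subset) auto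
  have ig: "(\<lambda>x. (g x)\<^sup>2) integrable_on {0..L}" and ig': "(\<lambda>x. (g' x)\<^sup>2) integrable_on {0..L}"
    by (intro integrable_continuous_interval continuous_on_power gc g'c)+
  have *: "w\<^sup>2 * integral {0..L} (\<lambda>x. (g x)\<^sup>2) \<le> integral {0..L} (\<lambda>x. (g' x)\<^sup>2)"
    if w: "0 < w" "w < pi / L" for w
  proof -
    \<comment> \<open>The phase centres the arc: \<open>w * x + c\<close> runs from \<open>c\<close>
      to \<open>pi - c\<close>, so the sine stays positive on the closed interval. This needs
      \<open>w < pi / L\<close> strictly.\<close>
    define c where "c = (pi - w * L) / 2"
    have c: "0 < c" using w L by (simp add: c_def field_simps)
    define s where "s x = sin (w * x + c)" for x
    define s' where "s' x = cos (w * x + c)" for x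
    have spos: "0 < s x" if "0 \<le> x" "x \<le> L" for x
    proof -
      have "w * x \<le> w * L" "0 \<le> w * x" using that w by auto
      moreover have "2 * c = pi - w * L" by (simp add: c_def)
      ultimately have "0 < w * x + c" "w * x + c < pi" using c by linarith+
      then show ?thesis unfolding s_def by (rule sin_gt_zero)
    qed
    have sq: "(s x)\<^sup>2 + (s' x)\<^sup>2 = 1" for x by (simp add: s_def s'_def)
    have ds: "(s has_real_derivative w * s' x) (at x)" "(s' has_real_derivative - (w * s x)) (at x)" for x
      unfolding s_def s'_def by (auto intro!: derivative_eq_intros)
    define f where "f x = w * ((g x)\<^sup>2 * s' x / s x)" for x
    define f' where "f' x = (g' x)\<^sup>2 - w\<^sup>2 * (g x)\<^sup>2 - (g' x - w * (s' x / s x) * g x)\<^sup>2" for x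
    have "(f' has_integral (f L - f 0)) {0..L}"
    proof (rule has_integral_DERIV)
      fix x assume x: "0 \<le> x" "x \<le> L"
      note sx = spos[OF x]
      have d1: "((\<lambda>x. (g x)\<^sup>2 * s' x) has_real_derivative 2 * g x * g' x * s' x - (g x)\<^sup>2 * (w * s x)) (at x)"
        using DERIV_mult[OF DERIV_power[OF g[of x], of 2] ds(2)[of x]] by (simp add: algebra_simps)
      have "(f has_real_derivative w * (((2 * g x * g' x * s' x - (g x)\<^sup>2 * (w * s x)) * s x
          - (g x)\<^sup>2 * s' x * (w * s' x)) / (s x * s x))) (at x)"
        unfolding f_def using DERIV_cmult[OF DERIV_divide[OF d1 ds(1)[of x]], of w] sx by auto
      moreover have "w * (((2 * g x * g' x * s' x - (g x)\<^sup>2 * (w * s x)) * s x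
          - (g x)\<^sup>2 * s' x * (w * s' x)) / (s x * s x)) = f' x"
        using sx unfolding f'_def by (simp add: field_simps power2_eq_square)
      ultimately show "(f has_real_derivative f' x) (at x)" by simp
    qed (use L in auto)
    then have "(f' has_integral 0) {0..L}" by (simp add: f_def bd)
    moreover have "((\<lambda>x. (g' x)\<^sup>2 - w\<^sup>2 * (g x)\<^sup>2) has_integral
        integral {0..L} (\<lambda>x. (g' x)\<^sup>2) - w\<^sup>2 * integral {0..L} (\<lambda>x. (g x)\<^sup>2)) {0..L}"
      by (intro has_integral_diff has_integral_mult_right integrable_integral ig ig')
    ultimately have "0 \<le> integral {0..L} (\<lambda>x. (g' x)\<^sup>2) - w\<^sup>2 * integral {0..L} (\<lambda>x. (g x)\<^sup>2)"
      by (rule has_integral_le) (simp add: f'_def)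
    then show ?thesis by simp
  qed
  \<comment> \<open>The sharp constant is the limit of the admissible frequencies.\<close>
  have "((\<lambda>w. w\<^sup>2 * integral {0..L} (\<lambda>x. (g x)\<^sup>2)) \<longlongrightarrow> (pi / L)\<^sup>2 * integral {0..L} (\<lambda>x. (g x)\<^sup>2)) (at_left (pi / L))"
    by (intro tendsto_intros)
  moreover have "eventually (\<lambda>w. w \<in> {0<..<pi / L}) (at_left (pi / L))"
    using L by (intro eventually_at_left_real) simp
  then have "eventually (\<lambda>w. w\<^sup>2 * integral {0..L} (\<lambda>x. (g x)\<^sup>2) \<le> integral {0..L} (\<lambda>x. (g' x)\<^sup>2)) (at_left (pi / L))"
    by (rule eventually_mono) (use * in auto)
  ultimately show ?thesis by (rule tendsto_upperbound) simp
qed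

text \<open>The antiderivative \<open>g\<close> of \<open>y\<close> vanishes at both ends. With
  \<open>w = (pi / L)^2\<close>, expanding the integral of \<open>(y' + w * g)^2\<close> and
  integrating by parts leaves \<open>2wI \<le> D + w^2 G\<close>, and the Dirichlet case applied to
  \<open>g\<close> gives \<open>wG \<le> I\<close>.\<close>

lemma Wirtinger_mean_zero:
  fixes y y' :: "real \<Rightarrow> real"
  assumes y: "\<And>x. (y has_real_derivative y' x) (at x)" and y'_cont: "continuous_on UNIV y'"
    and mean: "integral {0..L} y = 0" and L: "0 < L"
  shows "(pi / L)\<^sup>2 * integral {0..L} (\<lambda>x. (y x)\<^sup>2) \<le> integral {0..L} (\<lambda>x. (y' x)\<^sup>2)"
proof -
  have y_cont: "isCont y x" for x using y by (rule DERIV_isCont)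
  obtain F where F: "\<And>t. (F has_vector_derivative y t) (at t)"
    using einterval_antiderivative[of "-\<infinity>" "\<infinity>" y] y_cont by auto
  define g where "g x = F x - F 0" for x
  have g: "(g has_real_derivative y x) (at x)" for x
    unfolding g_def has_real_derivative_iff_has_vector_derivative using F
    by (auto intro!: derivative_eq_intros)
  have g0: "g 0 = 0" by (simp add: g_def)
  have gL: "g L = 0"
    using integral_unique[OF has_integral_DERIV[of 0 L g y]] g L mean g0 by simp
  have c: "continuous_on {0..L} g" "continuous_on {0..L} y" "continuous_on {0..L} y'"
    using y_cont DERIV_isCont[OF g] continuous_on_subset[OF y'_cont]
    by (auto intro!: continuous_at_imp_continuous_on)
  define w where "w = (pi / L)\<^sup>2"
  define I where "I = integral {0..L} (\<lambda>x. (y x)\<^sup>2)"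
  define G where "G = integral {0..L} (\<lambda>x. (g x)\<^sup>2)"
  define D where "D = integral {0..L} (\<lambda>x. (y' x)\<^sup>2)"
  have hI: "((\<lambda>x. (y x)\<^sup>2) has_integral I) {0..L}" and hG: "((\<lambda>x. (g x)\<^sup>2) has_integral G) {0..L}"
    and hD: "((\<lambda>x. (y' x)\<^sup>2) has_integral D) {0..L}"
    unfolding I_def G_def D_def by (intro integrable_integral integrable_continuous_interval continuous_on_power c)+
  have "((\<lambda>x. y x * y x + y' x * g x) has_integral (g L * y L - g 0 * y 0)) {0..L}"
    by (rule has_integral_DERIV[where F = "\<lambda>x. g x * y x"]) (use L DERIV_mult[OF g y] in auto)
  then have "((\<lambda>x. (y x)\<^sup>2 + y' x * g x) has_integral 0) {0..L}" by (simp add: g0 gL power2_eq_square)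
  from has_integral_diff[OF this hI]
  have "((\<lambda>x. y' x * g x) has_integral - I) {0..L}" by simp
  from has_integral_add[OF has_integral_add[OF hD has_integral_mult_right[OF this, of "2 * w"]] has_integral_mult_right[OF hG, of "w\<^sup>2"]]
  have "((\<lambda>x. (y' x + w * g x)\<^sup>2) has_integral D + 2 * w * - I + w\<^sup>2 * G) {0..L}"
    by (simp add: power2_sum power_mult_distrib algebra_simps)
  then have "0 \<le> D + 2 * w * - I + w\<^sup>2 * G" by (rule has_integral_nonneg) simp
  moreover have "w * G \<le> I"
    unfolding w_def G_def I_def
    by (rule Wirtinger_Dirichlet) (use g g0 gL L y_cont in \<open>auto intro: continuous_at_imp_continuous_on\<close>)
  then have "w * (w * G) \<le> w * I" by (intro mult_left_mono) (auto simp: w_def)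
  ultimately have "w * I \<le> D" by (simp add: power2_eq_square)
  then show ?thesis by (simp add: w_def I_def D_def)
qed

lemma powr_above_tangent:
  fixes p :: real
  assumes "p \<ge> 1 \<or> p \<le> 0" "0 < x" "0 < c"
  shows "c powr p + p * c powr (p - 1) * (x - c) \<le> x powr p"
proof -
  have "convex_on {0<..} (\<lambda>x. x powr p)"
  proof (rule f''_ge0_imp_convex)
    show "((\<lambda>x. x powr p) has_real_derivative p * x powr (p - 1)) (at x)"
      "((\<lambda>x. p * x powr (p - 1)) has_real_derivative p * ((p - 1) * x powr (p - 1 - 1))) (at x)"
      if "x \<in> {0<..}" for x using that by (auto intro!: derivative_eq_intros)
    show "0 \<le> p * ((p - 1) * x powr (p - 1 - 1))" for x
    proof -
      have "0 \<le> p * (p - 1)" using assms(1) by (auto simp: zero_le_mult_iff)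
      then have "0 \<le> p * (p - 1) * x powr (p - 1 - 1)" by (rule mult_nonneg_nonneg) simp
      then show ?thesis by (simp add: mult.assoc)
    qed
  qed simp
  then have "x powr p - c powr p \<ge> p * c powr (p - 1) * (x - c)"
    by (rule convex_on_imp_above_tangent)
      (use assms in \<open>auto intro!: derivative_eq_intros simp: interior_open connected_Ioi\<close>)
  then show ?thesis by simp
qed

text \<open>V' is strictly convex for q > 1 and strictly concave for q < 1, so the trapezoidal rule
  for V' on \<open>{a..b}\<close> errs with the sign of \<open>q - 1\<close>. The exact integral is
  \<open>pot q b - pot q a = 0\<close>, hence the sign passes to the trapezoidal value
  itself.\<close>

lemma trapezoid_gap:
  assumes "0 < a" "a < b" "pot q a = pot q b" "q \<noteq> 1"
  shows "0 < (q - 1) * (force q a + force q b)"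
proof -
  define f where "f t = (q - 1) * ((t - a) * (force q a + force q t) / 2 - (pot q t - pot q a))" for t
  define f' where "f' t = (q - 1) * ((t - a) * t powr (q - 1) - (force q t - force q a)) / 2" for t
  have d: "(f has_real_derivative f' t) (at t)" if t: "a \<le> t" for t
    unfolding f_def f'_def using t assms DERIV_force[of t q] DERIV_pot[of t q]
    by (auto intro!: derivative_eq_intros simp: field_simps)
  have pos: "0 < f' t" if t: "a < t" for t
  proof -
    obtain u where u: "a < u" "u < t" "force q t - force q a = (t - a) * u powr (q - 1)"
      using MVT2[OF t, of "force q" "\<lambda>u. u powr (q - 1)"] assms DERIV_force by auto
    have "0 < (q - 1) * (t powr (q - 1) - u powr (q - 1))"
    proof (cases "1 < q")
      case True
      then show ?thesis using u assms powr_less_mono2[of "q - 1" u t] by simp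
    next
      case False
      then have "q - 1 < 0" using assms by simp
      then show ?thesis using u assms powr_less_mono2_neg[of "q - 1" u t] by (simp add: mult_neg_neg)
    qed
    then have "0 < (t - a) * ((q - 1) * (t powr (q - 1) - u powr (q - 1)))" using t by simp
    then show ?thesis unfolding f'_def u(3) by (simp add: algebra_simps)
  qed
  have "f a < f b"
  proof (rule DERIV_pos_imp_increasing_open[OF assms(2)])
    show "\<exists>y. (f has_real_derivative y) (at x) \<and> 0 < y" if "a < x" "x < b" for x
      using d[of x] pos[of x] that by auto
    show "continuous_on {a..b} f"
      by (intro continuous_at_imp_continuous_on ballI DERIV_isCont[OF d]) auto
  qed
  then have "0 < (b - a) * ((q - 1) * (force q a + force q b))"
    using assms by (simp add: f_def algebra_simps)
  then show ?thesis using assms by (simp add: zero_less_mult_iff)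
qed

text \<open>The weights 1/6 and 1/3 are those that make this an equality for cubic V. The difference
  \<open>f\<close> of the two sides vanishes to first order at \<open>c\<close>, and
  \<open>f''\<close> is a third of the error of the tangent of V'' at \<open>t\<close>, evaluated at
  \<open>c\<close>; so \<open>f\<close> is convex.\<close>

lemma pot_le_third_order:
  assumes q: "q \<ge> 2 \<or> q \<le> 1" and "0 < c" "0 < x"
  shows "pot q x - pot q c \<le> c powr (q - 1) * (x - c)\<^sup>2 / 6 + force q c * (x - c)
    + (force q x - force q c) * (x - c) / 3"
proof -
  define f where "f t = c powr (q - 1) * (t - c)\<^sup>2 / 6 + force q c * (t - c)
    + (force q t - force q c) * (t - c) / 3 - (pot q t - pot q c)" for t
  define f' where "f' t = c powr (q - 1) * (t - c) / 3 + force q c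
    + t powr (q - 1) * (t - c) / 3 + (force q t - force q c) / 3 - force q t" for t
  define f'' where "f'' t = (c powr (q - 1) - t powr (q - 1) - (q - 1) * t powr (q - 1 - 1) * (c - t)) / 3" for t
  have d1: "(f has_real_derivative f' t) (at t)" if "0 < t" for t
    unfolding f_def f'_def using DERIV_force[OF that] DERIV_pot[OF that]
    by (auto intro!: derivative_eq_intros simp: field_simps)
  have d2: "(f' has_real_derivative f'' t) (at t)" if "0 < t" for t
    unfolding f'_def f''_def using DERIV_force[OF that] that
    by (auto intro!: derivative_eq_intros simp: field_simps)
  have "convex_on {0<..} f"
  proof (rule f''_ge0_imp_convex)
    show "0 \<le> f'' t" if "t \<in> {0<..}" for t
      using powr_above_tangent[of "q - 1" c t] q assms that by (auto simp: f''_def)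
  qed (use d1 d2 in auto)
  then have "f x - f c \<ge> f' c * (x - c)"
    by (rule convex_on_imp_above_tangent)
      (use assms d1[of c] in \<open>auto simp: interior_open connected_Ioi intro: has_field_derivative_at_within\<close>)
  then show ?thesis by (simp add: f_def f'_def)
qed

section \<open>Comparison of a wave with its mean\<close>

context wave
begin

definition mass :: real where "mass = integral {0..L} k"
definition action :: real where "action = integral {0..L} (\<lambda>x. (kd x)\<^sup>2)"
text \<open>The energy difference for the normalised potential over half a period; the other half
  contributes the same by reflection.\<close>

definition gap :: real where
  "gap = integral {0..L} (\<lambda>x. (kd x)\<^sup>2 / 2 - pot q (k x)) + L * pot q (mass / L)"

lemma isCont_k: "isCont k x" using DERIV_k by (rule DERIV_isCont)
lemma isCont_kd: "isCont kd x" using DERIV_kd by (rule DERIV_isCont)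

lemma DERIV_force_k: "((\<lambda>x. force q (k x)) has_real_derivative k x powr (q - 1) * kd x) (at x)"
  using DERIV_chain2[OF DERIV_force[OF k_pos] DERIV_k] .

lemma DERIV_pot_k: "((\<lambda>x. pot q (k x)) has_real_derivative force q (k x) * kd x) (at x)"
  using DERIV_chain2[OF DERIV_pot[OF k_pos] DERIV_k] .

lemma continuous_k: "continuous_on S k" and continuous_kd: "continuous_on S kd"
  and continuous_force_k: "continuous_on S (\<lambda>x. force q (k x))"
  and continuous_pot_k: "continuous_on S (\<lambda>x. pot q (k x))"
  by (intro continuous_at_imp_continuous_on ballI isCont_k isCont_kd
      DERIV_isCont[OF DERIV_force_k] DERIV_isCont[OF DERIV_pot_k])+

lemma kd_period: "kd (x + 2 * L) = kd x"
proof -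
  have "((\<lambda>x. k (x + 2 * L)) has_real_derivative kd (x + 2 * L)) (at x)"
    using DERIV_shift[THEN iffD1, OF DERIV_k] .
  then have "(k has_real_derivative kd (x + 2 * L)) (at x)" by (simp add: k_period)
  then show ?thesis using DERIV_unique DERIV_k by blast
qed

lemma kd_odd: "kd (- x) = - kd x"
proof -
  have "((\<lambda>x. k (- x)) has_real_derivative - kd (- x)) (at x)"
    using DERIV_mirror[THEN iffD1, OF DERIV_k] .
  then have "(k has_real_derivative - kd (- x)) (at x)" by (simp add: k_even)
  then show ?thesis using DERIV_unique DERIV_k by fastforce
qed

lemma k_reflect: "k (2 * L - x) = k x" and kd_reflect: "kd (2 * L - x) = - kd x"
  using k_period[of "- x"] kd_period[of "- x"] by (simp_all add: k_even kd_odd add.commute)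

lemma energy_conserved: "(kd x)\<^sup>2 / 2 + pot q (k x) = pot q \<beta>"
proof -
  have "((\<lambda>x. (kd x)\<^sup>2 / 2 + pot q (k x)) has_real_derivative 0) (at x)" for x
    using DERIV_add[OF DERIV_cdivide[OF DERIV_power[OF DERIV_kd[of x], of 2], of 2] DERIV_pot_k[of x]]
    by (simp add: algebra_simps)
  then have "(kd x)\<^sup>2 / 2 + pot q (k x) = (kd 0)\<^sup>2 / 2 + pot q (k 0)"
    using DERIV_isconst_all[of "\<lambda>x. (kd x)\<^sup>2 / 2 + pot q (k x)"] by blast
  then show ?thesis by (simp add: k_0 kd_0)
qed

lemma k_increasing:
  assumes "0 \<le> x" "x < y" "y \<le> L" shows "k x < k y"
proof (rule DERIV_pos_imp_increasing_open[OF assms(2)])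
  show "\<exists>d. (k has_real_derivative d) (at t) \<and> 0 < d" if "x < t" "t < y" for t
    using that assms DERIV_k[of t] kd_pos[of t] by auto
qed (rule continuous_k)

lemma has_integral_mass: "(k has_integral mass) {0..L}"
  unfolding mass_def by (intro integrable_integral integrable_continuous_interval continuous_k)

lemma has_integral_action: "((\<lambda>x. (kd x)\<^sup>2) has_integral action) {0..L}"
  unfolding action_def by (intro integrable_integral integrable_continuous_interval continuous_on_power continuous_kd)

lemma has_integral_const: "((\<lambda>x. c) has_integral L * c) {0..L}"
  using has_integral_const_real[of c 0 L] L_pos by simp

lemma force_mean_zero: "((\<lambda>x. force q (k x)) has_integral 0) {0..L}"
proof -
  have "((\<lambda>x. - force q (k x)) has_integral (kd L - kd 0)) {0..L}"
    by (rule has_integral_DERIV) (use L_pos DERIV_kd in auto)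
  from has_integral_neg[OF this] show ?thesis by (simp add: kd_0 kd_L)
qed

text \<open>The equation tested against \<open>k - c\<close>. The value does not depend on
  \<open>c\<close>, because the force has mean zero.\<close>

lemma action_force: "((\<lambda>x. force q (k x) * (k x - c)) has_integral action) {0..L}"
proof -
  have "((\<lambda>x. kd x * kd x - force q (k x) * (k x - c)) has_integral ((k L - c) * kd L - (k 0 - c) * kd 0)) {0..L}"
  proof (rule has_integral_DERIV)
    show "((\<lambda>x. (k x - c) * kd x) has_real_derivative kd x * kd x - force q (k x) * (k x - c)) (at x)" for x
      using DERIV_mult[OF DERIV_diff[OF DERIV_k[of x] DERIV_const[of c]] DERIV_kd[of x]] by (simp add: algebra_simps)
  qed (use L_pos in auto)
  then have "((\<lambda>x. (kd x)\<^sup>2 - force q (k x) * (k x - c)) has_integral 0) {0..L}"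
    by (simp add: kd_0 kd_L power2_eq_square)
  from has_integral_diff[OF has_integral_action this] show ?thesis by simp
qed

text \<open>Test the equation against \<open>k\<close>, rewrite \<open>k * V'\<close> by
  \<open>pot_force\<close>, and remove V by conservation of energy. What remains determines the mass
  from action, period and energy level.\<close>

lemma virial: "(q + 3) * action = 2 * (q + 1) * pot q \<beta> * L - 2 * L + 2 * mass"
proof -
  have e: "force q (k x) * (k x - 0) = (q + 1) * pot q \<beta> - 1 - (q + 1) / 2 * (kd x)\<^sup>2 + k x" for x
  proof -
    have "pot q (k x) = pot q \<beta> - (kd x)\<^sup>2 / 2" using energy_conserved[of x] by simp
    then have "(q + 1) * (pot q \<beta> - (kd x)\<^sup>2 / 2) = k x * force q (k x) - k x + 1"
      using pot_force[OF k_pos, of q x] by simp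
    then show ?thesis by (simp add: algebra_simps)
  qed
  have "((\<lambda>x. (q + 1) * pot q \<beta> - 1 - (q + 1) / 2 * (kd x)\<^sup>2 + k x) has_integral
      L * ((q + 1) * pot q \<beta> - 1) - (q + 1) / 2 * action + mass) {0..L}"
    by (intro has_integral_add has_integral_diff has_integral_mult_right has_integral_const
        has_integral_action has_integral_mass)
  then have "L * ((q + 1) * pot q \<beta> - 1) - (q + 1) / 2 * action + mass = action"
    using action_force[of 0] unfolding e by (rule has_integral_unique)
  then show ?thesis by (simp add: field_simps)
qed

lemma gap_eq: "gap = action - pot q \<beta> * L + L * pot q (mass / L)"
proof -
  have e: "(kd x)\<^sup>2 / 2 - pot q (k x) = (kd x)\<^sup>2 - pot q \<beta>" for x
    using energy_conserved[of x] by simp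
  have "((\<lambda>x. (kd x)\<^sup>2 - pot q \<beta>) has_integral action - L * pot q \<beta>) {0..L}"
    by (intro has_integral_diff has_integral_const has_integral_action)
  then show ?thesis unfolding gap_def e by (simp add: integral_unique)
qed

lemma mass_pos: "0 < mass"
  unfolding mass_def
  using integral_continuous_pos[OF L_pos continuous_k, of 0] L_pos k_pos by (auto simp: less_imp_le)

text \<open>For q > 1 the convex function V' lies above its tangent \<open>y - 1\<close> at 1,
  strictly at the minimum \<beta>. Since V' has mean zero along the wave, the mean of
  \<open>k - 1\<close> is negative.\<close>

lemma mass_less:
  assumes "1 < q" shows "mass < L"
proof -
  have t: "q * k x \<le> q + q * force q (k x)" for x
    using powr_above_tangent[of q "k x" 1] k_pos[of x] assms by (simp add: powr_eq_force algebra_simps)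
  have "0 < integral {0..L} (\<lambda>x. 1 + force q (k x) - k x)"
  proof (rule integral_continuous_pos[where c = 0])
    show "continuous_on {0..L} (\<lambda>x. 1 + force q (k x) - k x)"
      by (intro continuous_intros continuous_k continuous_force_k)
    have ge: "0 \<le> 1 + force q (k x) - k x" for x
    proof -
      have "0 \<le> q * (1 + force q (k x) - k x)" using t[of x] by (simp add: algebra_simps)
      then show ?thesis using assms by (simp add: zero_le_mult_iff)
    qed
    then show "0 \<le> 1 + force q (k x) - k x" for x .
    obtain u where u: "\<beta> < u" "u < 1" "force q 1 - force q \<beta> = (1 - \<beta>) * u powr (q - 1)"
      using MVT2[of \<beta> 1 "force q" "\<lambda>u. u powr (q - 1)"] \<beta>_pos \<beta>_less DERIV_force by auto
    have "u powr (q - 1) < 1 powr (q - 1)" using u \<beta>_pos assms by (intro powr_less_mono2) auto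
    then have "(1 - \<beta>) * u powr (q - 1) < 1 - \<beta>" using \<beta>_less by simp
    moreover have "- force q \<beta> = (1 - \<beta>) * u powr (q - 1)" using u(3) by simp
    ultimately show "0 < 1 + force q (k 0) - k 0" unfolding k_0 by linarith
  qed (use L_pos in auto)
  moreover have "((\<lambda>x. 1 + force q (k x) - k x) has_integral L * 1 + 0 - mass) {0..L}"
    by (intro has_integral_add has_integral_diff has_integral_const force_mean_zero has_integral_mass)
  ultimately show ?thesis by (simp add: integral_unique)
qed

text \<open>The equation is linear here: the mean is exactly 1, where the potential vanishes, and
  the virial identity reduces to equipartition of energy.\<close>

lemma gap_zero: "q = 1 \<Longrightarrow> gap = 0"
proof -
  assume q: "q = 1"
  have "force q (k x) = k x - 1" for x using k_pos[of x] by (simp add: q force_def)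
  then have "((\<lambda>x. force q (k x)) has_integral mass - L * 1) {0..L}"
    by (simp only:) (intro has_integral_diff has_integral_const has_integral_mass)
  then have "mass - L * 1 = 0" using force_mean_zero by (rule has_integral_unique)
  then have mass: "mass = L" by simp
  then have "action = pot q \<beta> * L" using virial q by simp
  then show ?thesis using gap_eq mass L_pos by simp
qed

text \<open>Compare the slopes at \<open>x\<close> and \<open>L - x\<close>. Where they agree,
  conservation of energy makes the potentials agree, and \<open>trapezoid_gap\<close> then fixes the
  sign of the derivative of the difference. So the two slopes never meet again inside the half
  interval.\<close>

lemma steeper_side:
  assumes q: "q \<noteq> 1" and x: "0 < x" "x < L / 2"
  shows "0 < (q - 1) * (kd (L - x) - kd x)"
proof (rule pos_of_zero_derivs[where M = "L / 2" and D = "\<lambda>x. (q - 1) * (kd (L - x) - kd x)"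
      and D' = "\<lambda>x. (q - 1) * (force q (k x) + force q (k (L - x)))"])
  fix x
  have "((\<lambda>x. kd (L - x)) has_real_derivative force q (k (L - x))) (at x)"
    using DERIV_reflect[OF DERIV_kd[of "L - x"]] by simp
  from DERIV_cmult[OF DERIV_diff[OF this DERIV_kd[of x]], of "q - 1"]
  show "((\<lambda>x. (q - 1) * (kd (L - x) - kd x)) has_real_derivative (q - 1) * (force q (k x) + force q (k (L - x)))) (at x)"
    by (simp add: algebra_simps)
next
  fix x assume x: "0 \<le> x" "x < L / 2" "(q - 1) * (kd (L - x) - kd x) = 0"
  then have "kd (L - x) = kd x" using q by simp
  then have "pot q (k x) = pot q (k (L - x))" using energy_conserved[of x] energy_conserved[of "L - x"] by simp
  moreover have "k x < k (L - x)" using x by (intro k_increasing) auto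
  ultimately show "0 < (q - 1) * (force q (k x) + force q (k (L - x)))"
    using trapezoid_gap k_pos q by blast
qed (use x kd_0 kd_L in auto)

text \<open>Folding about \<open>L / 2\<close> factors the integrand as minus the product of
  \<open>z\<close> and \<open>w\<close>. Both decrease, \<open>z\<close> by
  \<open>steeper_side\<close>, and \<open>z\<close> has mean zero; Chebyshev's inequality then makes
  the integral of \<open>z * w\<close> positive.\<close>

lemma cosine_moment:
  assumes q: "q \<noteq> 1"
  shows "(q - 1) * integral {0..L} (\<lambda>x. (k x - mass / L)\<^sup>2 * cos (pi / L * x)) < 0"
proof -
  define c where "c = mass / L"
  define M where "M = L / 2"
  have M: "0 < M" "2 * M = L" using L_pos by (auto simp: M_def)
  define z where "z x = (q - 1) * (k x + k (L - x) - 2 * c)" for x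
  define w where "w x = (k (L - x) - k x) * cos (pi / L * x)" for x
  define f where "f x = (k x - c)\<^sup>2 * cos (pi / L * x)" for x
  have ck: "isCont (\<lambda>x. k (L - x)) x" for x
    by (intro isCont_o2[OF _ isCont_k]) simp
  have contz: "isCont z x" for x unfolding z_def by (intro continuous_intros isCont_k ck)
  have contw: "isCont w x" for x unfolding w_def by (intro continuous_intros isCont_k ck)
  have z_dec: "z y < z x" if "0 \<le> x" "x < y" "y \<le> M" for x y
  proof (rule DERIV_neg_imp_decreasing_open[OF that(2), of z])
    fix t assume t: "x < t" "t < y"
    have "((\<lambda>x. k (L - x)) has_real_derivative - kd (L - t)) (at t)"
      using DERIV_reflect[OF DERIV_k[of "L - t"]] .
    from DERIV_cmult[OF DERIV_diff[OF DERIV_add[OF DERIV_k[of t] this] DERIV_const[of "2 * c"]], of "q - 1"]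
    have "(z has_real_derivative - ((q - 1) * (kd (L - t) - kd t))) (at t)"
      unfolding z_def by (simp add: algebra_simps)
    moreover have "0 < (q - 1) * (kd (L - t) - kd t)" using t that by (intro steeper_side q) (auto simp: M_def)
    ultimately show "\<exists>d. (z has_real_derivative d) (at t) \<and> d < 0" by (meson neg_less_0_iff_less)
  qed (intro continuous_at_imp_continuous_on ballI contz)
  have arg: "0 \<le> pi / L * x" "pi / L * x \<le> pi / 2" if "0 \<le> x" "x \<le> M" for x
    using that L_pos by (auto simp: M_def field_simps)
  have w_dec: "w y < w x" if "0 \<le> x" "x < y" "y \<le> M" for x y
  proof -
    have "k x < k y" using that M L_pos by (intro k_increasing) auto
    moreover have "k (L - y) < k (L - x)" using that M L_pos by (intro k_increasing) auto
    ultimately have a: "k (L - y) - k y < k (L - x) - k x" by simp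
    have b: "0 \<le> k (L - y) - k y"
    proof (cases "y = M")
      case True
      then have "L - y = y" using M by simp
      then show ?thesis by simp
    next
      case False
      then have "k y < k (L - y)" using that M by (intro k_increasing) auto
      then show ?thesis by simp
    qed
    have "pi / L * x < pi / L * y" using that L_pos by (intro mult_strict_left_mono) auto
    then have d: "cos (pi / L * y) < cos (pi / L * x)"
    proof (intro cos_monotone_0_pi)
      show "0 \<le> pi / L * x" using that by (intro arg) auto
      have "pi / L * y \<le> pi / 2" using that by (intro arg) auto
      then show "pi / L * y \<le> pi" using pi_gt_zero by linarith
    qed
    have e: "0 \<le> cos (pi / L * y)" using arg[of y] that by (intro cos_ge_zero) auto
    show ?thesis unfolding w_def using a b d e by (intro mult_strict_mono') auto
  qed
  have hz: "integral {0..M} z = 0"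
  proof -
    have "integral {0..M} (\<lambda>x. (k x - c) + (k (L - x) - c)) = integral {0..L} (\<lambda>x. k x - c)"
      using integral_fold[of M "\<lambda>x. k x - c"] M by (simp add: continuous_on_diff continuous_k)
    also have "\<dots> = mass - L * c"
      by (rule integral_unique) (intro has_integral_diff has_integral_mass has_integral_const)
    also have "\<dots> = 0" using L_pos by (simp add: c_def)
    finally have "integral {0..M} (\<lambda>x. (k x - c) + (k (L - x) - c)) = 0" .
    moreover have "z = (\<lambda>x. (q - 1) * ((k x - c) + (k (L - x) - c)))" by (simp add: z_def fun_eq_iff)
    ultimately show ?thesis by simp
  qed
  have cz: "continuous_on {0..M} z" and cw: "continuous_on {0..M} w"
    by (intro continuous_at_imp_continuous_on ballI contz contw)+
  have z0: "0 < z 0"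
  proof (rule ccontr)
    assume n: "\<not> 0 < z 0"
    have "0 < integral {0..M} (\<lambda>x. - z x)"
    proof (rule integral_continuous_pos[where c = M])
      show "0 \<le> - z x" if "x \<in> {0..M}" for x
        using z_dec[of 0 x] n that by (cases "x = 0") auto
      show "0 < - z M" using z_dec[of 0 M] n M by auto
    qed (use M cz in \<open>auto intro: continuous_on_minus\<close>)
    then show False using hz by simp
  qed
  have zM: "z M < 0"
  proof (rule ccontr)
    assume n: "\<not> z M < 0"
    have "0 < integral {0..M} z"
    proof (rule integral_continuous_pos[where c = 0])
      show "0 \<le> z x" if "x \<in> {0..M}" for x
        using z_dec[of x M] n that by (cases "x = M") auto
    qed (use M cz z0 in auto)
    then show False using hz by simp
  qed
  have "\<exists>p. 0 \<le> p \<and> p \<le> M \<and> z p = 0"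
    using M contz z0 zM by (intro IVT2) auto
  then obtain p where p: "0 \<le> p" "p \<le> M" "z p = 0" by blast
  then have p0: "0 < p" using z0 by (cases "p = 0") auto
  \<comment> \<open>Subtracting the constant \<open>w p\<close> costs nothing because
    \<open>z\<close> has mean zero. As \<open>p\<close> is the sign change of \<open>z\<close>, both
    factors change sign there together.\<close>
  have "0 < integral {0..M} (\<lambda>x. z x * (w x - w p))"
  proof (rule integral_continuous_pos[where c = 0])
    show "continuous_on {0..M} (\<lambda>x. z x * (w x - w p))" by (intro continuous_intros cz cw)
    show "0 \<le> z x * (w x - w p)" if x: "x \<in> {0..M}" for x
    proof (cases x p rule: linorder_cases)
      case less
      then show ?thesis using z_dec[of x p] w_dec[of x p] p x by (intro mult_nonneg_nonneg) auto
    next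
      case greater
      then show ?thesis using z_dec[of p x] w_dec[of p x] p x by (intro mult_nonpos_nonpos) auto
    qed simp
    show "0 < z 0 * (w 0 - w p)"
      using z_dec[of 0 p] w_dec[of 0 p] p p0 by (intro mult_pos_pos) auto
  qed (use M in auto)
  moreover have "((\<lambda>x. z x * w x - w p * z x) has_integral integral {0..M} (\<lambda>x. z x * w x) - w p * 0) {0..M}"
    using hz cz cw
    by (intro has_integral_diff has_integral_mult_right)
      (auto intro!: integrable_integral integrable_continuous_interval continuous_on_mult simp: has_integral_iff)
  ultimately have "0 < integral {0..M} (\<lambda>x. z x * w x)"
    by (simp add: integral_unique algebra_simps)
  moreover have "integral {0..L} f = integral {0..M} (\<lambda>x. f x + f (2 * M - x))"
    unfolding M(2)[symmetric]
    by (rule integral_fold) (use M in \<open>auto simp: f_def intro!: continuous_intros continuous_k\<close>)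
  \<comment> \<open>The cosine is odd about \<open>L / 2\<close>, so a difference of two squares
    appears; its factors are the sum and the difference of the values of \<open>k\<close>.\<close>
  moreover have fold: "(q - 1) * (f x + f (2 * M - x)) = - (z x * w x)" for x
  proof -
    have "cos (pi / L * (2 * M - x)) = - cos (pi / L * x)"
      using L_pos unfolding M(2) by (simp add: right_diff_distrib)
    then show ?thesis unfolding f_def z_def w_def M(2)
      by (simp add: algebra_simps power2_eq_square)
  qed
  have "(q - 1) * integral {0..M} (\<lambda>x. f x + f (2 * M - x)) = integral {0..M} (\<lambda>x. - (z x * w x))"
    unfolding fold[symmetric] by simp
  ultimately have "(q - 1) * integral {0..L} f < 0" by simp
  then show ?thesis unfolding f_def c_def .
qed

lemma below_critical_mean:
  assumes q: "q \<ge> 2 \<or> q < 1"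
  shows "(mass / L) powr (q - 1) < (pi / L)\<^sup>2"
proof -
  define c where "c = mass / L"
  define w where "w = pi / L"
  define C where "C = integral {0..L} (\<lambda>x. (k x - c)\<^sup>2 * cos (w * x))"
  have c: "0 < c" using mass_pos L_pos by (simp add: c_def)
  have w: "0 < w" "w * L = pi" using L_pos by (auto simp: w_def)
  have C: "(q - 1) * C < 0" unfolding C_def c_def w_def using q by (intro cosine_moment) auto
  have ds: "((\<lambda>x. sin (w * x)) has_real_derivative w * cos (w * x)) (at x)"
    "((\<lambda>x. cos (w * x)) has_real_derivative - (w * sin (w * x))) (at x)" for x
    by (auto intro!: derivative_eq_intros)
  have sin_ge: "0 \<le> kd x * sin (w * x)" if "x \<in> {0..L}" for x
  proof -
    have "0 \<le> w * x" "w * x \<le> w * L" using that w(1) by (auto intro: mult_left_mono)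
    then have "0 \<le> sin (w * x)" using w by (intro sin_ge_zero) auto
    moreover have "0 \<le> kd x" using kd_pos[of x] that kd_0 kd_L by (cases "x = 0 \<or> x = L") auto
    ultimately show ?thesis by simp
  qed
  define W where "W = integral {0..L} (\<lambda>x. kd x * sin (w * x))"
  have hW: "((\<lambda>x. kd x * sin (w * x)) has_integral W) {0..L}"
    unfolding W_def by (intro integrable_integral integrable_continuous_interval continuous_intros continuous_kd)
  have W0: "0 \<le> W" using hW sin_ge by (rule has_integral_nonneg)
  have hC: "((\<lambda>x. (k x - c)\<^sup>2 * cos (w * x)) has_integral C) {0..L}"
    unfolding C_def by (intro integrable_integral integrable_continuous_interval continuous_intros continuous_k)
  \<comment> \<open>Integration by parts of \<open>(k - c)^2 * sin\<close>: the first-order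
    remainder of the tangent inequality becomes a multiple of the cosine moment.\<close>
  have "((\<lambda>x. 2 * ((k x - c) * kd x * sin (w * x)) + w * ((k x - c)\<^sup>2 * cos (w * x))) has_integral
      ((k L - c)\<^sup>2 * sin (w * L) - (k 0 - c)\<^sup>2 * sin (w * 0))) {0..L}"
  proof (rule has_integral_DERIV)
    show "((\<lambda>x. (k x - c)\<^sup>2 * sin (w * x)) has_real_derivative
        2 * ((k x - c) * kd x * sin (w * x)) + w * ((k x - c)\<^sup>2 * cos (w * x))) (at x)" for x
      using DERIV_mult[OF DERIV_power[OF DERIV_diff[OF DERIV_k[of x] DERIV_const[of c]], of 2] ds(1)[of x]]
      by (simp add: algebra_simps)
  qed (use L_pos in auto)
  then have "((\<lambda>x. 2 * ((k x - c) * kd x * sin (w * x)) + w * ((k x - c)\<^sup>2 * cos (w * x))) has_integral 0) {0..L}"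
    by (simp add: w)
  from has_integral_divide[OF has_integral_diff[OF this has_integral_mult_right[OF hC, of w]], of 2]
  have hY: "((\<lambda>x. (k x - c) * kd x * sin (w * x)) has_integral - (w * C) / 2) {0..L}" by simp
  \<comment> \<open>The differentiated equation tested against the sine. Both the sine and
    \<open>kd\<close> vanish at 0 and at \<open>L\<close>, so no boundary terms survive.\<close>
  have "((\<lambda>x. w\<^sup>2 * (kd x * sin (w * x)) - k x powr (q - 1) * kd x * sin (w * x)) has_integral
      ((- force q (k L) * sin (w * L) - w * (kd L * cos (w * L))) - (- force q (k 0) * sin (w * 0) - w * (kd 0 * cos (w * 0))))) {0..L}"
  proof (rule has_integral_DERIV)
    show "((\<lambda>x. - force q (k x) * sin (w * x) - w * (kd x * cos (w * x))) has_real_derivative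
        w\<^sup>2 * (kd x * sin (w * x)) - k x powr (q - 1) * kd x * sin (w * x)) (at x)" for x
      using DERIV_diff[OF DERIV_mult[OF DERIV_minus[OF DERIV_force_k[of x]] ds(1)[of x]]
          DERIV_cmult[OF DERIV_mult[OF DERIV_kd[of x] ds(2)[of x]], of w]]
      by (simp add: algebra_simps power2_eq_square)
  qed (use L_pos in auto)
  then have h0: "((\<lambda>x. w\<^sup>2 * (kd x * sin (w * x)) - k x powr (q - 1) * kd x * sin (w * x)) has_integral 0) {0..L}"
    by (simp add: w kd_0 kd_L)
  have h1: "((\<lambda>x. w\<^sup>2 * (kd x * sin (w * x)) - (c powr (q - 1) * (kd x * sin (w * x))
      + (q - 1) * c powr (q - 1 - 1) * ((k x - c) * kd x * sin (w * x)))) has_integral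
      w\<^sup>2 * W - (c powr (q - 1) * W + (q - 1) * c powr (q - 1 - 1) * (- (w * C) / 2))) {0..L}"
    by (intro has_integral_diff has_integral_add has_integral_mult_right hW hY)
  have "0 \<le> w\<^sup>2 * W - (c powr (q - 1) * W + (q - 1) * c powr (q - 1 - 1) * (- (w * C) / 2))"
  proof (rule has_integral_le[OF h0 h1])
    fix x assume x: "x \<in> {0..L}"
    have "c powr (q - 1) + (q - 1) * c powr (q - 1 - 1) * (k x - c) \<le> k x powr (q - 1)"
      using q c k_pos[of x] by (intro powr_above_tangent) auto
    from mult_right_mono[OF this sin_ge[OF x]]
    show "w\<^sup>2 * (kd x * sin (w * x)) - k x powr (q - 1) * kd x * sin (w * x) \<le>
      w\<^sup>2 * (kd x * sin (w * x)) - (c powr (q - 1) * (kd x * sin (w * x))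
      + (q - 1) * c powr (q - 1 - 1) * ((k x - c) * kd x * sin (w * x)))"
      by (simp add: algebra_simps)
  qed
  then have "(c powr (q - 1 - 1) * w / 2) * - ((q - 1) * C) \<le> (w\<^sup>2 - c powr (q - 1)) * W"
    by (simp add: field_simps)
  moreover have "0 < (c powr (q - 1 - 1) * w / 2) * - ((q - 1) * C)"
    using c w C by (intro mult_pos_pos) auto
  \<comment> \<open>With \<open>W \<ge> 0\<close>, positivity of the product forces the first factor
    to be positive.\<close>
  ultimately have "0 < (w\<^sup>2 - c powr (q - 1)) * W" by linarith
  then show ?thesis using W0 by (auto simp: zero_less_mult_iff c_def w_def)
qed

lemma gap_pos:
  assumes q: "q \<ge> 2 \<or> q < 1"
  shows "0 < gap"
proof -
  define c where "c = mass / L"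
  define Y where "Y = integral {0..L} (\<lambda>x. (k x - c)\<^sup>2)"
  have c: "0 < c" using mass_pos L_pos by (simp add: c_def)
  have hY: "((\<lambda>x. (k x - c)\<^sup>2) has_integral Y) {0..L}"
    unfolding Y_def by (intro integrable_integral integrable_continuous_interval continuous_intros continuous_k)
  have hy: "((\<lambda>x. k x - c) has_integral 0) {0..L}"
    using has_integral_diff[OF has_integral_mass has_integral_const[of c]] L_pos by (simp add: c_def)
  have Y_pos: "0 < Y"
  proof -
    have "k 0 \<noteq> c \<or> k L \<noteq> c" using k_increasing[of 0 L] L_pos by auto
    then obtain x where x: "x \<in> {0..L}" "k x \<noteq> c" using L_pos by (metis atLeastAtMost_iff less_imp_le order_refl)
    show ?thesis unfolding Y_def
      by (rule integral_continuous_pos[where c = x])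
        (use L_pos x in \<open>auto intro!: continuous_intros continuous_k\<close>)
  qed
  have "(pi / L)\<^sup>2 * Y \<le> action"
    unfolding Y_def action_def
  proof (rule Wirtinger_mean_zero)
    show "((\<lambda>x. k x - c) has_real_derivative kd x) (at x)" for x
      using DERIV_diff[OF DERIV_k[of x] DERIV_const[of c]] by simp
  qed (use continuous_kd L_pos integral_unique[OF hy] in auto)
  moreover have "c powr (q - 1) * Y < (pi / L)\<^sup>2 * Y"
    using below_critical_mean[OF q] Y_pos by (simp add: c_def)
  ultimately have J: "c powr (q - 1) * Y < action" by simp
  \<comment> \<open>The right side of \<open>pot_le_third_order\<close>, with the two linear terms
    merged into 2/3. That term integrates to 0 and the last one to \<open>action / 3\<close>, so the
    gap is at least \<open>(action - c powr (q - 1) * Y) / 6\<close>.\<close>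
  define R where "R x = c powr (q - 1) / 6 * (k x - c)\<^sup>2 + (2 / 3 * force q c) * (k x - c)
      + 1 / 3 * (force q (k x) * (k x - c))" for x
  have hR: "(R has_integral c powr (q - 1) / 6 * Y + (2 / 3 * force q c) * 0 + 1 / 3 * action) {0..L}"
    unfolding R_def by (intro has_integral_add has_integral_mult_right hY hy action_force)
  have hP: "((\<lambda>x. pot q (k x) - pot q c) has_integral integral {0..L} (\<lambda>x. pot q (k x)) - L * pot q c) {0..L}"
    by (intro has_integral_diff has_integral_const integrable_integral integrable_continuous_interval continuous_pot_k)
  have "integral {0..L} (\<lambda>x. pot q (k x)) - L * pot q c \<le>
      c powr (q - 1) / 6 * Y + (2 / 3 * force q c) * 0 + 1 / 3 * action"
  proof (rule has_integral_le[OF hP hR])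
    show "pot q (k x) - pot q c \<le> R x" for x
    proof -
      have "q \<ge> 2 \<or> q \<le> 1" using q by auto
      from pot_le_third_order[OF this c k_pos[of x]] show ?thesis by (simp add: R_def field_simps)
    qed
  qed
  moreover have "integral {0..L} (\<lambda>x. (kd x)\<^sup>2 / 2 - pot q (k x)) = action / 2 - integral {0..L} (\<lambda>x. pot q (k x))"
    by (rule integral_unique, intro has_integral_diff has_integral_divide has_integral_action
      integrable_integral integrable_continuous_interval continuous_pot_k)
  ultimately show ?thesis using J by (simp add: gap_def c_def)
qed

end

section \<open>Dependence on the minimum of the wave\<close>

inductive wave_term :: "(real \<Rightarrow> real) \<Rightarrow> (real \<Rightarrow> real) \<Rightarrow> (real \<Rightarrow> real) \<Rightarrow> bool"
  for k kd :: "real \<Rightarrow> real" where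
  const: "wave_term k kd (\<lambda>_. c)"
| deriv: "wave_term k kd kd"
| ln: "wave_term k kd (\<lambda>x. ln (k x))"
| powr: "wave_term k kd (\<lambda>x. k x powr p)"
| add: "wave_term k kd f \<Longrightarrow> wave_term k kd g \<Longrightarrow> wave_term k kd (\<lambda>x. f x + g x)"
| mult: "wave_term k kd f \<Longrightarrow> wave_term k kd g \<Longrightarrow> wave_term k kd (\<lambda>x. f x * g x)"

lemma wave_term_force:
  assumes "\<And>x. 0 < k x" shows "wave_term k kd (\<lambda>x. - force q (k x))"
proof (cases "q = 0")
  case True
  have "wave_term k kd (\<lambda>x. (-1) * ln (k x))" by (intro wave_term.intros)
  then show ?thesis using True by (simp add: force_def)
next
  case False
  have "wave_term k kd (\<lambda>x. (- 1 / q) * (k x powr q) + 1 / q)" by (intro wave_term.intros)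
  moreover have "(\<lambda>x. (- 1 / q) * (k x powr q) + 1 / q) = (\<lambda>x. - force q (k x))"
    using False by (auto simp: force_def field_simps)
  ultimately show ?thesis by simp
qed

text \<open>The expressions in \<open>k\<close>, \<open>k'\<close>, \<open>ln k\<close> and the powers of \<open>k\<close> are closed under
  differentiation because the equation eliminates \<open>k''\<close>.\<close>

lemma wave_term_DERIV:
  assumes k: "\<And>x. 0 < k x" "\<And>x. (k has_real_derivative kd x) (at x)"
      "\<And>x. (kd has_real_derivative - force q (k x)) (at x)"
    and "wave_term k kd f"
  shows "\<exists>g. wave_term k kd g \<and> (\<forall>x. (f has_real_derivative g x) (at x))"
  using assms(4)
proof induction
  case (const c)
  show ?case by (intro exI[of _ "\<lambda>_. 0"]) (auto intro: wave_term.const)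
next
  case deriv
  show ?case using wave_term_force[of k, OF k(1)] k(3) by blast
next
  case ln
  have "wave_term k kd (\<lambda>x. k x powr (-1) * kd x)" by (intro wave_term.intros)
  moreover have "((\<lambda>x. ln (k x)) has_real_derivative k x powr (-1) * kd x) (at x)" for x
    using DERIV_chain2[OF DERIV_ln[OF k(1)] k(2)] k(1)[of x] by (simp add: powr_minus)
  ultimately show ?case by blast
next
  case (powr p)
  have "wave_term k kd (\<lambda>x. p * k x powr (p - 1) * kd x)" by (intro wave_term.intros)
  moreover have "((\<lambda>x. k x powr p) has_real_derivative p * k x powr (p - 1) * kd x) (at x)" for x
    using DERIV_chain2[OF has_real_derivative_powr[OF k(1)] k(2)] .
  ultimately show ?case by blast
next
  case (add f g)
  then obtain f' g' where "wave_term k kd f'" "wave_term k kd g'"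
    "\<And>x. (f has_real_derivative f' x) (at x)" "\<And>x. (g has_real_derivative g' x) (at x)" by blast
  then show ?case
    by (intro exI[of _ "\<lambda>x. f' x + g' x"]) (auto intro: wave_term.add DERIV_add)
next
  case (mult f g)
  then obtain f' g' where *: "wave_term k kd f'" "wave_term k kd g'"
    "\<And>x. (f has_real_derivative f' x) (at x)" "\<And>x. (g has_real_derivative g' x) (at x)" by blast
  have "wave_term k kd (\<lambda>x. f' x * g x + g' x * f x)"
    by (intro wave_term.add wave_term.mult * mult.hyps)
  moreover have "((\<lambda>x. f x * g x) has_real_derivative f' x * g x + g' x * f x) (at x)" for x
    by (intro DERIV_mult *)
  ultimately show ?case by blast
qed

lemma force_ode_smooth:
  assumes k: "\<And>x. 0 < k x" "\<And>x. (k has_real_derivative kd x) (at x)"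
      "\<And>x. (kd has_real_derivative - force q (k x)) (at x)"
  shows "smooth k"
proof -
  \<comment> \<open>The class has no generator for \<open>k\<close> itself; it enters as the power
    with exponent 1.\<close>
  have "wave_term k kd ((deriv ^^ j) (\<lambda>x. k x powr 1))" for j
  proof (induction j)
    case (Suc j)
    obtain g where g: "wave_term k kd g"
      "\<And>x. ((deriv ^^ j) (\<lambda>x. k x powr 1) has_real_derivative g x) (at x)"
      using wave_term_DERIV[OF k Suc] by blast
    have "(deriv ^^ Suc j) (\<lambda>x. k x powr 1) = g" using DERIV_imp_deriv[OF g(2)] by auto
    then show ?case using g(1) by simp
  qed (simp add: wave_term.powr del: powr_one')
  moreover have "(\<lambda>x. k x powr 1) = k" using k(1) by (auto simp: less_imp_le)
  ultimately have "wave_term k kd ((deriv ^^ j) k)" for j by metis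
  then show ?thesis
    unfolding smooth_def using wave_term_DERIV[OF k] real_differentiable_def by blast
qed

lemma is_k_ode:
  assumes "is_k q \<alpha> l"
  shows "0 < l x" "(l has_real_derivative deriv l x) (at x)"
    "(deriv l has_real_derivative - force q (l x)) (at x)" "l 0 = \<alpha>" "deriv l 0 = 0"
proof -
  show "0 < l x" "l 0 = \<alpha>" "deriv l 0 = 0" using assms by (auto simp: is_k_def)
  have s: "(deriv ^^ j) l differentiable (at x)" for j using assms by (auto simp: is_k_def smooth_def)
  show "(l has_real_derivative deriv l x) (at x)"
    using s[of 0] by (simp add: DERIV_deriv_iff_real_differentiable)
  have "(deriv ^^ 2) l x + force q (l x) = 0" using assms by (auto simp: is_k_def force_def)
  moreover have "(deriv l has_real_derivative (deriv ^^ 2) l x) (at x)"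
    using s[of 1] by (simp add: DERIV_deriv_iff_real_differentiable numeral_2_eq_2)
  ultimately show "(deriv l has_real_derivative - force q (l x)) (at x)"
    by (metis add_eq_0_iff2)
qed

lemma is_k_intro:
  assumes k: "\<And>x. 0 < k x" "\<And>x. (k has_real_derivative kd x) (at x)"
      "\<And>x. (kd has_real_derivative - force q (k x)) (at x)"
    and "k 0 = \<alpha>" "kd 0 = 0" "0 < T" "\<And>x. k (x + T) = k x"
  shows "is_k q \<alpha> k"
proof -
  have d: "deriv k = kd" "deriv kd = (\<lambda>x. - force q (k x))"
    using DERIV_imp_deriv[OF k(2)] DERIV_imp_deriv[OF k(3)] by auto
  have "periodic k" unfolding periodic_def using assms by (auto simp: periodic_fun_simple_def)
  moreover have "(deriv ^^ 2) k x + force q (k x) = 0" for x by (simp add: numeral_2_eq_2 d)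
  ultimately show ?thesis
    using assms force_ode_smooth[OF k] by (auto simp: is_k_def d force_def)
qed

lemma is_least_period_unique: "is_least_period f S \<Longrightarrow> is_least_period f T \<Longrightarrow> S = T"
  unfolding is_least_period_def by (metis linorder_neqE_linordered_idom)

context wave
begin

lemma k_fun_eq: "k_fun q \<beta> = k"
  unfolding k_fun_def
proof (rule the_equality)
  show "is_k q \<beta> k"
    using L_pos by (intro is_k_intro[OF k_pos DERIV_k DERIV_kd k_0 kd_0 _ k_period]) auto
  show "l = k" if "is_k q \<beta> l" for l
    using is_k_ode(4,5)[OF that] k_0 kd_0
    by (intro force_ode_unique[OF is_k_ode(1-3)[OF that] k_pos DERIV_k DERIV_kd]) auto
qed

text \<open>Within one period the minimum is attained only at 0: \<open>k\<close> increases strictly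
  up to \<open>L\<close>, and the second half is its mirror image.\<close>

lemma least_period: "is_least_period k (2 * L)"
  unfolding is_least_period_def
proof (intro conjI allI impI)
  fix S assume S: "0 < S \<and> S < 2 * L"
  show "\<not> periodic_fun_simple k S"
  proof
    assume "periodic_fun_simple k S"
    then have "k (0 + S) = k 0" by (rule periodic_fun_simple.plus_period)
    moreover have "k 0 < k S"
    proof (cases "S \<le> L")
      case False
      then have "k 0 < k (2 * L - S)" using S by (intro k_increasing) auto
      then show ?thesis by (simp add: k_reflect)
    qed (use S in \<open>auto intro: k_increasing\<close>)
    ultimately show False by simp
  qed
qed (use L_pos k_period in \<open>auto simp: periodic_fun_simple_def\<close>)

lemma P_fun_eq: "P_fun q \<beta> = 2 * L"
  unfolding P_fun_def k_fun_eq
  using least_period is_least_period_unique by (intro the_equality) auto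

lemma integral_period:
  assumes "continuous_on {0..2 * L} f" "\<And>x. f (2 * L - x) = f x"
  shows "integral {0..2 * L} f = 2 * integral {0..L} (f :: real \<Rightarrow> real)"
  using integral_fold[OF _ assms(1)] L_pos assms(2) by simp

lemma A_fun_eq: "A_fun q \<beta> = 2 * mass"
  unfolding A_fun_def k_fun_eq P_fun_eq mass_def
  using k_reflect by (intro integral_period continuous_k) auto

end

text \<open>The virial identity solved for the mass, so that differentiability in \<beta> is
  inherited from period and action.\<close>

definition half_mass :: "real \<Rightarrow> real \<Rightarrow> real" where
  "half_mass q \<beta> = ((q + 3) * half_action q \<beta> - 2 * (q + 1) * pot q \<beta> * half_period q \<beta> + 2 * half_period q \<beta>) / 2"

definition half_gap :: "real \<Rightarrow> real \<Rightarrow> real" where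
  "half_gap q \<beta> = half_action q \<beta> - pot q \<beta> * half_period q \<beta>
     + half_period q \<beta> * pot q (half_mass q \<beta> / half_period q \<beta>)"

lemma wave_data:
  assumes "0 < \<beta>" "\<beta> < 1"
  obtains k kd where "wave q \<beta> (half_period q \<beta>) k kd"
    "wave.action (half_period q \<beta>) kd = half_action q \<beta>"
    "wave.mass (half_period q \<beta>) k = half_mass q \<beta>"
    "wave.gap q (half_period q \<beta>) k kd = half_gap q \<beta>"
proof -
  obtain k kd where w: "wave q \<beta> (half_period q \<beta>) k kd"
    "integral {0..half_period q \<beta>} (\<lambda>x. (kd x)\<^sup>2) = half_action q \<beta>"
    using wave_exists[OF assms] by blast
  interpret wave q \<beta> "half_period q \<beta>" k kd by (rule w)
  have a: "action = half_action q \<beta>" using w(2) by (simp add: action_def)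
  have m: "mass = half_mass q \<beta>" using virial unfolding half_mass_def a by simp
  have "gap = half_gap q \<beta>" unfolding gap_eq half_gap_def a m ..
  then show ?thesis using that w a m by blast
qed

lemma half_period_pos: "0 < \<beta> \<Longrightarrow> \<beta> < 1 \<Longrightarrow> 0 < half_period q \<beta>"
  using wave_data[of \<beta> q] wave.L_pos by metis

text \<open>Places the mean between \<beta> and 1. There V' is negative, which gives the derivative
  of the scaled gap its sign, and V is at most \<open>pot q \<beta>\<close>.\<close>

lemma half_mass_bounds:
  assumes "0 < \<beta>" "\<beta> < 1" "1 < q"
  shows "\<beta> * half_period q \<beta> \<le> half_mass q \<beta>" "half_mass q \<beta> < half_period q \<beta>"
proof -
  obtain k kd where w: "wave q \<beta> (half_period q \<beta>) k kd"
    "wave.mass (half_period q \<beta>) k = half_mass q \<beta>"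
    using wave_data[OF assms(1,2)] by metis
  interpret wave q \<beta> "half_period q \<beta>" k kd by (rule w)
  show "half_mass q \<beta> < half_period q \<beta>" using mass_less assms w by simp
  have "half_period q \<beta> * \<beta> \<le> mass"
  proof (rule has_integral_le[OF has_integral_const has_integral_mass])
    show "\<beta> \<le> k x" if "x \<in> {0..half_period q \<beta>}" for x
      using k_increasing[of 0 x] that k_0 by (cases "x = 0") auto
  qed
  then show "\<beta> * half_period q \<beta> \<le> half_mass q \<beta>" using w by (simp add: mult.commute)
qed

text \<open>Conservation of energy with V nonnegative bounds \<open>k'^2\<close> by twice the energy
  level; this makes the gap small near \<beta> = 1.\<close>

lemma half_action_bounds:
  assumes "0 < \<beta>" "\<beta> < 1"
  shows "0 \<le> half_action q \<beta>" "half_action q \<beta> \<le> 2 * pot q \<beta> * half_period q \<beta>"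
proof -
  obtain k kd where w: "wave q \<beta> (half_period q \<beta>) k kd"
    "wave.action (half_period q \<beta>) kd = half_action q \<beta>"
    using wave_data[OF assms] by metis
  interpret wave q \<beta> "half_period q \<beta>" k kd by (rule w)
  show "0 \<le> half_action q \<beta>" using has_integral_nonneg[OF has_integral_action] w by simp
  have "action \<le> half_period q \<beta> * (2 * pot q \<beta>)"
  proof (rule has_integral_le[OF has_integral_action has_integral_const])
    show "(kd x)\<^sup>2 \<le> 2 * pot q \<beta>" for x
      using energy_conserved[of x] pot_nonneg[OF k_pos, of q x] by simp
  qed
  then show "half_action q \<beta> \<le> 2 * pot q \<beta> * half_period q \<beta>" using w by (simp add: mult_ac)
qed

lemma E_fun_eq:
  assumes "0 < \<beta>" "\<beta> < 1"
  shows "E_fun q \<beta> = (2 * half_period q \<beta>) powr (3 - q) * (2 * half_mass q \<beta>) powr (q - 1)"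
proof -
  obtain k kd where w: "wave q \<beta> (half_period q \<beta>) k kd"
    "wave.mass (half_period q \<beta>) k = half_mass q \<beta>"
    using wave_data[OF assms] by metis
  then show ?thesis
    unfolding E_fun_def using wave.P_fun_eq[OF w(1)] wave.A_fun_eq[OF w(1)] by simp
qed

section \<open>Differentiating period and action with respect to the minimum\<close>

lemma arc_in_domain:
  fixes x t :: real
  assumes "x \<in> {a<..<0}" shows "a < x * cos t"
proof -
  have "x * 1 \<le> x * cos t" using assms by (intro mult_left_mono_neg) auto
  moreover have "a < x" using assms by simp
  ultimately show ?thesis by linarith
qed

lemma amp_rate_profile_C1:
  assumes "0 < b"
  shows "s \<in> {amp q b<..} \<Longrightarrow> ((\<lambda>s. amp_rate q (profile q s)) has_real_derivative
      amp_rate' q (profile q s) * amp_rate q (profile q s)) (at s)"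
    and "continuous_on {amp q b<..} (\<lambda>s. amp_rate' q (profile q s) * amp_rate q (profile q s))"
proof -
  show "((\<lambda>s. amp_rate q (profile q s)) has_real_derivative
      amp_rate' q (profile q s) * amp_rate q (profile q s)) (at s)" if "s \<in> {amp q b<..}"
    using that by (intro DERIV_amp_rate_profile[OF assms]) auto
  have "isCont (\<lambda>s. amp_rate' q (profile q s) * amp_rate q (profile q s)) s" if "amp q b < s" for s
  proof -
    have p: "0 < profile q s" using profile_gt[OF assms that] assms by simp
    have c: "isCont (profile q) s" using DERIV_profile[OF assms that] by (rule DERIV_isCont)
    show ?thesis
      by (intro isCont_mult isCont_o2[OF c isCont_amp_rate'[OF p]] isCont_o2[OF c isCont_amp_rate[OF p]])
  qed
  then show "continuous_on {amp q b<..} (\<lambda>s. amp_rate' q (profile q s) * amp_rate q (profile q s))"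
    by (intro continuous_at_imp_continuous_on) auto
qed

text \<open>Existence is enough: in the derivative of the scaled gap, the value \<open>P'\<close>
  survives only inside the derivative of E.\<close>

lemma DERIV_half_period:
  assumes \<beta>: "0 < \<beta>" "\<beta> < 1"
  obtains P' where "(half_period q has_real_derivative P') (at \<beta>)"
proof -
  define b where "b = \<beta> / 2"
  have b: "0 < b" "b < \<beta>" using \<beta> by (auto simp: b_def)
  have a: "amp q \<beta> \<in> {amp q b<..<0}" using amp_strict_mono[OF b] amp_neg[OF \<beta>] by auto
  have "((\<lambda>x. integral {0..pi} (\<lambda>t. 1 / sqrt 2 * amp_rate q (profile q (0 + x * cos t)))) has_real_derivative
      integral {0..pi} (\<lambda>t. 1 / sqrt 2 * cos t * (amp_rate' q (profile q (0 + amp q \<beta> * cos t)) * amp_rate q (profile q (0 + amp q \<beta> * cos t))))) (at (amp q \<beta>))"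
    by (rule DERIV_integral_linear_arg[OF amp_rate_profile_C1[OF b(1)] _ _ _ _ a])
      (auto intro!: continuous_intros arc_in_domain)
  from DERIV_chain2[where f = "\<lambda>x. integral {0..pi} (\<lambda>t. 1 / sqrt 2 * amp_rate q (profile q (0 + x * cos t)))" and g = "amp q", OF this DERIV_amp[OF \<beta>(1)]]
  show ?thesis using that unfolding half_period_def[abs_def] by simp
qed

text \<open>The classical relation that the derivative of the action by the energy level is the
  period, here with energy level \<open>a^2\<close> and \<open>a = amp q \<beta>\<close>.
  Differentiating \<open>2 * a^2 * I\<close> leaves a term \<open>I'\<close> with \<open>f'\<close>,
  which an integration by parts in the angle trades for \<open>P\<close> and
  \<open>I\<close>.\<close>

lemma DERIV_half_action:
  assumes \<beta>: "0 < \<beta>" "\<beta> < 1"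
  shows "(half_action q has_real_derivative force q \<beta> * half_period q \<beta>) (at \<beta>)"
proof -
  define b where "b = \<beta> / 2"
  have b: "0 < b" "b < \<beta>" using \<beta> by (auto simp: b_def)
  define a where "a = amp q \<beta>"
  have a: "a \<in> {amp q b<..<0}" using amp_strict_mono[OF b] amp_neg[OF \<beta>] by (auto simp: a_def)
  define f where "f s = amp_rate q (profile q s)" for s
  define f' where "f' s = amp_rate' q (profile q s) * amp_rate q (profile q s)" for s
  have f: "(f has_real_derivative f' s) (at s)" if "s \<in> {amp q b<..}" for s
    unfolding f_def f'_def using amp_rate_profile_C1(1)[OF b(1) that] .
  have cf': "continuous_on {amp q b<..} f'"
    unfolding f'_def using amp_rate_profile_C1(2)[OF b(1)] .
  have arc: "a * cos t \<in> {amp q b<..}" for t using arc_in_domain[OF a, of t] by simp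
  have cft: "continuous_on {0..pi} (\<lambda>t. f (a * cos t))"
  proof (rule continuous_on_compose2[of "{amp q b<..}" f])
    show "continuous_on {amp q b<..} f"
      by (intro continuous_at_imp_continuous_on ballI DERIV_isCont[OF f])
  qed (use arc in \<open>auto intro!: continuous_intros\<close>)
  have cft': "continuous_on {0..pi} (\<lambda>t. f' (a * cos t))"
    by (rule continuous_on_compose2[OF cf']) (use arc in \<open>auto intro!: continuous_intros\<close>)
  define I where "I = integral {0..pi} (\<lambda>t. ((sin t)\<^sup>2 / sqrt 2) * f (a * cos t))"
  define I' where "I' = integral {0..pi} (\<lambda>t. ((sin t)\<^sup>2 / sqrt 2) * cos t * f' (a * cos t))"
  define P where "P = integral {0..pi} (\<lambda>t. 1 / sqrt 2 * f (a * cos t))"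
  have hI: "((\<lambda>t. ((sin t)\<^sup>2 / sqrt 2) * f (a * cos t)) has_integral I) {0..pi}"
    and hI': "((\<lambda>t. ((sin t)\<^sup>2 / sqrt 2) * cos t * f' (a * cos t)) has_integral I') {0..pi}"
    and hP: "((\<lambda>t. 1 / sqrt 2 * f (a * cos t)) has_integral P) {0..pi}"
    unfolding I_def I'_def P_def
    by (intro integrable_integral integrable_continuous_interval continuous_intros cft cft'; simp)+
  have "((\<lambda>x. integral {0..pi} (\<lambda>t. ((sin t)\<^sup>2 / sqrt 2) * f (0 + x * cos t))) has_real_derivative
      integral {0..pi} (\<lambda>t. ((sin t)\<^sup>2 / sqrt 2) * cos t * f' (0 + a * cos t))) (at a)"
    by (rule DERIV_integral_linear_arg[OF f cf' _ _ _ _ a])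
      (auto intro!: continuous_intros arc_in_domain)
  then have "((\<lambda>x. integral {0..pi} (\<lambda>t. ((sin t)\<^sup>2 / sqrt 2) * f (x * cos t))) has_real_derivative I') (at a)"
    by (simp add: I'_def)
  from DERIV_mult[OF DERIV_cmult[OF DERIV_power[OF DERIV_ident, of 2], of 2] this]
  have dA: "((\<lambda>x. 2 * x\<^sup>2 * integral {0..pi} (\<lambda>t. ((sin t)\<^sup>2 / sqrt 2) * f (x * cos t))) has_real_derivative
      4 * a * I + 2 * a\<^sup>2 * I') (at a)"
    by (simp add: I_def algebra_simps)
  \<comment> \<open>The total derivative of \<open>f (a * cos t) * cos t * sin t / sqrt 2\<close>;
    its end values vanish with the sine, which yields \<open>a * I' = P - 2 * I\<close>.\<close>
  have "((\<lambda>t. 1 / sqrt 2 * (- (a * sin t * f' (a * cos t)) * (cos t * sin t) + ((cos t)\<^sup>2 - (sin t)\<^sup>2) * f (a * cos t)))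
      has_integral (1 / sqrt 2 * (f (a * cos pi) * (cos pi * sin pi)) - 1 / sqrt 2 * (f (a * cos 0) * (cos 0 * sin 0)))) {0..pi}"
  proof (rule has_integral_DERIV)
    fix t :: real
    have 1: "((\<lambda>t. a * cos t) has_real_derivative - (a * sin t)) (at t)" by (auto intro!: derivative_eq_intros)
    have 2: "((\<lambda>t. cos t * sin t) has_real_derivative (cos t)\<^sup>2 - (sin t)\<^sup>2) (at t)"
      by (auto intro!: derivative_eq_intros simp: power2_eq_square)
    from DERIV_cmult[OF DERIV_mult[OF DERIV_chain2[where f = f and g = "\<lambda>t. a * cos t", OF f[OF arc] 1] 2], of "1 / sqrt 2"]
    show "((\<lambda>t. 1 / sqrt 2 * (f (a * cos t) * (cos t * sin t))) has_real_derivative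
      1 / sqrt 2 * (- (a * sin t * f' (a * cos t)) * (cos t * sin t) + ((cos t)\<^sup>2 - (sin t)\<^sup>2) * f (a * cos t))) (at t)"
      by (simp add: mult_ac)
  qed simp
  then have h0: "((\<lambda>t. 1 / sqrt 2 * (- (a * sin t * f' (a * cos t)) * (cos t * sin t) + ((cos t)\<^sup>2 - (sin t)\<^sup>2) * f (a * cos t)))
      has_integral 0) {0..pi}" by simp
  have e: "1 / sqrt 2 * (- (a * sin t * f' (a * cos t)) * (cos t * sin t) + ((cos t)\<^sup>2 - (sin t)\<^sup>2) * f (a * cos t)) =
      - a * (((sin t)\<^sup>2 / sqrt 2) * cos t * f' (a * cos t)) + 1 / sqrt 2 * f (a * cos t) - 2 * (((sin t)\<^sup>2 / sqrt 2) * f (a * cos t))" for t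
    unfolding cos_squared_eq divide_inverse by (simp add: algebra_simps power2_eq_square)
  have "((\<lambda>t. - a * (((sin t)\<^sup>2 / sqrt 2) * cos t * f' (a * cos t)) + 1 / sqrt 2 * f (a * cos t) - 2 * (((sin t)\<^sup>2 / sqrt 2) * f (a * cos t)))
      has_integral (- a * I' + P - 2 * I)) {0..pi}"
    by (intro has_integral_add has_integral_diff has_integral_mult_right hI hI' hP)
  then have "- a * I' + P - 2 * I = 0" using h0 unfolding e by (rule has_integral_unique)
  then have "2 * a * (2 * I + a * I') = 2 * a * P" by simp
  then have eq: "4 * a * I + 2 * a\<^sup>2 * I' = 2 * a * P" by (simp add: algebra_simps power2_eq_square)
  from DERIV_chain2[where f = "\<lambda>x. 2 * x\<^sup>2 * integral {0..pi} (\<lambda>t. ((sin t)\<^sup>2 / sqrt 2) * f (x * cos t))" and g = "amp q",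
      OF dA[unfolded a_def] DERIV_amp[OF \<beta>(1)]]
  have "(half_action q has_real_derivative 2 * amp q \<beta> * P * inverse (amp_rate q \<beta>)) (at \<beta>)"
    using eq unfolding half_action_def[abs_def] f_def a_def by simp
  moreover have "2 * amp q \<beta> * P * inverse (amp_rate q \<beta>) = force q \<beta> * P"
    using force_amp_rate[OF \<beta>(1), of q] amp_rate_pos[OF \<beta>(1), of q] by (simp add: field_simps)
  moreover have "P = half_period q \<beta>" by (simp add: P_def half_period_def f_def a_def)
  ultimately show ?thesis by metis
qed

text \<open>The energy gap between a wave and its mean at a fixed common period is, up to a constant
  factor, \<open>half_period powr ((3 + q) / (q - 1)) * half_gap\<close>. Its derivative is tied to
  the logarithmic one of \<open>E\<close> by the virial identity and \<open>half_action' = force * half_period\<close>.\<close>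

lemma DERIV_scaled_gap:
  assumes \<beta>: "0 < \<beta>" "\<beta> < 1" and q: "1 < q" and E: "(E_fun q has_real_derivative d) (at \<beta>)"
  shows "((\<lambda>\<beta>. half_period q \<beta> powr ((3 + q) / (q - 1)) * half_gap q \<beta>) has_real_derivative
    half_period q \<beta> powr ((3 + q) / (q - 1)) * (force q (half_mass q \<beta> / half_period q \<beta>) *
      half_mass q \<beta> / (q - 1)) * (d / E_fun q \<beta>)) (at \<beta>)"
proof -
  define P where "P = half_period q \<beta>"
  define A where "A = half_mass q \<beta>"
  define J where "J = half_action q \<beta>"
  define e where "e = pot q \<beta>"
  define f where "f = force q \<beta>"
  define V where "V = pot q (A / P)"
  define F where "F = force q (A / P)"
  \<comment> \<open>A common period forces the length scale to be proportional to
    \<open>1 / P\<close>; invariance under \<open>scale_invariant\<close> then makes the height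
    scale its power \<open>2 / (q - 1)\<close>. The factor \<open>2 / (a * b^2)\<close> of the
    energy difference is thus proportional to \<open>P powr g\<close>.\<close>
  define g where "g = (3 + q) / (q - 1)"
  have P: "0 < P" unfolding P_def by (rule half_period_pos[OF \<beta>])
  have A: "0 < A"
    using half_mass_bounds(1)[OF \<beta> q] P mult_pos_pos[OF \<beta>(1) P] unfolding P_def A_def by linarith
  obtain P' where P': "(half_period q has_real_derivative P') (at \<beta>)" using DERIV_half_period[OF \<beta>] by blast
  note J' = DERIV_half_action[OF \<beta>, of q] and e' = DERIV_pot[OF \<beta>(1), of q]
  have "\<exists>A'. (half_mass q has_real_derivative A') (at \<beta>)"
    unfolding half_mass_def[abs_def]
    by (intro exI, (rule derivative_intros P' J' e')+) simp
  then obtain A' where A': "(half_mass q has_real_derivative A') (at \<beta>)" ..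
  have dE: "d = (3 - q) * E_fun q \<beta> * P' / P + (q - 1) * E_fun q \<beta> * A' / A"
  proof -
    let ?E = "\<lambda>\<beta>. (2 * half_period q \<beta>) powr (3 - q) * (2 * half_mass q \<beta>) powr (q - 1)"
    have 1: "((\<lambda>\<beta>. (2 * half_period q \<beta>) powr (3 - q)) has_real_derivative
        (3 - q) * (2 * P) powr (3 - q - 1) * (2 * P')) (at \<beta>)"
      using DERIV_chain2[OF has_real_derivative_powr[of "2 * half_period q \<beta>" "3 - q"] DERIV_cmult[OF P', of 2]] P
      by (simp add: P_def)
    have 2: "((\<lambda>\<beta>. (2 * half_mass q \<beta>) powr (q - 1)) has_real_derivative
        (q - 1) * (2 * A) powr (q - 1 - 1) * (2 * A')) (at \<beta>)"
      using DERIV_chain2[OF has_real_derivative_powr[of "2 * half_mass q \<beta>" "q - 1"] DERIV_cmult[OF A', of 2]] A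
      by (simp add: A_def)
    have "(?E has_real_derivative d) (at \<beta>)"
      by (rule has_field_derivative_transform_within_open[OF E, of "{0<..<1}"]) (use \<beta> E_fun_eq in auto)
    then have "d = (3 - q) * (2 * P) powr (3 - q - 1) * (2 * P') * (2 * A) powr (q - 1)
        + (q - 1) * (2 * A) powr (q - 1 - 1) * (2 * A') * (2 * P) powr (3 - q)"
      using DERIV_unique[OF _ DERIV_mult[OF 1 2]] by (simp add: P_def A_def)
    moreover have "(2 * P) powr (3 - q - 1) = (2 * P) powr (3 - q) / (2 * P)"
      "(2 * A) powr (q - 1 - 1) = (2 * A) powr (q - 1) / (2 * A)"
      using P A by (subst powr_diff; simp)+
    moreover define X Y where "X = (2 * P) powr (3 - q)" and "Y = (2 * A) powr (q - 1)"
    ultimately have "d = (3 - q) * (X / (2 * P)) * (2 * P') * Y + (q - 1) * (Y / (2 * A)) * (2 * A') * X"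
      by simp
    moreover have "E_fun q \<beta> = X * Y"
      using E_fun_eq[OF \<beta>] by (simp add: P_def A_def X_def Y_def)
    ultimately show ?thesis using P A by (simp add: field_simps)
  qed
  have E_pos: "0 < E_fun q \<beta>" using E_fun_eq[OF \<beta>, of q] P A by (simp add: P_def A_def)
  have c': "((\<lambda>\<beta>. pot q (half_mass q \<beta> / half_period q \<beta>)) has_real_derivative
      F * ((A' * P - A * P') / (P * P))) (at \<beta>)"
    using DERIV_chain2[OF DERIV_pot DERIV_divide[OF A' P']] P A by (simp add: P_def A_def F_def)
  define G' where "G' = f * P - (f * P + P' * e) + (P' * V + F * ((A' * P - A * P') / (P * P)) * P)"
  have G: "(half_gap q has_real_derivative G') (at \<beta>)"
    using DERIV_add[OF DERIV_diff[OF J' DERIV_mult[OF e' P']] DERIV_mult[OF P' c']]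
    unfolding half_gap_def[abs_def] G'_def f_def P_def e_def V_def A_def by simp
  have S: "((\<lambda>\<beta>. half_period q \<beta> powr g * half_gap q \<beta>) has_real_derivative
      (g * P powr (g - 1) * P') * half_gap q \<beta> + G' * P powr g) (at \<beta>)"
    using DERIV_mult[OF DERIV_chain2[OF has_real_derivative_powr[of "half_period q \<beta>" g] P'] G] P
    by (simp add: P_def)
  have vir: "(q + 3) * J = 2 * A + 2 * (q + 1) * e * P - 2 * P"
    by (simp add: J_def A_def e_def P_def half_mass_def field_simps)
  have hom: "(q + 1) * V = A / P * F - A / P + 1"
    unfolding V_def F_def by (rule pot_force) (use A P in simp)
  have gap: "half_gap q \<beta> = J - e * P + P * V"
    by (simp add: half_gap_def J_def e_def P_def V_def A_def)
  define c where "c = A / P"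
  have Ac: "A = c * P" using P by (simp add: c_def)
  \<comment> \<open>Multiplying by \<open>q - 1\<close> turns \<open>g\<close> into
    \<open>q + 3\<close>, the coefficient of the action in the virial identity.\<close>
  have "(q - 1) * (g * (J - e * P + P * V) * (P' / P) + G')
      = (q + 3) * (J - e * P + P * V) * (P' / P) + (q - 1) * G'"
  proof -
    have "(q - 1) * (g * x * y + G') = ((q - 1) * g) * x * y + (q - 1) * G'" for x y
      by (simp add: distrib_left mult.assoc)
    moreover have "(q - 1) * g = q + 3" using q by (simp add: g_def)
    ultimately show ?thesis by (simp only:)
  qed
  also have "\<dots> = ((q + 3) * J - (q + 3) * (e * P) + (q + 3) * (P * V)) * (P' / P)
      + (q - 1) * (- (P' * e) + P' * V + F * (A' - c * P'))"
    using P unfolding G'_def Ac by (simp add: field_simps)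
  \<comment> \<open>After \<open>vir\<close> the terms in \<open>e\<close> cancel, and V enters only
    in the combination that \<open>hom\<close> annihilates.\<close>
  also have "\<dots> = F * ((3 - q) * c * P' + (q - 1) * A')
      + 2 * P' * ((q + 1) * V - (c * F - c + 1))"
    unfolding vir Ac using P by (simp add: field_simps)
  also have "\<dots> = F * ((3 - q) * c * P' + (q - 1) * A')"
    using hom unfolding c_def by simp
  finally have key: "(q - 1) * (g * (J - e * P + P * V) * (P' / P) + G')
      = F * ((3 - q) * c * P' + (q - 1) * A')" .
  have "(g * P powr (g - 1) * P') * half_gap q \<beta> + G' * P powr g
      = P powr g * (g * (J - e * P + P * V) * (P' / P) + G')"
    using P unfolding gap by (simp add: powr_diff field_simps)
  also have "g * (J - e * P + P * V) * (P' / P) + G' = F * ((3 - q) * c * P' + (q - 1) * A') / (q - 1)"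
    using key q by (simp add: field_simps)
  \<comment> \<open>What is left is \<open>A\<close> times the logarithmic derivative of E, which is
    \<open>(3 - q) * P' / P + (q - 1) * A' / A\<close>.\<close>
  also have "F * ((3 - q) * c * P' + (q - 1) * A') / (q - 1) = F * A / (q - 1) * (d / E_fun q \<beta>)"
    unfolding dE c_def using E_pos P A q by (simp add: field_simps)
  finally show ?thesis using S unfolding P_def[symmetric] A_def[symmetric] F_def[symmetric] g_def[symmetric]
    by (simp add: mult.assoc)
qed

text \<open>The periods stay bounded as \<beta> tends to 1, since the orbits remain in a fixed
  compact range of amplitudes. The gap is at most \<open>2 * pot q \<beta>\<close> times the half
  period, and \<open>pot q \<beta>\<close> tends to 0.\<close>

lemma scaled_gap_vanishes:
  assumes q: "1 < q"
  shows "((\<lambda>\<beta>. half_period q \<beta> powr ((3 + q) / (q - 1)) * half_gap q \<beta>) \<longlongrightarrow> 0) (at_left 1)"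
proof -
  define g where "g = (3 + q) / (q - 1)"
  have g: "0 < g" using q by (simp add: g_def)
  \<comment> \<open>Minima above 1/2 have amplitudes in \<open>{-a..a}\<close>; the smaller value
    1/4 used below leaves room inside the domain of \<open>profile\<close>.\<close>
  define a where "a = - amp q (1/2)"
  have a: "0 < a" using amp_neg[of "1/2" q] by (simp add: a_def)
  define f where "f s = amp_rate q (profile q s)" for s
  have dom: "amp q (1/4) < s" if "- a \<le> s" for s
    using that amp_strict_mono[of "1/4" "1/2" q] by (simp add: a_def)
  have fc: "isCont f s" if "- a \<le> s" for s
    unfolding f_def by (rule DERIV_isCont[OF DERIV_amp_rate_profile[OF _ dom[OF that]]]) simp
  then have "continuous_on {-a..a} f" by (intro continuous_at_imp_continuous_on) auto
  then obtain u where u: "u \<in> {-a..a}" "\<And>s. s \<in> {-a..a} \<Longrightarrow> f s \<le> f u"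
    using continuous_attains_sup[of "{-a..a}" f] a by auto
  define K where "K = pi * (1 / sqrt 2 * f u)"
  have bound: "half_period q \<beta> \<le> K" if \<beta>: "1/2 < \<beta>" "\<beta> < 1" for \<beta>
  proof -
    have ab: "- a < amp q \<beta>" "amp q \<beta> < 0"
      using amp_strict_mono[of "1/2" \<beta> q] amp_neg[of \<beta> q] \<beta> by (auto simp: a_def)
    have arg: "amp q \<beta> * cos t \<in> {-a..a}" for t
    proof -
      have "\<bar>amp q \<beta> * cos t\<bar> \<le> \<bar>amp q \<beta>\<bar> * 1" unfolding abs_mult by (intro mult_left_mono) auto
      then show ?thesis using ab by auto
    qed
    have "((\<lambda>t. 1 / sqrt 2 * f (amp q \<beta> * cos t)) has_integral half_period q \<beta>) {0..pi}"
      unfolding half_period_def f_def[symmetric]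
    proof (intro integrable_integral integrable_continuous_interval continuous_on_mult continuous_on_const)
      show "continuous_on {0..pi} (\<lambda>t. f (amp q \<beta> * cos t))"
        by (rule continuous_on_compose2[OF \<open>continuous_on {-a..a} f\<close>])
          (use arg in \<open>auto intro!: continuous_intros\<close>)
    qed
    moreover have "((\<lambda>t. 1 / sqrt 2 * f u) has_integral K) {0..pi}"
      using has_integral_const_real[of "1 / sqrt 2 * f u" 0 pi] by (simp add: K_def)
    ultimately show ?thesis
      by (rule has_integral_le) (intro mult_left_mono u(2) arg, simp)
  qed
  have K: "0 < K" using bound[of "3/4"] half_period_pos[of "3/4" q] by simp
  have gap: "\<bar>half_period q \<beta> powr g * half_gap q \<beta>\<bar> \<le> K powr g * (2 * K) * pot q \<beta>"
    if \<beta>: "1/2 < \<beta>" "\<beta> < 1" for \<beta>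
  proof -
    have b: "0 < \<beta>" "\<beta> < 1" using \<beta> by auto
    define P where "P = half_period q \<beta>"
    define e where "e = pot q \<beta>"
    have P: "0 < P" "P \<le> K" unfolding P_def using half_period_pos[OF b] bound \<beta> by auto
    have e: "0 \<le> e" unfolding e_def using b by (intro pot_nonneg)
    define c where "c = half_mass q \<beta> / P"
    have c: "\<beta> \<le> c" "c < 1"
      using half_mass_bounds[OF b q] P by (simp_all add: c_def P_def field_simps)
    have "pot q c \<le> e" using pot_decreasing[of \<beta> c q] b c by (cases "\<beta> = c") (auto simp: e_def)
    moreover have "0 \<le> pot q c" using c b by (intro pot_nonneg) auto
    ultimately have V: "0 \<le> P * pot q c" "P * pot q c \<le> P * e" using P by auto
    have "\<bar>half_gap q \<beta>\<bar> \<le> 2 * e * P"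
      using half_action_bounds[OF b, of q] V unfolding half_gap_def P_def[symmetric] e_def[symmetric] c_def[symmetric]
      by (simp add: abs_le_iff algebra_simps)
    also have "\<dots> \<le> 2 * e * K" using P e by (intro mult_left_mono) auto
    finally have 1: "\<bar>half_gap q \<beta>\<bar> \<le> 2 * e * K" .
    have 2: "P powr g \<le> K powr g" using P g by (intro powr_mono2) auto
    have "P powr g * \<bar>half_gap q \<beta>\<bar> \<le> K powr g * (2 * e * K)"
      using 1 2 by (intro mult_mono) auto
    then show ?thesis by (simp add: abs_mult P_def e_def mult_ac)
  qed
  have ev: "eventually (\<lambda>\<beta>. \<beta> \<in> {1/2<..<1}) (at_left (1::real))" by (intro eventually_at_left_real) simp
  have "(pot q \<longlongrightarrow> pot q 1) (at_left 1)"
    using DERIV_isCont[OF DERIV_pot[of 1 q]] by (simp add: isCont_def tendsto_within_subset filterlim_at_split)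
  then have "((\<lambda>\<beta>. K powr g * (2 * K) * pot q \<beta>) \<longlongrightarrow> 0) (at_left 1)"
    using tendsto_mult_right_zero by (metis pot_one)
  moreover have "eventually (\<lambda>\<beta>. norm (half_period q \<beta> powr g * half_gap q \<beta>) \<le> K powr g * (2 * K) * pot q \<beta>) (at_left 1)"
    using ev by (rule eventually_mono) (use gap in auto)
  ultimately show ?thesis unfolding g_def by (rule Lim_null_comparison[rotated])
qed

text \<open>The factor \<sigma>, used with the values 1 and -1, treats increasing and decreasing E
  together. The quantity \<open>S\<close> decreases strictly to its limit 0, so it is positive
  before.\<close>

lemma half_gap_sign:
  assumes \<alpha>: "0 < \<alpha>" "\<alpha> < 1" and q: "1 < q"
    and E: "\<And>\<beta>. \<alpha> < \<beta> \<Longrightarrow> \<beta> < 1 \<Longrightarrow> \<exists>d. (E_fun q has_real_derivative d) (at \<beta>) \<and> 0 < \<sigma> * d"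
  shows "0 < \<sigma> * half_gap q \<alpha>"
proof -
  define S where "S \<beta> = \<sigma> * (half_period q \<beta> powr ((3 + q) / (q - 1)) * half_gap q \<beta>)" for \<beta>
  have neg: "\<exists>y. (S has_real_derivative y) (at \<beta>) \<and> y < 0" if \<beta>: "\<alpha> < \<beta>" "\<beta> < 1" for \<beta>
  proof -
    have b: "0 < \<beta>" "\<beta> < 1" using \<beta> \<alpha> by auto
    obtain d where d: "(E_fun q has_real_derivative d) (at \<beta>)" "0 < \<sigma> * d" using E[OF \<beta>] by blast
    define P where "P = half_period q \<beta>"
    define A where "A = half_mass q \<beta>"
    have P: "0 < P" unfolding P_def by (rule half_period_pos[OF b])
    have A: "0 < A" "A < P"
      using half_mass_bounds[OF b q] mult_pos_pos[OF b(1) P] unfolding P_def A_def by linarith+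
    have F: "force q (A / P) < 0" using P A by (intro force_neg) auto
    have E: "0 < E_fun q \<beta>" using E_fun_eq[OF b, of q] P A by (simp add: P_def A_def)
    from DERIV_cmult[OF DERIV_scaled_gap[OF b q d(1)], of \<sigma>]
    have "(S has_real_derivative \<sigma> * (P powr ((3 + q) / (q - 1)) * (force q (A / P) * A / (q - 1)) * (d / E_fun q \<beta>))) (at \<beta>)"
      unfolding S_def P_def A_def .
    moreover have "(P powr ((3 + q) / (q - 1)) * (A / (q - 1)) * (\<sigma> * d / E_fun q \<beta>)) * force q (A / P) < 0"
    proof (intro mult_pos_neg F mult_pos_pos[OF _ divide_pos_pos[OF d(2) E]])
      show "0 < P powr ((3 + q) / (q - 1)) * (A / (q - 1))" using P A q by simp
    qed
    then have "\<sigma> * (P powr ((3 + q) / (q - 1)) * (force q (A / P) * A / (q - 1)) * (d / E_fun q \<beta>)) < 0"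
      by (simp add: mult_ac)
    ultimately show ?thesis by blast
  qed
  \<comment> \<open>E is assumed differentiable only beyond \<alpha>; at \<alpha> itself continuity
    comes from period, action and potential.\<close>
  have cont: "isCont S \<alpha>"
  proof -
    obtain P' where P': "(half_period q has_real_derivative P') (at \<alpha>)" using DERIV_half_period[OF \<alpha>] by blast
    have P: "0 < half_period q \<alpha>" by (rule half_period_pos[OF \<alpha>])
    have cP: "isCont (half_period q) \<alpha>" and cJ: "isCont (half_action q) \<alpha>" and ce: "isCont (pot q) \<alpha>"
      using DERIV_isCont[OF P'] DERIV_isCont[OF DERIV_half_action[OF \<alpha>]] DERIV_isCont[OF DERIV_pot[OF \<alpha>(1)]] by auto
    have cA: "isCont (half_mass q) \<alpha>"
      unfolding half_mass_def[abs_def] by (intro continuous_intros cP cJ ce) auto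
    have A: "0 < half_mass q \<alpha>"
      using half_mass_bounds(1)[OF \<alpha> q] mult_pos_pos[OF \<alpha>(1) P] by linarith
    have "isCont (\<lambda>\<beta>. pot q (half_mass q \<beta> / half_period q \<beta>)) \<alpha>"
      by (rule isCont_o2[OF _ DERIV_isCont[OF DERIV_pot]]) (use A P cA cP in \<open>auto intro!: continuous_intros\<close>)
    then have "isCont (half_gap q) \<alpha>"
      unfolding half_gap_def[abs_def] by (intro continuous_intros cP cJ ce)
    then show ?thesis unfolding S_def by (intro continuous_intros cP) (use P in auto)
  qed
  have dec: "S y < S x" if "\<alpha> \<le> x" "x < y" "y < 1" for x y
  proof (rule DERIV_neg_imp_decreasing_open[OF that(2), of S])
    show "\<exists>d. (S has_real_derivative d) (at t) \<and> d < 0" if "x < t" "t < y" for t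
      using neg[of t] that \<open>\<alpha> \<le> x\<close> \<open>y < 1\<close> by auto
    have "isCont S t" if "x \<le> t" "t \<le> y" for t
      using cont neg[of t] that \<open>\<alpha> \<le> x\<close> \<open>y < 1\<close> DERIV_isCont by (cases "t = \<alpha>") auto
    then show "continuous_on {x..y} S" by (intro continuous_at_imp_continuous_on) auto
  qed
  \<comment> \<open>An intermediate point keeps the inequality strict: the limit gives only
    \<open>0 \<le> S m\<close>, and \<open>S m < S \<alpha>\<close>.\<close>
  define m where "m = (\<alpha> + 1) / 2"
  have m: "\<alpha> < m" "m < 1" using \<alpha> by (auto simp: m_def)
  have "(S \<longlongrightarrow> 0) (at_left 1)"
    unfolding S_def using tendsto_mult_right_zero[OF scaled_gap_vanishes[OF q], of \<sigma>] by simp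
  moreover have "eventually (\<lambda>\<beta>. S \<beta> \<le> S m) (at_left 1)"
    using eventually_at_left_real[OF m(2)] by (rule eventually_mono) (use dec[of m] m in \<open>auto simp: less_imp_le\<close>)
  ultimately have "0 \<le> S m" by (rule tendsto_upperbound) simp
  then have "0 < S \<alpha>" using dec[of \<alpha> m] m by simp
  moreover have "S \<alpha> = half_period q \<alpha> powr ((3 + q) / (q - 1)) * (\<sigma> * half_gap q \<alpha>)"
    by (simp add: S_def)
  ultimately show ?thesis using half_period_pos[OF \<alpha>, of q] by (simp add: zero_less_mult_iff)
qed

section \<open>Rescaling of steady states\<close>

lemma half_gap_cases:
  assumes "0 < \<alpha>" "\<alpha> < 1"
  shows "q \<ge> 2 \<or> q < 1 \<Longrightarrow> 0 < half_gap q \<alpha>" "q = 1 \<Longrightarrow> half_gap q \<alpha> = 0"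
  using wave_data[OF assms, of q] wave.gap_pos wave.gap_zero by metis+

text \<open>For an antiderivative \<open>F\<close> of a periodic function,
  \<open>F (t + T) - F t\<close> is constant, so the shift \<open>s\<close> leaves the integral over
  a full period unchanged.\<close>

lemma integral_periodic_affine:
  fixes f :: "real \<Rightarrow> real"
  assumes cont: "\<And>x. isCont f x" and per: "\<And>x. f (x + T) = f x" and "0 < a" "0 < T"
  shows "integral {0..a * T} (\<lambda>x. f ((x - s) / a)) = a * integral {0..T} f"
proof -
  obtain F where F: "\<And>t. (F has_vector_derivative f t) (at t)"
    using einterval_antiderivative[of "-\<infinity>" "\<infinity>" f] cont by auto
  then have dF: "(F has_real_derivative f t) (at t)" for t
    by (simp add: has_real_derivative_iff_has_vector_derivative)
  have "((\<lambda>t. F (t + T) - F t) has_real_derivative 0) (at t)" for t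
    using DERIV_diff[OF DERIV_shift[THEN iffD1, OF dF[of "t + T"]] dF[of t]] per[of t] by simp
  then have shift: "F (t + T) - F t = F (0 + T) - F 0" for t
    using DERIV_isconst_all[of "\<lambda>t. F (t + T) - F t"] by blast
  have "((\<lambda>x. f ((x - s) / a)) has_integral (a * F ((a * T - s) / a) - a * F ((0 - s) / a))) {0..a * T}"
  proof (rule has_integral_DERIV)
    fix x
    have "((\<lambda>x. (x - s) / a) has_real_derivative 1 / a) (at x)"
      using \<open>0 < a\<close> by (auto intro!: derivative_eq_intros)
    from DERIV_cmult[OF DERIV_chain2[where f = F and g = "\<lambda>x. (x - s) / a", OF dF this], of a]
    show "((\<lambda>x. a * F ((x - s) / a)) has_real_derivative f ((x - s) / a)) (at x)"
      using \<open>0 < a\<close> by simp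
  qed (use assms in simp)
  moreover have "(a * T - s) / a = (0 - s) / a + T" using \<open>0 < a\<close> by (simp add: field_simps)
  ultimately have "integral {0..a * T} (\<lambda>x. f ((x - s) / a)) = a * (F (0 + T) - F 0)"
    using shift[of "(0 - s) / a"] by (simp add: integral_unique flip: right_diff_distrib)
  moreover have "integral {0..T} f = F T - F 0"
    by (intro integral_unique has_integral_DERIV dF) (use \<open>0 < T\<close> in simp)
  ultimately show ?thesis by simp
qed

text \<open>Only H'' is prescribed, so the given potential agrees with \<open>pot\<close> up to an
  affine function. Affine terms drop out when a wave is compared with its mean, as both have the
  same mass.\<close>

lemma potential_eq_pot:
  assumes G: "\<And>u. 0 < u \<Longrightarrow> (G has_real_derivative g u) (at u)"
    "\<And>u. 0 < u \<Longrightarrow> (g has_real_derivative u powr (q - 1)) (at u)"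
  obtains c0 c1 where "\<And>u. 0 < u \<Longrightarrow> G u = pot q u + c1 * u + c0"
proof -
  have 1: "((\<lambda>u. g u - force q u) has_real_derivative 0) (at u)" if "0 < u" for u
    using DERIV_diff[OF G(2)[OF that] DERIV_force[OF that, of q]] by simp
  obtain c1 where c1: "\<And>u. u \<in> {0<..} \<Longrightarrow> g u - force q u = c1"
    using has_field_derivative_zero_constant[of "{0<..}" "\<lambda>u. g u - force q u"] 1
    by (metis convex_real_interval(3) greaterThan_iff has_field_derivative_at_within)
  have 2: "((\<lambda>u. G u - pot q u - c1 * u) has_real_derivative 0) (at u)" if "0 < u" for u
  proof -
    have "((\<lambda>u. G u - pot q u - c1 * u) has_real_derivative g u - force q u - c1) (at u)"
      using DERIV_diff[OF DERIV_diff[OF G(1)[OF that] DERIV_pot[OF that, of q]] DERIV_cmult[OF DERIV_ident, of c1]] by simp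
    then show ?thesis using c1[of u] that by simp
  qed
  obtain c0 where c0: "\<And>u. u \<in> {0<..} \<Longrightarrow> G u - pot q u - c1 * u = c0"
    using has_field_derivative_zero_constant[of "{0<..}" "\<lambda>u. G u - pot q u - c1 * u"] 2
    by (metis convex_real_interval(3) greaterThan_iff has_field_derivative_at_within)
  have "G u = pot q u + c1 * u + c0" if "0 < u" for u using c0[of u] that by simp
  then show ?thesis using that by blast
qed

lemma (in wave) energy_gap:
  assumes a: "0 < a" and b: "0 < b" and scale: "a\<^sup>2 * B * b powr (1 - q) = 1"
    and h: "\<And>x. h x = k ((x - s) / a) / b"
    and H: "\<And>y. y > 0 \<Longrightarrow> H differentiable (at y)"
      "\<And>y. y > 0 \<Longrightarrow> (deriv H has_real_derivative B * y powr (q - 1)) (at y)"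
  shows "energy H (a * (2 * L)) h - energy H (a * (2 * L)) (\<lambda>_. mean_value (a * (2 * L)) h) = 2 / (a * b\<^sup>2) * gap"
proof -
  \<comment> \<open>The potential seen by \<open>k\<close>: its second derivative is
    \<open>a^2 * B * (u / b) powr (q - 1)\<close>, which is \<open>u powr (q - 1)\<close> by the
    hypothesis on the scales.\<close>
  define G where "G u = a\<^sup>2 * b\<^sup>2 * H (u / b)" for u
  have scl: "((\<lambda>u. u / b) has_real_derivative 1 / b) (at u)" for u
    using b by (auto intro!: derivative_eq_intros)
  have dG: "(G has_real_derivative a\<^sup>2 * b * deriv H (u / b)) (at u)" if "0 < u" for u
  proof -
    have "(H has_real_derivative deriv H (u / b)) (at (u / b))"
      using H(1)[of "u / b"] that b by (simp add: DERIV_deriv_iff_real_differentiable)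
    from DERIV_cmult[OF DERIV_chain2[where f = H and g = "\<lambda>u. u / b", OF this scl], of "a\<^sup>2 * b\<^sup>2"]
    show ?thesis unfolding G_def using b by (simp add: power2_eq_square mult_ac)
  qed
  have dg: "((\<lambda>u. a\<^sup>2 * b * deriv H (u / b)) has_real_derivative u powr (q - 1)) (at u)" if u: "0 < u" for u
  proof -
    have "(u / b) powr (q - 1) = u powr (q - 1) * b powr (1 - q)"
      using u b by (simp add: powr_divide powr_minus_divide[of b "q - 1", simplified])
    then have "a\<^sup>2 * b * (B * (u / b) powr (q - 1) * (1 / b)) = (a\<^sup>2 * B * b powr (1 - q)) * u powr (q - 1)"
      using b by simp
    then have e: "a\<^sup>2 * b * (B * (u / b) powr (q - 1) * (1 / b)) = u powr (q - 1)" by (simp add: scale)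
    have "(deriv H has_real_derivative B * (u / b) powr (q - 1)) (at (u / b))"
      using H(2)[of "u / b"] u b by simp
    from DERIV_cmult[OF DERIV_chain2[where f = "deriv H" and g = "\<lambda>u. u / b", OF this scl], of "a\<^sup>2 * b"]
    show ?thesis unfolding e .
  qed
  obtain c0 c1 where G: "\<And>u. 0 < u \<Longrightarrow> G u = pot q u + c1 * u + c0"
    using potential_eq_pot[OF dG dg] by blast
  have HG: "H (u / b) = G u / (a\<^sup>2 * b\<^sup>2)" for u using a b by (simp add: G_def)
  have dh: "deriv h x = kd ((x - s) / a) / (a * b)" for x
  proof -
    have "((\<lambda>x. (x - s) / a) has_real_derivative 1 / a) (at x)"
      using a by (auto intro!: derivative_eq_intros)
    from DERIV_cdivide[OF DERIV_chain2[where f = k and g = "\<lambda>x. (x - s) / a", OF DERIV_k this], of b]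
    have "((\<lambda>x. k ((x - s) / a) / b) has_real_derivative kd ((x - s) / a) / (a * b)) (at x)" by simp
    moreover have "h = (\<lambda>x. k ((x - s) / a) / b)" using h by auto
    ultimately show ?thesis by (intro DERIV_imp_deriv) simp
  qed
  define f where "f y = (1 / 2 * (kd y)\<^sup>2 - (pot q (k y) + c1 * k y + c0)) / (a\<^sup>2 * b\<^sup>2)" for y
  have "1 / 2 * (deriv h x)\<^sup>2 - H (h x) = f ((x - s) / a)" for x
    unfolding dh h HG G[OF k_pos] f_def by (simp add: power_divide power_mult_distrib diff_divide_distrib)
  then have "energy H (a * (2 * L)) h = integral {0..a * (2 * L)} (\<lambda>x. f ((x - s) / a))"
    by (simp add: energy_def)
  also have "\<dots> = a * integral {0..2 * L} f"
  proof (rule integral_periodic_affine)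
    show "isCont f x" for x
      unfolding f_def
      by (intro continuous_intros isCont_k isCont_kd DERIV_isCont[OF DERIV_pot_k]) (use a b in auto)
    show "f (x + 2 * L) = f x" for x by (simp add: f_def k_period kd_period)
  qed (use a L_pos in auto)
  also have "integral {0..2 * L} f = 2 * integral {0..L} f"
  proof (rule integral_period)
    show "continuous_on {0..2 * L} f" unfolding f_def
      by (intro continuous_intros continuous_k continuous_kd continuous_pot_k) (use a b in auto)
    show "f (2 * L - x) = f x" for x by (simp add: f_def k_reflect kd_reflect)
  qed
  also have "integral {0..L} f = (integral {0..L} (\<lambda>x. (kd x)\<^sup>2 / 2 - pot q (k x)) - c1 * mass - L * c0) / (a\<^sup>2 * b\<^sup>2)"
  proof (rule integral_unique)
    have "(\<lambda>x. (kd x)\<^sup>2 / 2 - pot q (k x)) integrable_on {0..L}"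
      by (intro integrable_continuous_interval continuous_intros continuous_kd continuous_pot_k) auto
    then have "((\<lambda>x. ((kd x)\<^sup>2 / 2 - pot q (k x) - c1 * k x - c0) / (a\<^sup>2 * b\<^sup>2)) has_integral
        (integral {0..L} (\<lambda>x. (kd x)\<^sup>2 / 2 - pot q (k x)) - c1 * mass - L * c0) / (a\<^sup>2 * b\<^sup>2)) {0..L}"
      by (intro has_integral_divide has_integral_diff has_integral_mult_right has_integral_mass
          has_integral_const integrable_integral)
    then show "(f has_integral (integral {0..L} (\<lambda>x. (kd x)\<^sup>2 / 2 - pot q (k x)) - c1 * mass - L * c0) / (a\<^sup>2 * b\<^sup>2)) {0..L}"
      unfolding f_def by (simp add: diff_diff_eq)
  qed
  finally have Eh: "energy H (a * (2 * L)) h = a * (2 * ((integral {0..L} (\<lambda>x. (kd x)\<^sup>2 / 2 - pot q (k x))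
      - c1 * mass - L * c0) / (a\<^sup>2 * b\<^sup>2)))" .
  have "integral {0..a * (2 * L)} h = a * integral {0..2 * L} (\<lambda>x. k x / b)"
    unfolding h[abs_def]
    by (rule integral_periodic_affine[where f = "\<lambda>x. k x / b"])
      (use a b L_pos isCont_k in \<open>auto simp: k_period intro!: continuous_intros\<close>)
  also have "integral {0..2 * L} (\<lambda>x. k x / b) = 2 * (mass / b)"
    using integral_period[of k] continuous_k k_reflect by (simp add: mass_def)
  finally have mean: "mean_value (a * (2 * L)) h = (mass / L) / b"
    using a L_pos unfolding mean_value_def by simp
  have c: "0 < mass / L" using mass_pos L_pos by simp
  have "energy H (a * (2 * L)) (\<lambda>_. (mass / L) / b) = - (a * (2 * L)) * ((pot q (mass / L) + c1 * (mass / L) + c0) / (a\<^sup>2 * b\<^sup>2))"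
    unfolding energy_def using a L_pos HG[of "mass / L"] G[OF c] by simp
  note Em = this
  \<comment> \<open>The contributions of \<open>c0\<close> and \<open>c1\<close> are the same in
    both energies and cancel.\<close>
  have "energy H (a * (2 * L)) h - energy H (a * (2 * L)) (\<lambda>_. mean_value (a * (2 * L)) h)
      = (2 * a / (a\<^sup>2 * b\<^sup>2)) * gap"
    unfolding Eh mean Em gap_def using a b L_pos by (simp add: field_simps)
  then show ?thesis using a by (simp add: power2_eq_square)
qed

section \<open>Scales of the rescaling, and the reduction of steady states to waves\<close>

definition scale_height :: "real \<Rightarrow> real \<Rightarrow> real \<Rightarrow> real" where
  "scale_height q B D = (if q = 0 then exp (- D / B) else (B / D) powr (1 / q))"

definition scale_length :: "real \<Rightarrow> real \<Rightarrow> real \<Rightarrow> real" where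
  "scale_length q B D = (if q = 0 then exp (D / (2 * B)) * B powr (- 1 / 2)
     else (D / B) powr (1 / (2 * q)) * D powr (- 1 / 2))"

lemma rescaling_eq: "rescaling q B D h x = scale_height q B D * h (scale_length q B D * x)"
  by (simp add: rescaling_def scale_height_def scale_length_def)

text \<open>With \<open>a\<close> the length and \<open>b\<close> the height scale, everything
  follows from \<open>a^2 * b = 1 / D\<close> and \<open>b powr q = B / D\<close>, which for q = 0
  become \<open>1 / B\<close> and 1.\<close>

lemma
  assumes B: "0 < B" and D: "q \<noteq> 0 \<Longrightarrow> 0 < D"
  shows scale_height_pos: "0 < scale_height q B D"
    and scale_length_pos: "0 < scale_length q B D"
    and scale_invariant: "(scale_length q B D)\<^sup>2 * B * scale_height q B D powr (1 - q) = 1"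
    and scale_force: "0 < y \<Longrightarrow> force q (scale_height q B D * y) =
      (scale_length q B D)\<^sup>2 * scale_height q B D * (if q = 0 then B * ln y - D else (B * y powr q - D) / q)"
proof -
  define a where "a = scale_length q B D"
  define b where "b = scale_height q B D"
  show ap: "0 < scale_length q B D" and bp: "0 < scale_height q B D"
    using B D by (auto simp: scale_length_def scale_height_def)
  have a2: "a\<^sup>2 = (if q = 0 then exp (D / B) / B else (D / B) powr (1 / q) / D)"
  proof (cases "q = 0")
    case True
    have "(exp (D / (2 * B)))\<^sup>2 = exp (D / B)"
      by (simp add: power2_eq_square flip: exp_add)
    moreover have "(B powr (- 1 / 2))\<^sup>2 = 1 / B" using B by (simp add: power2_eq_square powr_minus_divide flip: powr_add)
    ultimately show ?thesis using True by (simp add: a_def scale_length_def power_mult_distrib)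
  next
    case False
    have "((D / B) powr (1 / (2 * q)))\<^sup>2 = (D / B) powr (1 / q)"
      by (simp add: power2_eq_square flip: powr_add)
    moreover have "(D powr (- 1 / 2))\<^sup>2 = 1 / D" using D[OF False] by (simp add: power2_eq_square powr_minus_divide flip: powr_add)
    ultimately show ?thesis using False by (simp add: a_def scale_length_def power_mult_distrib)
  qed
  have a2b: "a\<^sup>2 * b = (if q = 0 then 1 / B else 1 / D)"
  proof (cases "q = 0")
    case True
    have "exp (D / B) * exp (- D / B) = 1" by (simp flip: exp_add)
    then show ?thesis using True by (simp add: a2 b_def scale_height_def)
  next
    case False
    have "(D / B) powr (1 / q) * (B / D) powr (1 / q) = 1"
      using B D[OF False] by (simp flip: powr_mult)
    then show ?thesis using False by (simp add: a2 b_def scale_height_def)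
  qed
  have bq: "b powr q = (if q = 0 then 1 else B / D)"
    using B D by (cases "q = 0") (simp_all add: b_def scale_height_def powr_powr)
  have "a\<^sup>2 * B * b powr (1 - q) = (a\<^sup>2 * b) * B / b powr q"
    using bp by (simp add: powr_diff b_def)
  also have "\<dots> = 1" using B D unfolding a2b bq by (cases "q = 0") simp_all
  finally show "(scale_length q B D)\<^sup>2 * B * scale_height q B D powr (1 - q) = 1"
    unfolding a_def b_def .
  assume y: "0 < y"
  have "force q (b * y) = (a\<^sup>2 * b) * (if q = 0 then B * ln y - D else (B * y powr q - D) / q)"
  proof (cases "q = 0")
    case True
    have "ln (b * y) = - D / B + ln y"
      using y bp True by (simp add: ln_mult b_def scale_height_def)
    then show ?thesis unfolding a2b using True B by (simp add: force_def field_simps)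
  next
    case False
    have "(b * y) powr q = B / D * y powr q" using y bp bq False by (simp add: powr_mult b_def)
    then show ?thesis unfolding a2b using False D[OF False] by (simp add: force_def field_simps)
  qed
  then show "force q (scale_height q B D * y) =
      (scale_length q B D)\<^sup>2 * scale_height q B D * (if q = 0 then B * ln y - D else (B * y powr q - D) / q)"
    unfolding a_def b_def .
qed

text \<open>Undoing the rescaling writes \<open>h\<close> as a stretched and shifted wave. Least
  periods correspond under the stretching, so \<open>X\<close> is \<open>a\<close> times the period
  of the wave and \<open>energy_gap\<close> applies.\<close>

lemma energy_gap_rescales_to:
  assumes B: "0 < B"
    and H: "\<And>y. y > 0 \<Longrightarrow> H differentiable (at y)"
      "\<And>y. y > 0 \<Longrightarrow> (deriv H has_real_derivative B * y powr (q - 1)) (at y)"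
    and X: "is_least_period h X"
    and \<alpha>: "0 < \<alpha>" "\<alpha> < 1" and resc: "rescales_to q B (\<lambda>x. h (x\<^sub>0 + x)) \<alpha>"
  obtains C where "0 < C" "energy H X h - energy H X (\<lambda>_. mean_value X h) = C * half_gap q \<alpha>"
proof -
  obtain D where D: "q \<noteq> 0 \<Longrightarrow> 0 < D" "rescaling q B D (\<lambda>x. h (x\<^sub>0 + x)) = k_fun q \<alpha>"
    using resc by (auto simp: rescales_to_def)
  obtain k kd where w: "wave q \<alpha> (half_period q \<alpha>) k kd"
    "wave.gap q (half_period q \<alpha>) k kd = half_gap q \<alpha>"
    using wave_data[OF \<alpha>] by metis
  interpret wave q \<alpha> "half_period q \<alpha>" k kd by (rule w)
  define a where "a = scale_length q B D"
  define b where "b = scale_height q B D"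
  have a: "0 < a" and b: "0 < b" and sc: "a\<^sup>2 * B * b powr (1 - q) = 1"
    unfolding a_def b_def
    using scale_length_pos[OF B D(1)] scale_height_pos[OF B D(1)] scale_invariant[OF B D(1)] by auto
  have k: "k y = b * h (x\<^sub>0 + a * y)" for y
    using fun_cong[OF D(2), of y] k_fun_eq by (simp add: rescaling_eq a_def b_def)
  have h: "h x = k ((x - x\<^sub>0) / a) / b" for x using a b by (simp add: k)
  have per: "periodic_fun_simple k S \<longleftrightarrow> periodic_fun_simple h (a * S)" for S
  proof -
    have "(\<forall>y. k (y + S) = k y) \<longleftrightarrow> (\<forall>x. h (x + a * S) = h x)"
    proof
      assume k': "\<forall>y. k (y + S) = k y"
      show "\<forall>x. h (x + a * S) = h x"
      proof
        fix x
        have "(x + a * S - x\<^sub>0) / a = (x - x\<^sub>0) / a + S" using a by (simp add: field_simps)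
        then show "h (x + a * S) = h x" unfolding h using k' by simp
      qed
    qed (simp add: k distrib_left flip: add.assoc)
    then show ?thesis by (simp add: periodic_fun_simple_def)
  qed
  have "is_least_period k (X / a)"
    unfolding is_least_period_def
  proof (intro conjI allI impI)
    show "0 < X / a" "periodic_fun_simple k (X / a)"
      using X a per[of "X / a"] by (auto simp: is_least_period_def)
    fix S assume "0 < S \<and> S < X / a"
    then have "0 < a * S" "a * S < X" using a by (auto simp: field_simps)
    then show "\<not> periodic_fun_simple k S" using X per[of S] by (auto simp: is_least_period_def)
  qed
  then have "X / a = 2 * half_period q \<alpha>" using least_period by (rule is_least_period_unique)
  then have Xa: "X = a * (2 * half_period q \<alpha>)" using a by (simp add: field_simps)
  show ?thesis
    using that[of "2 / (a * b\<^sup>2)"] energy_gap[OF a b sc h H] a b w(2) unfolding Xa by simp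
qed

text \<open>The flux is a constant \<open>C\<close>. Dividing by \<open>h powr n\<close> shows that
  the periodic function \<open>g\<close> has derivative \<open>C * h powr (- n)\<close>, of one
  sign, so \<open>C = 0\<close> and \<open>g\<close> is constant.\<close>

lemma steady_state_imp_ode:
  assumes B: "0 < B" and q: "q = m - n + 1" and h: "positive_periodic_steady_state m n B h"
  obtains D where "q \<noteq> 0 \<Longrightarrow> 0 < D" "steady_ode q B D h"
proof -
  define h1 where "h1 = deriv h"
  define h2 where "h2 = (deriv ^^ 2) h"
  define h3 where "h3 = (deriv ^^ 3) h"
  have pos: "0 < h x" for x using h by (simp add: positive_periodic_steady_state_def)
  have diff: "((deriv ^^ j) h has_real_derivative (deriv ^^ Suc j) h x) (at x)" if "j < 4" for j x
    using h that by (simp add: positive_periodic_steady_state_def C4_def DERIV_deriv_iff_real_differentiable)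
  have d0: "(h has_real_derivative h1 x) (at x)" and d1: "(h1 has_real_derivative h2 x) (at x)"
    and d2: "(h2 has_real_derivative h3 x) (at x)" for x
    using diff[of 0] diff[of 1] diff[of 2] by (simp_all add: h1_def h2_def h3_def numeral_2_eq_2 numeral_3_eq_3)
  obtain T where T: "0 < T" "\<And>x. h (x + T) = h x"
    using h by (auto simp: positive_periodic_steady_state_def periodic_def periodic_fun_simple_def)
  have shift: "f' (x + T) = f' x" if "\<And>x. f (x + T) = f x" "\<And>x. (f has_real_derivative f' x) (at x)"
    for f f' :: "real \<Rightarrow> real" and x
    using DERIV_shift[THEN iffD1, OF that(2)[of "x + T"]] that DERIV_unique by (simp add: that(1)) blast
  have T1: "h1 (x + T) = h1 x" for x by (rule shift[OF T(2) d0])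
  have T2: "h2 (x + T) = h2 x" for x by (rule shift[OF T1 d1])
  obtain C where C: "\<And>x. h x powr n * h3 x + B * h x powr m * h1 x = C"
  proof -
    have "\<forall>x. ((\<lambda>y. h y powr n * h3 y + B * h y powr m * h1 y) has_real_derivative 0) (at x)"
      using h by (simp add: positive_periodic_steady_state_def h3_def h1_def)
    from DERIV_isconst_all[OF this] show ?thesis using that by blast
  qed
  define g where "g x = h2 x + B * force q (h x)" for x
  have dg: "(g has_real_derivative C * h x powr (- n)) (at x)" for x
  proof -
    have hn: "0 < h x powr n" using pos[of x] by simp
    have "h x powr m = h x powr n * h x powr (q - 1)" by (simp add: q flip: powr_add)
    then have "h x powr n * (h3 x + B * (h x powr (q - 1) * h1 x)) = C"
      using C[of x] by (simp add: algebra_simps)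
    then have "h3 x + B * (h x powr (q - 1) * h1 x) = C * h x powr (- n)"
      using hn by (simp add: powr_minus field_simps)
    then show ?thesis
      unfolding g_def
      using DERIV_add[OF d2[of x] DERIV_cmult[OF DERIV_chain2[OF DERIV_force[where q = q, OF pos] d0], of B]] by simp
  qed
  obtain z where z: "g T - g 0 = (T - 0) * (C * h z powr (- n))"
    using MVT2[OF T(1), of g "\<lambda>x. C * h x powr (- n)"] dg by blast
  moreover have "g T = g 0" using T2[of 0] T(2)[of 0] by (simp add: g_def)
  moreover have "0 < h z powr (- n)" using pos[of z] by simp
  ultimately have "C = 0" using T(1) by simp
  then have "(g has_real_derivative 0) (at x)" for x using dg[of x] by simp
  then obtain c where c: "\<And>x. g x = c" using DERIV_isconst_all[of g] by blast
  \<comment> \<open>For q nonzero, \<open>force\<close> contains the constant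
    \<open>- 1 / q\<close>, which contributes the summand \<open>B\<close>.\<close>
  define D where "D = (if q = 0 then c else B + q * c)"
  have ode: "h2 x + (if q = 0 then B * ln (h x) - D else (B * h x powr q - D) / q) = 0" for x
    using c[of x] by (auto simp: g_def D_def force_def field_simps)
  \<comment> \<open>At a zero of \<open>h''\<close> the equation reads
    \<open>D = B * h z powr q\<close>, whence the sign of \<open>D\<close>.\<close>
  obtain z where z: "h1 T - h1 0 = (T - 0) * h2 z" using MVT2[OF T(1), of h1 h2] d1 by blast
  then have "h2 z = 0" using T1[of 0] T(1) by simp
  then have "D = B * h z powr q" if "q \<noteq> 0" using ode[of z] that by simp
  then have "0 < D" if "q \<noteq> 0" using that B pos[of z] by simp
  moreover have "steady_ode q B D h" using ode by (simp add: steady_ode_def h2_def)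
  ultimately show ?thesis by (rule that)
qed

text \<open>The rescaled function solves the normalised equation with zero initial slope, so
  uniqueness identifies it with the wave of minimum \<open>k 0\<close>, provided this value is below
  1.\<close>

lemma steady_state_rescales:
  assumes B: "0 < B" and q: "q = m - n + 1" and h: "positive_periodic_steady_state m n B h"
    and nonconst: "\<not> h constant_on UNIV" and min: "\<And>x. h x\<^sub>0 \<le> h x"
  shows "\<exists>\<alpha>\<in>{0<..<1}. rescales_to q B (\<lambda>x. h (x\<^sub>0 + x)) \<alpha>"
proof -
  obtain D where D: "q \<noteq> 0 \<Longrightarrow> 0 < D" "steady_ode q B D h"
    using steady_state_imp_ode[OF B q h] by blast
  have pos: "0 < h x" for x using h by (simp add: positive_periodic_steady_state_def)
  have diff: "((deriv ^^ j) h has_real_derivative (deriv ^^ Suc j) h x) (at x)" if "j < 4" for j x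
    using h that by (simp add: positive_periodic_steady_state_def C4_def DERIV_deriv_iff_real_differentiable)
  have d0: "(h has_real_derivative deriv h x) (at x)"
    and d1: "(deriv h has_real_derivative (deriv ^^ 2) h x) (at x)" for x
    using diff[of 0] diff[of 1] by (simp_all add: numeral_2_eq_2)
  obtain T where T: "0 < T" "\<And>x. h (x + T) = h x"
    using h by (auto simp: positive_periodic_steady_state_def periodic_def periodic_fun_simple_def)
  define l where "l x = h (x\<^sub>0 + x)" for x
  have "((\<lambda>x. h (x + x\<^sub>0)) has_real_derivative deriv h (x + x\<^sub>0)) (at x)"
    "((\<lambda>x. deriv h (x + x\<^sub>0)) has_real_derivative (deriv ^^ 2) h (x + x\<^sub>0)) (at x)" for x
    using DERIV_shift[THEN iffD1, OF d0] DERIV_shift[THEN iffD1, OF d1] by auto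
  then have dl: "(l has_real_derivative deriv h (x\<^sub>0 + x)) (at x)"
    "((\<lambda>x. deriv h (x\<^sub>0 + x)) has_real_derivative (deriv ^^ 2) h (x\<^sub>0 + x)) (at x)" for x
    unfolding l_def by (simp_all only: add.commute[of _ "x\<^sub>0"])
  have dl_eq: "deriv l = (\<lambda>x. deriv h (x\<^sub>0 + x))" using DERIV_imp_deriv[OF dl(1)] by auto
  have ddl: "(deriv ^^ 2) l x = (deriv ^^ 2) h (x\<^sub>0 + x)" for x
    using DERIV_imp_deriv[OF dl(2)] by (simp add: numeral_2_eq_2 dl_eq)
  have ode_l: "steady_ode q B D l"
    using D(2) unfolding steady_ode_def ddl l_def by blast
  define a where "a = scale_length q B D"
  define b where "b = scale_height q B D"
  have a: "0 < a" and b: "0 < b"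
    unfolding a_def b_def using scale_length_pos[OF B D(1)] scale_height_pos[OF B D(1)] by auto
  define k where "k = rescaling q B D l"
  define kd where "kd x = b * a * deriv h (x\<^sub>0 + a * x)" for x
  have k: "k x = b * l (a * x)" for x by (simp add: k_def rescaling_eq a_def b_def)
  have k_pos: "0 < k x" for x using b pos by (simp add: k l_def)
  have scl: "((\<lambda>x. a * x) has_real_derivative a) (at x)" for x by (auto intro!: derivative_eq_intros)
  have DERIV_k: "(k has_real_derivative kd x) (at x)" for x
    using DERIV_cmult[OF DERIV_chain2[where f = l and g = "\<lambda>x. a * x", OF dl(1) scl], of b x]
    by (simp add: k[abs_def] kd_def mult_ac)
  have DERIV_kd: "(kd has_real_derivative - force q (k x)) (at x)" for x
  proof -
    have "(deriv ^^ 2) h (x\<^sub>0 + a * x) = - (if q = 0 then B * ln (l (a * x)) - D else (B * l (a * x) powr q - D) / q)"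
      using ode_l ddl unfolding steady_ode_def by (metis add_eq_0_iff2)
    moreover have "force q (k x) = a\<^sup>2 * b * (if q = 0 then B * ln (l (a * x)) - D else (B * l (a * x) powr q - D) / q)"
      unfolding k a_def b_def by (rule scale_force[OF B]) (use D(1) pos in \<open>auto simp: l_def\<close>)
    ultimately have "b * a * ((deriv ^^ 2) h (x\<^sub>0 + a * x) * a) = - force q (k x)"
      by (simp add: power2_eq_square)
    then show ?thesis
      using DERIV_cmult[OF DERIV_chain2[where f = "\<lambda>x. deriv h (x\<^sub>0 + x)" and g = "\<lambda>x. a * x", OF dl(2) scl], of "b * a" x]
      by (simp add: kd_def[abs_def])
  qed
  have "deriv h x\<^sub>0 = 0"
    by (rule DERIV_local_min[OF d0, of 1]) (use min in auto)
  then have kd0: "kd 0 = 0" by (simp add: kd_def)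
  define S where "S = T / a"
  have S: "0 < S" "k (x + S) = k x" for x
  proof -
    have "x\<^sub>0 + a * (x + S) = (x\<^sub>0 + a * x) + T" using a by (simp add: S_def field_simps)
    then show "k (x + S) = k x" unfolding k l_def by (simp only: T(2))
  qed (use a T in \<open>simp add: S_def\<close>)
  have kdS: "kd (0 + S) = kd 0"
    using DERIV_shift[THEN iffD1, OF DERIV_k[of "0 + S"]] S(2) DERIV_k[of 0] DERIV_unique by simp blast
  define \<alpha> where "\<alpha> = k 0"
  have kmin: "\<alpha> \<le> k x" for x using min b by (simp add: \<alpha>_def k l_def)
  \<comment> \<open>The force vanishes somewhere in a period, so \<open>k\<close> takes the
    equilibrium value 1 and its minimum is at most 1.\<close>
  obtain z where "kd S - kd 0 = (S - 0) * - force q (k z)"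
    using MVT2[OF S(1), of kd "\<lambda>x. - force q (k x)"] DERIV_kd by blast
  then have "force q (k z) = 0" using kdS S(1) by simp
  then have "k z = 1" using force_eq_0_iff k_pos by blast
  then have le: "\<alpha> \<le> 1" using kmin[of z] by simp
  have "\<alpha> \<noteq> 1"
  proof
    assume "\<alpha> = 1"
    \<comment> \<open>Starting at rest in the equilibrium, the solution is constant by uniqueness,
      which contradicts that \<open>h\<close> is not constant.\<close>
    have "k = (\<lambda>_. 1)"
      by (rule force_ode_unique[OF k_pos DERIV_k DERIV_kd, where ld = "\<lambda>_. 0"])
        (use \<open>\<alpha> = 1\<close> kd0 in \<open>auto simp: \<alpha>_def\<close>)
    then have "h x = 1 / b" for x
      using k[of "(x - x\<^sub>0) / a"] a b by (simp add: l_def field_simps)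
    then show False using nonconst by (auto simp: constant_on_def)
  qed
  then have \<alpha>: "0 < \<alpha>" "\<alpha> < 1" using le k_pos[of 0] by (auto simp: \<alpha>_def)
  obtain k1 kd1 where w: "wave q \<alpha> (half_period q \<alpha>) k1 kd1" using wave_data[OF \<alpha>] by metis
  interpret w: wave q \<alpha> "half_period q \<alpha>" k1 kd1 by (rule w)
  have "k = k1"
    by (rule force_ode_unique[OF k_pos DERIV_k DERIV_kd w.k_pos w.DERIV_k w.DERIV_kd])
      (use kd0 in \<open>auto simp: \<alpha>_def[symmetric] w.k_0 w.kd_0\<close>)
  then have "rescaling q B D l = k_fun q \<alpha>" using w.k_fun_eq by (simp add: k_def)
  then have "rescales_to q B l \<alpha>"
    unfolding rescales_to_def using ode_l D(1) min by (auto simp: l_def)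
  then show ?thesis using \<alpha> unfolding l_def[abs_def] by auto
qed

theorem theorem6:
  fixes m n B q X x\<^sub>0 :: real and h H :: "real \<Rightarrow> real"
  assumes "B > 0"
    and "q = m - n + 1"
    and "\<And>y. y > 0 \<Longrightarrow> H differentiable (at y)"
    and "\<And>y. y > 0 \<Longrightarrow> (deriv H has_real_derivative B * y powr (q - 1)) (at y)"
    and "positive_periodic_steady_state m n B h"
    and "\<not> h constant_on UNIV"
    and "is_least_period h X"
    and "\<And>x. h x\<^sub>0 \<le> h x"
  shows "(\<exists>\<alpha>\<in>{0<..<1}. rescales_to q B (\<lambda>x. h (x\<^sub>0 + x)) \<alpha>) \<and>
    (q \<ge> 2 \<or> q < 1 \<longrightarrow> energy H X h > energy H X (\<lambda>_. mean_value X h)) \<and>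
    (q = 1 \<longrightarrow> energy H X h = energy H X (\<lambda>_. mean_value X h)) \<and>
    (\<forall>\<alpha>\<in>{0<..<1}. rescales_to q B (\<lambda>x. h (x\<^sub>0 + x)) \<alpha> \<longrightarrow>
      (1 < q \<and> q < 2 \<and> (\<forall>\<beta>\<in>{\<alpha><..<1}. \<exists>d>0. (E_fun q has_real_derivative d) (at \<beta>)) \<longrightarrow>
         energy H X h > energy H X (\<lambda>_. mean_value X h)) \<and>
      (1 < q \<and> q < 2 \<and> (\<forall>\<beta>\<in>{\<alpha><..<1}. \<exists>d<0. (E_fun q has_real_derivative d) (at \<beta>)) \<longrightarrow>
         energy H X h < energy H X (\<lambda>_. mean_value X h)))"
proof -
  let ?gap = "energy H X h - energy H X (\<lambda>_. mean_value X h)"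
  have gap: "\<exists>C>0. ?gap = C * half_gap q \<alpha>"
    if "0 < \<alpha>" "\<alpha> < 1" "rescales_to q B (\<lambda>x. h (x\<^sub>0 + x)) \<alpha>" for \<alpha>
    using energy_gap_rescales_to[OF assms(1,3,4,7) that] by blast
  have ex: "\<exists>\<alpha>\<in>{0<..<1}. rescales_to q B (\<lambda>x. h (x\<^sub>0 + x)) \<alpha>"
    by (rule steady_state_rescales[OF assms(1,2,5,6,8)])
  then obtain \<alpha> C where \<alpha>: "0 < \<alpha>" "\<alpha> < 1" and C: "0 < C" "?gap = C * half_gap q \<alpha>"
    using gap by force
  have 1: "0 < ?gap" if "q \<ge> 2 \<or> q < 1"
    unfolding C(2) using half_gap_cases(1)[OF \<alpha> that] C(1) by simp
  have 2: "?gap = 0" if "q = 1"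
    unfolding C(2) using half_gap_cases(2)[OF \<alpha> that] by simp
  \<comment> \<open>The value 1 of \<sigma> serves E increasing and -1 serves E decreasing, for
    every \<alpha> to which the steady state rescales.\<close>
  have 3: "0 < \<sigma> * ?gap"
    if r: "0 < \<alpha>" "\<alpha> < 1" "rescales_to q B (\<lambda>x. h (x\<^sub>0 + x)) \<alpha>" "1 < q"
      "\<And>\<beta>. \<alpha> < \<beta> \<Longrightarrow> \<beta> < 1 \<Longrightarrow> \<exists>d. (E_fun q has_real_derivative d) (at \<beta>) \<and> 0 < \<sigma> * d" for \<alpha> \<sigma>
  proof -
    obtain C where C: "0 < C" "?gap = C * half_gap q \<alpha>" using gap[OF r(1-3)] by blast
    have "0 < C * (\<sigma> * half_gap q \<alpha>)" using half_gap_sign[OF r(1,2,4,5)] C(1) by simp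
    then show ?thesis unfolding C(2) by (simp add: mult_ac)
  qed
  have 4: "energy H X h > energy H X (\<lambda>_. mean_value X h)"
    if "\<alpha> \<in> {0<..<1}" "rescales_to q B (\<lambda>x. h (x\<^sub>0 + x)) \<alpha>" "1 < q"
      "\<forall>\<beta>\<in>{\<alpha><..<1}. \<exists>d>0. (E_fun q has_real_derivative d) (at \<beta>)" for \<alpha>
  proof -
    have "\<exists>d. (E_fun q has_real_derivative d) (at \<beta>) \<and> 0 < 1 * d" if "\<alpha> < \<beta>" "\<beta> < 1" for \<beta>
      using bspec[OF \<open>\<forall>\<beta>\<in>{\<alpha><..<1}. _ \<beta>\<close>, of \<beta>] that by auto
    then have "0 < 1 * ?gap" using that(1-3) by (intro 3[of \<alpha>]) auto
    then show ?thesis by simp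
  qed
  have 5: "energy H X h < energy H X (\<lambda>_. mean_value X h)"
    if "\<alpha> \<in> {0<..<1}" "rescales_to q B (\<lambda>x. h (x\<^sub>0 + x)) \<alpha>" "1 < q"
      "\<forall>\<beta>\<in>{\<alpha><..<1}. \<exists>d<0. (E_fun q has_real_derivative d) (at \<beta>)" for \<alpha>
  proof -
    have "\<exists>d. (E_fun q has_real_derivative d) (at \<beta>) \<and> 0 < - 1 * d" if "\<alpha> < \<beta>" "\<beta> < 1" for \<beta>
      using bspec[OF \<open>\<forall>\<beta>\<in>{\<alpha><..<1}. _ \<beta>\<close>, of \<beta>] that by auto
    then have "0 < - 1 * ?gap" using that(1-3) by (intro 3[of \<alpha>]) auto
    then show ?thesis by simp
  qed
  show ?thesis using ex 1 2 4 5 by auto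
qed

end
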